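(* For every complex number $v\neq0$, the varieties $\mathcal{C}_{3,v}$ and $\mathcal{C}_3$ are isomorphic.
   Context: For $v\in\mathbb{C}$, $\mathcal{C}_{3,v}$ denotes the affine variety with coordinate ring $\mathbb{C}[a_1,a_2]\otimes\mathbb{C}[a_3,\dots,a_9]/(r_1,r_2,r_3,r_4,r_5)$, where $r_1=a_3a_9-2a_4a_8+a_5a_7$, $r_2=a_3a_8-2a_4a_7+a_5a_6$, $r_3=a_3(a_3a_5-a_4^2-3v)+6(a_6a_8-a_7^2)$, $r_4=a_4(a_3a_5-a_4^2-3v)+3(a_6a_9-a_7a_8)$, $r_5=a_5(a_3a_5-a_4^2-3v)+6(a_7a_9-a_8^2)$. (It sits inside $(\mathcal{M}_3\times\mathcal{M}_3)/\!/\mathrm{GL}_3$ for each choice of $w$ with $w^2+\frac{4v^3}{27}=0$, the $a_i$ being the invariants $a_1=\mathrm{Tr}(X)$, $a_2=\mathrm{Tr}(Y)$, $a_3=\mathrm{Tr}(A^2)$, $a_4=\mathrm{Tr}(AB)$, $a_5=\mathrm{Tr}(B^2)$, $a_6=\mathrm{Tr}(A^3)$, $a_7=\mathrm{Tr}(A^2B)$, $a_8=\mathrm{Tr}(AB^2)$, $a_9=\mathrm{Tr}(B^3)$ with $A=X-\frac13\mathrm{Tr}(X)I_3$, $B=Y-\frac13\mathrm{Tr}(Y)I_3$.) $\mathcal{C}_3$ is the Calogero-Moser space: the quotient $\bar{\mathcal{C}}_3/\!/\mathrm{GL}_3(\mathbb{C})$ of $\bar{\mathcal{C}}_3=\{(X,Y)\in\mathcal{M}_3\times\mathcal{M}_3:\mathrm{rank}([X,Y]+I_3)=1\}$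 by simultaneous conjugation, where $\mathcal{M}_3$ is the algebra of complex $3\times3$ matrices. *)

theory Defs
  imports
    "HOL-Analysis.Analysis"
    "HOL-Algebra.QuotRing"
    "HOL-Library.Poly_Mapping"
begin

section \<open>Affine varieties over the complex numbers\<close>

text \<open>
  A commutative \<open>\<complex>\<close>-algebra is a ring together with its structure map \<open>scalar\<close> from the complex
  numbers.  An affine variety is given by its coordinate algebra \<open>A\<close>; its points are the
  \<open>\<complex>\<close>-algebra homomorphisms \<open>x\<close> from \<open>A\<close> to \<open>\<complex>\<close>, and the value of a regular function
  \<open>f\<close> at the point \<open>x\<close> is \<open>x f\<close>.
\<close>

record 'a calg = "'a ring" +
  scalar :: "complex \<Rightarrow> 'a"

definition complex_alg :: "complex calg" where
  "complex_alg = \<lparr>carrier = UNIV, mult = (*), one = 1, zero = 0, add = (+), scalar = (\<lambda>c. c)\<rparr>"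

definition calg_hom :: "'a calg \<Rightarrow> 'b calg \<Rightarrow> ('a \<Rightarrow> 'b) set" where
  "calg_hom A B = {\<psi> \<in> ring_hom A B. \<forall>c. \<psi> (scalar A c) = scalar B c}"

text \<open>Extensionality makes a point determined by its values on the carrier.\<close>

definition points :: "'a calg \<Rightarrow> ('a \<Rightarrow> complex) set" where
  "points A = calg_hom A complex_alg \<inter> extensional (carrier A)"

text \<open>
  An isomorphism of varieties is a bijection \<open>\<phi>\<close> of points whose comorphism \<open>\<psi>\<close>, pulling back
  regular functions along \<open>\<phi>\<close>, is an isomorphism of the coordinate algebras.  The comorphism is
  part of the data, so that the notion is also the right one (isomorphism of affine schemes) if
  nilpotent functions are not excluded beforehand.
\<close>

definition isomorphic_varieties :: "'a calg \<Rightarrow> 'b calg \<Rightarrow> bool" where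
  "isomorphic_varieties A B \<longleftrightarrow>
     (\<exists>\<phi> \<psi>. bij_betw \<phi> (points A) (points B) \<and>
            \<psi> \<in> calg_hom B A \<and> bij_betw \<psi> (carrier B) (carrier A) \<and>
            (\<forall>x\<in>points A. \<forall>f\<in>carrier B. \<phi> x f = x (\<psi> f)))"

definition quot_calg :: "'a calg \<Rightarrow> 'a set \<Rightarrow> 'a set calg" where
  "quot_calg A I = ring.extend (A Quot I) \<lparr>scalar = (\<lambda>c. I +>\<^bsub>A\<^esub> scalar A c)\<rparr>"


section \<open>The variety \<open>\<C>\<^sub>3\<^sub>,\<^sub>v\<close>\<close>

text \<open>
  Polynomials are finitely supported maps from monomials to coefficients, a monomial being a
  finitely supported map from variable indices to exponents.
\<close>

type_synonym cpoly = "(nat \<Rightarrow>\<^sub>0 nat) \<Rightarrow>\<^sub>0 complex"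

definition Cst :: "complex \<Rightarrow> cpoly" where
  "Cst c = Poly_Mapping.single 0 c"

definition Var :: "nat \<Rightarrow> cpoly" where
  "Var i = Poly_Mapping.single (Poly_Mapping.single i 1) 1"

definition poly_calg :: "nat set \<Rightarrow> cpoly calg" where
  "poly_calg V =
     \<lparr>carrier = {p. \<forall>m\<in>Poly_Mapping.keys p. Poly_Mapping.keys m \<subseteq> V},
      mult = (*), one = 1, zero = 0, add = (+), scalar = Cst\<rparr>"

definition r1 :: cpoly where
  "r1 = Var 3 * Var 9 - Cst 2 * Var 4 * Var 8 + Var 5 * Var 7"

definition r2 :: cpoly where
  "r2 = Var 3 * Var 8 - Cst 2 * Var 4 * Var 7 + Var 5 * Var 6"

definition r3 :: "complex \<Rightarrow> cpoly" where
  "r3 v = Var 3 * (Var 3 * Var 5 - Var 4 ^ 2 - Cst (3 * v)) + Cst 6 * (Var 6 * Var 8 - Var 7 ^ 2)"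

definition r4 :: "complex \<Rightarrow> cpoly" where
  "r4 v = Var 4 * (Var 3 * Var 5 - Var 4 ^ 2 - Cst (3 * v)) + Cst 3 * (Var 6 * Var 9 - Var 7 * Var 8)"

definition r5 :: "complex \<Rightarrow> cpoly" where
  "r5 v = Var 5 * (Var 3 * Var 5 - Var 4 ^ 2 - Cst (3 * v)) + Cst 6 * (Var 7 * Var 9 - Var 8 ^ 2)"

text \<open>
  The variables 1 and 2 do not occur in the relations, so this is the tensor product of the
  polynomial algebra in them with the quotient of the polynomial algebra in the other seven.
\<close>

definition C3v :: "complex \<Rightarrow> cpoly set calg" where
  "C3v v = quot_calg (poly_calg {1..9}) (genideal (poly_calg {1..9}) {r1, r2, r3 v, r4 v, r5 v})"


section \<open>The Calogero-Moser space \<open>\<C>\<^sub>3\<close>\<close>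

type_synonym mat3 = "complex ^ 3 ^ 3"

definition CMbar :: "(mat3 \<times> mat3) set" where
  "CMbar = {(X, Y). rank ((X ** Y - Y ** X) + mat 1) = 1}"

inductive_set polyfuns :: "(mat3 \<times> mat3 \<Rightarrow> complex) set" where
  const: "(\<lambda>_. c) \<in> polyfuns"
| entry_fst: "(\<lambda>(X, Y). X $ i $ j) \<in> polyfuns"
| entry_snd: "(\<lambda>(X, Y). Y $ i $ j) \<in> polyfuns"
| add: "f \<in> polyfuns \<Longrightarrow> g \<in> polyfuns \<Longrightarrow> (\<lambda>p. f p + g p) \<in> polyfuns"
| mult: "f \<in> polyfuns \<Longrightarrow> g \<in> polyfuns \<Longrightarrow> (\<lambda>p. f p * g p) \<in> polyfuns"

text \<open>
  Regular functions on a Zariski closed set are the restrictions of polynomial functions.  The set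
  \<open>CMbar\<close> is closed: its defining condition is equivalent to rank at most 1, since the matrix has
  trace 3 and so cannot vanish.
\<close>

definition regular_calg :: "(mat3 \<times> mat3) set \<Rightarrow> (mat3 \<times> mat3 \<Rightarrow> complex) calg" where
  "regular_calg S =
     \<lparr>carrier = (\<lambda>f. restrict f S) ` polyfuns,
      mult = (\<lambda>f g. restrict (\<lambda>p. f p * g p) S), one = restrict (\<lambda>_. 1) S,
      zero = restrict (\<lambda>_. 0) S, add = (\<lambda>f g. restrict (\<lambda>p. f p + g p) S),
      scalar = (\<lambda>c. restrict (\<lambda>_. c) S)\<rparr>"

definition conj_act :: "mat3 \<Rightarrow> mat3 \<times> mat3 \<Rightarrow> mat3 \<times> mat3" where
  "conj_act g = (\<lambda>(X, Y). (g ** X ** matrix_inv g, g ** Y ** matrix_inv g))"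

text \<open>
  The quotient of an affine variety \<open>S\<close> by simultaneous conjugation is the affine variety whose
  regular functions are the invariant regular functions on \<open>S\<close>.
\<close>

definition GL3_quotient :: "(mat3 \<times> mat3) set \<Rightarrow> (mat3 \<times> mat3 \<Rightarrow> complex) calg" where
  "GL3_quotient S = (regular_calg S)
     \<lparr>carrier := {f \<in> carrier (regular_calg S).
        \<forall>g. invertible g \<longrightarrow> (\<forall>p\<in>S. f (conj_act g p) = f p)}\<rparr>"

definition C3 :: "(mat3 \<times> mat3 \<Rightarrow> complex) calg" where
  "C3 = GL3_quotient CMbar"

end

theory Submission
  imports Defs "HOL-Computational_Algebra.Fundamental_Theorem_Algebra"
begin

text \<open>
  Let \<open>A\<close>, \<open>B\<close> be the traceless parts of a Calogero--Moser pair, so that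
  \<open>P = [A, B] + 1\<close> has the form \<open>i j\<^sup>T\<close>.  The Cayley--Hamilton theorem and the rule
  \<open>tr (u A B w) = tr (u B A w) + tr (w u P) - tr (w u)\<close> show that the nine traces satisfy the five
  relations with \<open>v = -3\<close>; the relations being homogeneous when \<open>v\<close> has degree 4, rescaling
  the traces by powers of \<open>l\<close> reaches every \<open>v = -3l\<^sup>4\<close>.  The traces thus define a homomorphism
  from the polynomial ring in nine variables to the invariant functions.

  It is surjective: if two triples of words \<open>w\<close> and \<open>w'\<close> make \<open>h = det (j w' w i)\<close> nonzero,
  then in the basis \<open>w i\<close> the entries of the pair are polynomials in the traces divided by \<open>h\<close>.
  Hence an invariant function times a power of \<open>h\<close> is a polynomial in the traces, and the
  various \<open>h\<close> generate the unit ideal.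

  Its kernel is generated by the relations: modulo them every polynomial is a combination of
  \<open>1\<close>, \<open>a\<^sub>4\<close>, \<open>a\<^sub>4\<^sup>2\<close>, \<open>a\<^sub>4\<^sup>3\<close>, \<open>a\<^sub>7\<close>, \<open>a\<^sub>8\<close> over the polynomials in the other
  variables, and over a generic value of the latter there are six points of the variety, all
  coming from Calogero--Moser pairs \<open>(diag x, Y)\<close> with \<open>Y\<close> having entries
  \<open>1 / (x\<^sub>i - x\<^sub>j)\<close> off the diagonal, which force such a combination to vanish.
\<close>

section \<open>Evaluation of polynomials\<close>

text \<open>Rank one is what makes the invariants computable. The vectors \<open>w i\<close> move
  with the pair under conjugation, so three independent ones give a basis in which the pair has a
  normal form depending only on its orbit. No single triple of words works everywhere, so an
  invariant function is known only up to powers of several denominators; an explicit combination of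
  these equal to 108 removes them. For the kernel, comparing points is not enough by itself, because
  the ideal of the relations is not known beforehand to be radical. Reduction to a normal form
  inside the ideal comes before any evaluation, and evaluation is then applied only to the
  coefficients of the normal form. The argument closes because the number of basis elements equals
  the number of points over a generic value of the base variables, both being six. The constant
  \<open>v = -3\<close> goes back to \<open>tr P = 3\<close>: the swap rule applied in the empty
  context yields \<open>3 * 3 - 3 = 6\<close>, and this shift propagates to the 9 in the last three
  relations.\<close>

definition mono_eval :: "(nat \<Rightarrow> complex) \<Rightarrow> (nat \<Rightarrow>\<^sub>0 nat) \<Rightarrow> complex" where
  "mono_eval \<phi> m = (\<Prod>i\<in>Poly_Mapping.keys m. \<phi> i ^ Poly_Mapping.lookup m i)"

definition ev :: "(nat \<Rightarrow> complex) \<Rightarrow> cpoly \<Rightarrow> complex" where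
  "ev \<phi> p = (\<Sum>m\<in>Poly_Mapping.keys p. Poly_Mapping.lookup p m * mono_eval \<phi> m)"

lemma mono_eval_superset:
  assumes "finite A" "Poly_Mapping.keys m \<subseteq> A"
  shows "mono_eval \<phi> m = (\<Prod>i\<in>A. \<phi> i ^ Poly_Mapping.lookup m i)"
  unfolding mono_eval_def
  by (rule prod.mono_neutral_left) (use assms in \<open>auto simp: in_keys_iff\<close>)

lemma mono_eval_add: "mono_eval \<phi> (m + n) = mono_eval \<phi> m * mono_eval \<phi> n"
proof -
  let ?A = "Poly_Mapping.keys m \<union> Poly_Mapping.keys n"
  have "Poly_Mapping.keys (m + n) \<subseteq> ?A" by (rule Poly_Mapping.keys_add)
  then show ?thesis
    by (simp add: mono_eval_superset[of ?A] lookup_add power_add prod.distrib)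
qed

lemma ev_superset:
  assumes "finite A" "Poly_Mapping.keys p \<subseteq> A"
  shows "ev \<phi> p = (\<Sum>m\<in>A. Poly_Mapping.lookup p m * mono_eval \<phi> m)"
  unfolding ev_def
  by (rule sum.mono_neutral_left) (use assms in \<open>auto simp: in_keys_iff\<close>)

lemma ev_add [simp]: "ev \<phi> (p + q) = ev \<phi> p + ev \<phi> q"
proof -
  let ?A = "Poly_Mapping.keys p \<union> Poly_Mapping.keys q"
  have "Poly_Mapping.keys (p + q) \<subseteq> ?A" by (rule Poly_Mapping.keys_add)
  then show ?thesis
    by (simp add: ev_superset[of ?A] lookup_add sum.distrib distrib_right)
qed

lemma ev_single: "ev \<phi> (Poly_Mapping.single m c) = c * mono_eval \<phi> m"
  by (simp add: ev_def)

lemma ev_zero [simp]: "ev \<phi> 0 = 0"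
  by (simp add: ev_def)

lemma ev_sum: "ev \<phi> (sum f A) = (\<Sum>x\<in>A. ev \<phi> (f x))"
  by (induction A rule: infinite_finite_induct) auto

lemma poly_sum_singles:
  fixes p :: cpoly
  shows "p = (\<Sum>m\<in>Poly_Mapping.keys p. Poly_Mapping.single m (Poly_Mapping.lookup p m))"
proof (rule poly_mapping_eqI)
  fix k
  show "Poly_Mapping.lookup p k =
    Poly_Mapping.lookup (\<Sum>m\<in>Poly_Mapping.keys p. Poly_Mapping.single m (Poly_Mapping.lookup p m)) k"
    by (cases "k \<in> Poly_Mapping.keys p")
      (auto simp: lookup_sum lookup_single when_def in_keys_iff)
qed

lemma ev_mult [simp]: "ev \<phi> (p * q) = ev \<phi> p * ev \<phi> q"
proof -
  have "p * q = (\<Sum>m\<in>Poly_Mapping.keys p. \<Sum>n\<in>Poly_Mapping.keys q.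
      Poly_Mapping.single (m + n) (Poly_Mapping.lookup p m * Poly_Mapping.lookup q n))"
    by (subst (1) poly_sum_singles[of p], subst (1) poly_sum_singles[of q])
      (simp add: sum_product mult_single)
  then show ?thesis
    by (simp add: ev_sum ev_single mono_eval_add)
      (simp add: ev_def sum_product algebra_simps)
qed

lemma ev_Cst [simp]: "ev \<phi> (Cst c) = c"
  by (simp add: Cst_def ev_single mono_eval_def)

lemma ev_Var [simp]: "ev \<phi> (Var i) = \<phi> i"
  by (simp add: Var_def ev_single mono_eval_def)

lemma Cst_mult: "Cst (a * b) = Cst a * Cst b"
  by (simp add: Cst_def mult_single)

lemma Cst_0: "Cst 0 = 0"
  by (simp add: Cst_def)

lemma Cst_1: "Cst 1 = 1"
  by (simp add: Cst_def)

lemma Cst_numeral: "Cst (numeral n) = numeral n"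
  by (simp add: Cst_def)

lemma ev_one [simp]: "ev \<phi> 1 = 1"
  using ev_Cst[of \<phi> 1] by (simp add: Cst_1)

lemma ev_numeral [simp]: "ev \<phi> (numeral n) = numeral n"
  using ev_Cst[of \<phi> "numeral n"] by (simp add: Cst_numeral)

lemma ev_uminus [simp]: "ev \<phi> (- p) = - ev \<phi> p"
  using ev_add[of \<phi> p "- p"] by (simp add: eq_neg_iff_add_eq_0 add.commute)

lemma ev_diff [simp]: "ev \<phi> (p - q) = ev \<phi> p - ev \<phi> q"
  using ev_add[of \<phi> p "- q"] by simp

lemma ev_power [simp]: "ev \<phi> (p ^ n) = ev \<phi> p ^ n"
  by (induction n) auto

section \<open>Polynomials in a given set of variables\<close>

definition polys :: "nat set \<Rightarrow> cpoly set" where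
  "polys V = {p. \<forall>m\<in>Poly_Mapping.keys p. Poly_Mapping.keys m \<subseteq> V}"

lemma polys_mono: "V \<subseteq> W \<Longrightarrow> polys V \<subseteq> polys W"
  by (auto simp: polys_def)

lemma polys_Cst [simp, intro]: "Cst c \<in> polys V"
  by (auto simp: polys_def Cst_def)

lemma polys_Var [intro]: "i \<in> V \<Longrightarrow> Var i \<in> polys V"
  by (auto simp: polys_def Var_def)

lemma polys_add [intro]: "p \<in> polys V \<Longrightarrow> q \<in> polys V \<Longrightarrow> p + q \<in> polys V"
  unfolding polys_def using Poly_Mapping.keys_add[of p q] by blast

lemma polys_mult [intro]:
  assumes "p \<in> polys V" "q \<in> polys V"
  shows "p * q \<in> polys V"
proof -
  have "Poly_Mapping.keys m \<subseteq> V" if "m \<in> Poly_Mapping.keys (p * q)" for m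
  proof -
    from that obtain a b where "a \<in> Poly_Mapping.keys p" "b \<in> Poly_Mapping.keys q" "m = a + b"
      using Poly_Mapping.keys_mult[of p q] by blast
    then show ?thesis
      using assms Poly_Mapping.keys_add[of a b] unfolding polys_def by blast
  qed
  then show ?thesis by (simp add: polys_def)
qed

lemma polys_uminus [intro]: "p \<in> polys V \<Longrightarrow> - p \<in> polys V"
  by (auto simp: polys_def)

lemma polys_diff [intro]: "p \<in> polys V \<Longrightarrow> q \<in> polys V \<Longrightarrow> p - q \<in> polys V"
  using polys_add[of p V "- q"] by auto

lemma polys_numeral [simp, intro]: "numeral n \<in> polys V"
  using polys_Cst[of "numeral n" V] by (simp add: Cst_numeral)

lemma polys_one [simp, intro]: "1 \<in> polys V"
  using polys_Cst[of 1 V] by (simp add: Cst_1)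

lemma polys_zero [simp, intro]: "0 \<in> polys V"
  by (simp add: polys_def)

lemma polys_power [intro]: "p \<in> polys V \<Longrightarrow> p ^ n \<in> polys V"
  by (induction n) auto

text \<open>The induction runs over the total degree of a monomial and peels off one variable at a
  time. In this form, a set closed under sums and containing the constants need only be stable under
  multiplication by each single variable.\<close>

lemma polys_induct [consumes 1, case_names Cst add Var]:
  assumes p: "p \<in> polys V"
    and Cst: "\<And>c. P (Cst c)"
    and add: "\<And>p q. P p \<Longrightarrow> P q \<Longrightarrow> P (p + q)"
    and Var: "\<And>i p. i \<in> V \<Longrightarrow> p \<in> polys V \<Longrightarrow> P p \<Longrightarrow> P (Var i * p)"
  shows "P p"
proof -
  have single: "P (Poly_Mapping.single m c)"
    if "sum (Poly_Mapping.lookup m) (Poly_Mapping.keys m) = d" "Poly_Mapping.keys m \<subseteq> V" for m c d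
    using that
  proof (induction d arbitrary: m)
    case 0
    then have "m = 0" by (auto simp: in_keys_iff intro!: poly_mapping_eqI)
    then show ?case using Cst[of c] by (simp add: Cst_def)
  next
    case (Suc d)
    then obtain i where i: "i \<in> Poly_Mapping.keys m" by fastforce
    define n where "n = m - Poly_Mapping.single i 1"
    have m: "m = Poly_Mapping.single i 1 + n"
      using i by (intro poly_mapping_eqI)
        (auto simp: n_def lookup_add lookup_minus lookup_single when_def in_keys_iff)
    have lk: "Poly_Mapping.lookup n k = (if k = i then Poly_Mapping.lookup m k - 1 else Poly_Mapping.lookup m k)" for k
      by (auto simp: n_def lookup_minus lookup_single when_def)
    have keys: "Poly_Mapping.keys n \<subseteq> Poly_Mapping.keys m"
      by (auto simp: in_keys_iff lk split: if_splits)
    have "sum (Poly_Mapping.lookup n) (Poly_Mapping.keys n) = sum (Poly_Mapping.lookup n) (Poly_Mapping.keys m)"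
      by (rule sum.mono_neutral_left) (use keys in \<open>auto simp: in_keys_iff\<close>)
    also have "\<dots> = d"
    proof -
      have "sum (Poly_Mapping.lookup m) (Poly_Mapping.keys m) =
          (\<Sum>k\<in>Poly_Mapping.keys m. (if k = i then 1 else 0) + Poly_Mapping.lookup n k)"
        by (rule sum.cong) (use i in \<open>auto simp: lk in_keys_iff\<close>)
      then show ?thesis using Suc.prems(1) i by (simp add: sum.distrib)
    qed
    finally have "P (Poly_Mapping.single n c)"
      using Suc.IH keys Suc.prems(2) by blast
    moreover have "Poly_Mapping.single m c = Var i * Poly_Mapping.single n c"
      by (simp add: Var_def mult_single m)
    moreover have "Poly_Mapping.single n c \<in> polys V"
      using keys Suc.prems(2) by (auto simp: polys_def)
    ultimately show ?case using Var[of i] i Suc.prems(2) by auto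
  qed
  have "P (\<Sum>m\<in>A. Poly_Mapping.single m (Poly_Mapping.lookup p m))"
    if "finite A" "A \<subseteq> Poly_Mapping.keys p" for A
    using that
  proof (induction A rule: finite_induct)
    case empty
    show ?case using Cst[of 0] by (simp add: Cst_0)
  next
    case (insert m A)
    have "P (Poly_Mapping.single m (Poly_Mapping.lookup p m))"
      using p insert.prems by (intro single[OF refl]) (auto simp: polys_def)
    then show ?case using insert by (simp add: add)
  qed
  then show ?thesis using poly_sum_singles[of p] by (metis finite_keys order_refl)
qed

lemma continuous_ev:
  assumes "\<And>i. isCont (\<lambda>t. \<phi> t i) x"
  shows "isCont (\<lambda>t. ev (\<phi> t) p) x"
  unfolding ev_def mono_eval_def
  by (intro continuous_intros assms)

lemma ev_cong:
  assumes "p \<in> polys V" "\<And>i. i \<in> V \<Longrightarrow> \<phi> i = \<psi> i"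
  shows "ev \<phi> p = ev \<psi> p"
  using assms(1) by (induction rule: polys_induct) (auto simp: assms(2))

text \<open>
  Evaluating at powers of distinct primes separates the monomials, and interpolation
  polynomials then isolate each coefficient.
\<close>

lemma poly_eq_zero_if_ev_zero:
  assumes "\<And>\<phi>. ev \<phi> p = 0"
  shows "p = 0"
proof -
  define pr :: "nat \<Rightarrow> nat" where "pr = enumerate {q. prime q}"
  have pr: "prime (pr i)" for i
    using enumerate_in_set[OF primes_infinite] by (auto simp: pr_def)
  have inj_pr: "inj pr"
    using strict_mono_enumerate[OF primes_infinite] by (auto simp: pr_def strict_mono_imp_inj_on)
  define val :: "(nat \<Rightarrow>\<^sub>0 nat) \<Rightarrow> nat"
    where "val m = (\<Prod>i\<in>Poly_Mapping.keys m. pr i ^ Poly_Mapping.lookup m i)" for m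
  have inj_val: "m = n" if "val m = val n" for m n
  proof (rule poly_mapping_eqI)
    fix i
    have mult: "multiplicity (pr i) (val m) = Poly_Mapping.lookup m i" for m
    proof -
      let ?A = "pr ` Poly_Mapping.keys m" and ?f = "\<lambda>q. Poly_Mapping.lookup m (inv_into UNIV pr q)"
      have "val m = (\<Prod>q\<in>?A. q ^ ?f q)"
        using inj_pr by (simp add: val_def prod.reindex inj_on_subset inv_f_f)
      moreover have "multiplicity (pr i) (\<Prod>q\<in>?A. q ^ ?f q) = (if pr i \<in> ?A then ?f (pr i) else 0)"
        by (rule multiplicity_prod_prime_powers) (use pr in auto)
      ultimately show ?thesis
        using inj_pr by (auto simp: inv_f_f inj_image_mem_iff in_keys_iff)
    qed
    show "Poly_Mapping.lookup m i = Poly_Mapping.lookup n i"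
      using mult[of m] mult[of n] that by simp
  qed
  have mono: "mono_eval (\<lambda>i. of_nat (pr i) ^ k) m = of_nat (val m) ^ k" for k m
    by (simp add: mono_eval_def val_def prod_power_distrib) (simp flip: power_mult add: mult.commute)
  have pow: "(\<Sum>m\<in>Poly_Mapping.keys p. Poly_Mapping.lookup p m * of_nat (val m) ^ k) = 0" for k
    using assms[of "\<lambda>i. of_nat (pr i) ^ k"] by (simp add: ev_def mono)
  have pol: "(\<Sum>m\<in>Poly_Mapping.keys p. Poly_Mapping.lookup p m * poly f (of_nat (val m))) = 0" for f :: "complex poly"
  proof -
    have "(\<Sum>m\<in>Poly_Mapping.keys p. Poly_Mapping.lookup p m * poly f (of_nat (val m))) =
        (\<Sum>k\<le>degree f. coeff f k * (\<Sum>m\<in>Poly_Mapping.keys p. Poly_Mapping.lookup p m * of_nat (val m) ^ k))"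
      by (simp add: poly_altdef sum_distrib_left, subst sum.swap) (simp add: algebra_simps)
    then show ?thesis by (simp add: pow)
  qed
  have "Poly_Mapping.lookup p m = 0" for m
  proof (rule ccontr)
    assume nz: "Poly_Mapping.lookup p m \<noteq> 0"
    define L where "L = Poly_Mapping.keys p - {m}"
    define f :: "complex poly" where "f = (\<Prod>n\<in>L. [:- of_nat (val n), 1:])"
    have fin: "finite L" by (simp add: L_def)
    have f0: "poly f (of_nat (val n)) = 0" if "n \<in> L" for n
      unfolding f_def poly_prod using that fin by (intro prod_zero) auto
    have f1: "poly f (of_nat (val m)) \<noteq> 0"
      unfolding f_def poly_prod using inj_val fin by (auto simp: L_def)
    have "(\<Sum>n\<in>Poly_Mapping.keys p. Poly_Mapping.lookup p n * poly f (of_nat (val n))) =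
        Poly_Mapping.lookup p m * poly f (of_nat (val m))"
      using nz by (subst sum.remove[of _ m]) (auto simp: f0 L_def in_keys_iff intro!: sum.neutral)
    then show False using pol[of f] nz f1 by simp
  qed
  then show ?thesis by (intro poly_mapping_eqI) simp
qed

section \<open>Trace identities for pairs with rank one perturbed commutator\<close>

lemma mat_mult: "mat c ** M = (\<chi> a b. c * M $ a $ b)" for M :: mat3
  by (simp add: vec_eq_iff matrix_matrix_mult_def mat_def sum_3 forall_3)

lemma mult_mat: "M ** mat c = (\<chi> a b. c * M $ a $ b)" for M :: mat3
  by (simp add: vec_eq_iff matrix_matrix_mult_def mat_def sum_3 forall_3)

lemma mat_commute: "M ** mat c = mat c ** M" for M :: mat3
  by (simp add: mat_mult mult_mat)

lemma trace_mat_mult: "trace (mat c ** M) = c * trace M" for M :: mat3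
  by (simp add: mat_mult trace_def sum_distrib_left)

lemma trace_mat: "trace (mat c :: mat3) = 3 * c"
  by (simp add: trace_def mat_def)

text \<open>For trace zero, Newton's identities turn the characteristic polynomial into
  \<open>t^3 - (tr A^2 / 2) t - tr A^3 / 3\<close>.\<close>

lemma cayley_hamilton_traceless:
  fixes A :: mat3
  assumes "trace A = 0"
  shows "A ** A ** A = mat (trace (A ** A) / 2) ** A + mat (trace (A ** A ** A) / 3)"
proof -
  have "A $ 3 $ 3 = - A $ 1 $ 1 - A $ 2 $ 2"
    using assms by (simp add: trace_def sum_3 add_eq_0_iff algebra_simps)
  then show ?thesis
    apply (simp add: mat_mult vec_eq_iff forall_3 matrix_matrix_mult_def sum_3 trace_def mat_def)
    apply (intro conjI; simp add: field_simps)
    done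
qed

text \<open>This is the part linear in \<open>s\<close> of the previous identity for
  \<open>A + s B\<close>.\<close>

lemma cayley_hamilton_polarized:
  fixes A B :: mat3
  assumes "trace A = 0" "trace B = 0"
  shows "A ** A ** B + A ** B ** A + B ** A ** A =
    mat (trace (A ** B)) ** A + mat (trace (A ** A) / 2) ** B + mat (trace (A ** A ** B))"
proof -
  have "A $ 3 $ 3 = - A $ 1 $ 1 - A $ 2 $ 2" "B $ 3 $ 3 = - B $ 1 $ 1 - B $ 2 $ 2"
    using assms by (simp_all add: trace_def sum_3 add_eq_0_iff algebra_simps)
  then show ?thesis
    apply (simp add: mat_mult vec_eq_iff forall_3 matrix_matrix_mult_def sum_3 trace_def mat_def)
    apply (intro conjI; simp add: field_simps)
    done
qed

lemma matrix_diff_ldistrib: "A ** (B - C) = A ** B - A ** C" for A B C :: mat3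
  by (simp add: vec_eq_iff matrix_matrix_mult_def sum_3 algebra_simps)

lemma matrix_add_rdistrib: "(B + C) ** A = B ** A + C ** A" for A B C :: mat3
  by (simp add: vec_eq_iff matrix_matrix_mult_def sum_3 algebra_simps)

lemma matrix_diff_rdistrib: "(B - C) ** A = B ** A - C ** A" for A B C :: mat3
  by (simp add: vec_eq_iff matrix_matrix_mult_def sum_3 algebra_simps)

lemma trace_uminus: "trace (- M) = - trace M" for M :: mat3
  by (simp add: trace_def sum_3)

lemma matrix_minus_mult: "(- M) ** N = - (M ** N)" "M ** (- N) = - (M ** N)" for M N :: mat3
  by (simp_all add: vec_eq_iff matrix_matrix_mult_def sum_3)

lemma numeral_mult_cancel: "numeral n * x = numeral n * y \<Longrightarrow> x = y" for x y :: complex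
  by simp

locale cm_pair =
  fixes A B :: mat3 and i j :: "complex ^ 3"
  assumes trace_A: "trace A = 0" and trace_B: "trace B = 0"
    and rank_one: "A ** B - B ** A + mat 1 = (\<chi> a b. i $ a * j $ b)"
begin

definition P :: mat3 where "P = A ** B - B ** A + mat 1"

text \<open>As a trace it depends on \<open>A\<close> and \<open>B\<close> alone, not on the choice
  of \<open>i\<close> and \<open>j\<close>, although it equals \<open>j^T w i\<close>. It can
  therefore serve later as a function of the pair.\<close>

definition jj :: "mat3 \<Rightarrow> complex" where "jj w = trace (w ** P)"

lemma P_outer: "P = (\<chi> a b. i $ a * j $ b)"
  using rank_one by (simp add: P_def)

lemma AB_eq: "A ** B = B ** A + P - mat 1"
  by (simp add: P_def)

lemma jj_alt: "jj w = (\<Sum>k\<in>UNIV. j $ k * (w *v i) $ k)"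
  by (simp add: jj_def P_outer trace_def matrix_matrix_mult_def matrix_vector_mult_def sum_3)
    (simp add: algebra_simps)

lemma trace_PP: "trace (u ** P ** w ** P) = jj u * jj w"
  by (simp add: jj_def P_outer trace_def matrix_matrix_mult_def sum_3) (simp add: algebra_simps)

lemma jj_1: "jj (mat 1) = 3"
  by (simp add: jj_def P_def trace_add trace_sub trace_mat trace_mul_sym[of A B])

lemma trace_swap: "trace (u ** A ** B ** w) = trace (u ** B ** A ** w) + jj (w ** u) - trace (w ** u)"
  for u w :: mat3
proof -
  have "u ** A ** B ** w = u ** (B ** A + P - mat 1) ** w"
    by (metis AB_eq matrix_mul_assoc)
  also have "\<dots> = u ** B ** A ** w + u ** P ** w - u ** w"
    by (simp add: matrix_add_ldistrib matrix_add_rdistrib matrix_diff_ldistrib matrix_diff_rdistrib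
        matrix_mul_assoc)
  finally show ?thesis
    by (simp add: trace_add trace_sub jj_def)
      (metis matrix_mul_assoc trace_mul_sym)
qed

text \<open>Substituting \<open>BA + P - 1\<close> for \<open>AB\<close> produces a trace containing
  \<open>P\<close> twice, which factors by rank one. Swapping two letters thus changes
  \<open>jj\<close> only by values on shorter words.\<close>

lemma jj_swap: "jj (u ** A ** B ** w) = jj (u ** B ** A ** w) + jj u * jj w - jj (u ** w)"
proof -
  have "u ** A ** B ** w = u ** (B ** A + P - mat 1) ** w"
    by (metis AB_eq matrix_mul_assoc)
  then show ?thesis unfolding trace_PP[symmetric]
    by (simp add: matrix_add_ldistrib matrix_add_rdistrib matrix_diff_ldistrib matrix_diff_rdistrib
        matrix_mul_assoc jj_def trace_add trace_sub)
qed

lemma trace_AAA: "trace (A ** A ** A ** w) = trace (A ** A) / 2 * trace (A ** w) + trace (A ** A ** A) / 3 * trace w"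
  by (subst (1) cayley_hamilton_traceless[OF trace_A])
    (simp add: matrix_add_rdistrib trace_add trace_mat_mult flip: matrix_mul_assoc)

lemma trace_BBB: "trace (B ** B ** B ** w) = trace (B ** B) / 2 * trace (B ** w) + trace (B ** B ** B) / 3 * trace w"
  by (subst (1) cayley_hamilton_traceless[OF trace_B])
    (simp add: matrix_add_rdistrib trace_add trace_mat_mult flip: matrix_mul_assoc)

lemma trace_AAB: "trace (A ** A ** B ** w) + trace (A ** B ** A ** w) + trace (B ** A ** A ** w) =
    trace (A ** B) * trace (A ** w) + trace (A ** A) / 2 * trace (B ** w) + trace (A ** A ** B) * trace w"
proof -
  have "(A ** A ** B + A ** B ** A + B ** A ** A) ** w =
    (mat (trace (A ** B)) ** A + mat (trace (A ** A) / 2) ** B + mat (trace (A ** A ** B))) ** w"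
    by (simp add: cayley_hamilton_polarized[OF trace_A trace_B])
  then have "trace ((A ** A ** B + A ** B ** A + B ** A ** A) ** w) =
    trace ((mat (trace (A ** B)) ** A + mat (trace (A ** A) / 2) ** B + mat (trace (A ** A ** B))) ** w)"
    by simp
  then show ?thesis
    by (simp add: matrix_add_rdistrib trace_add trace_mat_mult matrix_mul_assoc[symmetric, of "mat _"])
qed

section \<open>Values on short words, and the five relations\<close>

lemma jj_A: "jj A = 0"
  by (simp add: jj_def P_def trace_add trace_sub matrix_add_ldistrib matrix_diff_ldistrib trace_A
      matrix_mul_assoc) (metis matrix_mul_assoc trace_mul_sym cancel_comm_monoid_add_class.diff_cancel)

lemma jj_B: "jj B = 0"
  by (simp add: jj_def P_def trace_add trace_sub matrix_add_ldistrib matrix_diff_ldistrib trace_B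
      matrix_mul_assoc) (metis matrix_mul_assoc trace_mul_sym cancel_comm_monoid_add_class.diff_cancel)

lemma jj_AA: "jj (A ** A) = trace (A ** A)"
  using trace_swap[of "A ** A" "mat 1"] trace_mul_sym[of "A ** A ** B" A]
  by (simp add: matrix_mul_assoc)

lemma jj_BB: "jj (B ** B) = trace (B ** B)"
  using trace_swap[of "mat 1" "B ** B"] trace_mul_sym[of B "A ** B ** B"]
  by (simp add: matrix_mul_assoc)

text \<open>The cyclic rearrangements of \<open>ABAB\<close> and \<open>ABBA\<close> give the sum
  \<open>jj AB + jj BA = 2 tr AB\<close>; the swap rule in the empty context gives the difference
  6.\<close>

lemma jj_AB: "jj (A ** B) = trace (A ** B) + 3"
  and jj_BA: "jj (B ** A) = trace (A ** B) - 3"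
proof -
  have "trace (A ** B ** A ** B) = trace (A ** B ** B ** A) + jj (A ** B) - trace (A ** B)"
    using trace_swap[of "A ** B" "mat 1"] by (simp add: matrix_mul_assoc)
  moreover have "trace (B ** A ** A ** B) = trace (B ** A ** B ** A) + jj (B ** A) - trace (A ** B)"
    using trace_swap[of "B ** A" "mat 1"] by (simp add: matrix_mul_assoc trace_mul_sym[of B A])
  moreover have "trace (A ** B ** B ** A) = trace (B ** A ** A ** B)"
    "trace (A ** B ** A ** B) = trace (B ** A ** B ** A)"
    using trace_mul_sym[of "A ** B" "B ** A"] trace_mul_sym[of A "B ** A ** B"]
    by (simp_all add: matrix_mul_assoc)
  moreover have "jj (A ** B) = jj (B ** A) + 6"
    using jj_swap[of "mat 1" "mat 1"] by (simp add: jj_1)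
  ultimately have "2 * jj (A ** B) = 2 * (trace (A ** B) + 3)" by (simp add: algebra_simps)
  then show "jj (A ** B) = trace (A ** B) + 3" by (rule numeral_mult_cancel)
  with \<open>jj (A ** B) = jj (B ** A) + 6\<close> show "jj (B ** A) = trace (A ** B) - 3" by simp
qed

text \<open>Up to rotation there are two words with two letters of each kind. They differ by 3
  according to the swap rule, and the polarized identity times \<open>B\<close> gives a second
  equation between them.\<close>

lemma trace_AABB: "trace (A ** A ** B ** B) = (2 * trace (A ** B) ^ 2 + trace (A ** A) * trace (B ** B) - 6) / 6"
  and trace_ABAB: "trace (A ** B ** A ** B) = trace (A ** A ** B ** B) + 3"
proof -
  have rot: "trace (A ** B ** B ** A) = trace (A ** A ** B ** B)" "trace (B ** A ** A ** B) = trace (A ** A ** B ** B)"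
    using trace_mul_sym[of "A ** B ** B" A] trace_mul_sym[of B "A ** A ** B"] by (simp_all add: matrix_mul_assoc)
  have "trace (A ** B ** A ** B) = trace (A ** B ** B ** A) + jj (A ** B) - trace (A ** B)"
    using trace_swap[of "A ** B" "mat 1"] by (simp add: matrix_mul_assoc)
  then show *: "trace (A ** B ** A ** B) = trace (A ** A ** B ** B) + 3"
    by (simp add: rot jj_AB)
  show "trace (A ** A ** B ** B) = (2 * trace (A ** B) ^ 2 + trace (A ** A) * trace (B ** B) - 6) / 6"
    using trace_AAB[of B] * by (simp add: rot trace_B power2_eq_square field_simps)
qed

text \<open>The correction in a swap next to \<open>A\<close> is \<open>jj A * 3 - jj A = 0\<close>,
  so the order of the letters is immaterial; the polarized identity times \<open>P\<close> gives the
  common value.\<close>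

lemma jj_AAB_all: "jj (A ** A ** B) = trace (A ** A ** B)" "jj (A ** B ** A) = trace (A ** A ** B)"
  "jj (B ** A ** A) = trace (A ** A ** B)"
proof -
  have "jj (A ** A ** B) = jj (A ** B ** A)" "jj (A ** B ** A) = jj (B ** A ** A)"
    using jj_swap[of A "mat 1"] jj_swap[of "mat 1" A] by (simp_all add: jj_1 jj_A)
  moreover have "jj (A ** A ** B) + jj (A ** B ** A) + jj (B ** A ** A) = 3 * trace (A ** A ** B)"
    using trace_AAB[of P] jj_A jj_B jj_1 by (simp add: jj_def)
  ultimately show "jj (A ** A ** B) = trace (A ** A ** B)" "jj (A ** B ** A) = trace (A ** A ** B)"
    "jj (B ** A ** A) = trace (A ** A ** B)"
    by auto
qed

text \<open>The traces of words with three \<open>A\<close> and two \<open>B\<close> are computed in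
  two ways, by Cayley-Hamilton for \<open>A^3\<close> and by the polarized identity times
  \<open>BA\<close>. The discrepancy between the results is the relation.\<close>

lemma rel_r2: "trace (A ** A) * trace (A ** B ** B) - 2 * trace (A ** B) * trace (A ** A ** B)
    + trace (B ** B) * trace (A ** A ** A) = 0"
proof -
  have e1: "trace (A ** A ** B ** B ** A) = trace (A ** A ** A ** B ** B)"
    using trace_mul_sym[of "A ** A ** B ** B" A] by (simp add: matrix_mul_assoc)
  have e2: "trace (A ** B ** A ** B ** A) = trace (A ** A ** B ** A ** B)"
    using trace_mul_sym[of "A ** B ** A ** B" A] by (simp add: matrix_mul_assoc)
  have e3: "trace (B ** A ** A ** B ** A) = trace (A ** A ** B ** A ** B)"
    using trace_mul_sym[of B "A ** A ** B ** A"] by (simp add: matrix_mul_assoc)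
  have e4: "trace (A ** B ** A) = trace (A ** A ** B)" "trace (B ** B ** A) = trace (A ** B ** B)"
    "trace (B ** A) = trace (A ** B)"
    using trace_mul_sym[of "A ** B" A] trace_mul_sym[of "B ** B" A] trace_mul_sym[of B A]
    by (simp_all add: matrix_mul_assoc)
  have "trace (A ** A ** B ** A ** B) = trace (A ** A ** A ** B ** B)"
    using trace_swap[of "A ** A ** B" "mat 1"] by (simp add: matrix_mul_assoc jj_AAB_all e1)
  moreover have "trace (A ** A ** A ** B ** B) = trace (A ** A) / 2 * trace (A ** B ** B) + trace (A ** A ** A) / 3 * trace (B ** B)"
    using trace_AAA[of "B ** B"] by (simp add: matrix_mul_assoc)
  ultimately have h: "3 * (trace (A ** A) / 2 * trace (A ** B ** B) + trace (A ** A ** A) / 3 * trace (B ** B)) =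
      2 * trace (A ** B) * trace (A ** A ** B) + trace (A ** A) / 2 * trace (A ** B ** B)"
    using trace_AAB[of "B ** A"] by (simp add: matrix_mul_assoc e1 e2 e3 e4 mult_ac)
  have "trace (A ** A) * trace (A ** B ** B) - 2 * trace (A ** B) * trace (A ** A ** B)
      + trace (B ** B) * trace (A ** A ** A) =
    3 * (trace (A ** A) / 2 * trace (A ** B ** B) + trace (A ** A ** A) / 3 * trace (B ** B)) -
      (2 * trace (A ** B) * trace (A ** A ** B) + trace (A ** A) / 2 * trace (A ** B ** B))"
    by (simp add: field_simps)
  then show ?thesis by (simp only: h) simp
qed

text \<open>The same double computation for words with four \<open>A\<close> and two
  \<open>B\<close>, with the polarized identity multiplied by \<open>AAB\<close>. The 9 collects the
  corrections from the swaps.\<close>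

lemma rel_r3: "trace (A ** A) * (trace (A ** A) * trace (B ** B) - trace (A ** B) ^ 2 + 9)
    + 6 * (trace (A ** A ** A) * trace (A ** B ** B) - trace (A ** A ** B) ^ 2) = 0"
proof -
  have e1: "trace (A ** B ** A ** A ** A ** B) = trace (A ** A ** A ** B ** A ** B)"
    "trace (B ** A ** A ** A ** A ** B) = trace (A ** A ** A ** A ** B ** B)"
    "trace (A ** A ** B ** A ** B ** A) = trace (A ** A ** A ** B ** A ** B)"
    "trace (A ** A ** B ** A) = trace (A ** A ** A ** B)"
    "trace (B ** A ** A ** B) = trace (A ** A ** B ** B)"
    "trace (B ** A ** B) = trace (A ** B ** B)"
    using trace_mul_sym[of "A ** B" "A ** A ** A ** B"] trace_mul_sym[of B "A ** A ** A ** A ** B"]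
      trace_mul_sym[of "A ** A ** B ** A ** B" A] trace_mul_sym[of "A ** A ** B" A]
      trace_mul_sym[of B "A ** A ** B"] trace_mul_sym[of B "A ** B"]
    by (simp_all add: matrix_mul_assoc)
  have c: "trace (A ** A ** A ** B ** A ** B) = trace (A ** A) / 2 * trace (A ** B ** A ** B) + trace (A ** A ** A) / 3 * trace (A ** B ** B)"
    "trace (A ** A ** A ** A ** B ** B) = trace (A ** A) / 2 * trace (A ** A ** B ** B) + trace (A ** A ** A) / 3 * trace (A ** B ** B)"
    "trace (A ** A ** A ** B) = trace (A ** A) / 2 * trace (A ** B)"
    using trace_AAA[of "B ** A ** B"] trace_AAA[of "A ** B ** B"] trace_AAA[of B]
    by (simp_all add: matrix_mul_assoc e1 trace_B)
  have "jj (A ** A ** A ** B) = trace (A ** A) / 2 * jj (A ** B) + trace (A ** A ** A) / 3 * jj B"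
    using trace_AAA[of "B ** P"] by (simp add: jj_def matrix_mul_assoc)
  moreover have "jj (A ** A ** A ** B) = jj (A ** A ** B ** A) + 2 * trace (A ** A)"
    using jj_swap[of "A ** A" "mat 1"] by (simp add: jj_1 jj_AA)
  ultimately have j: "jj (A ** A ** B ** A) = trace (A ** A) * trace (A ** B) / 2 - trace (A ** A) / 2"
    by (simp add: jj_AB jj_B field_simps)
  have x: "trace (A ** A ** B ** A ** A ** B) = trace (A ** A ** A ** B ** A ** B) + jj (A ** A ** B ** A) - trace (A ** A ** A ** B)"
    using trace_swap[of "A ** A ** B ** A" "mat 1"] by (simp add: matrix_mul_assoc e1)
  have h: "trace (A ** A ** B ** A ** A ** B) + trace (A ** A ** A ** B ** A ** B) + trace (A ** A ** A ** A ** B ** B) =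
      trace (A ** B) * trace (A ** A ** A ** B) + trace (A ** A) / 2 * trace (A ** A ** B ** B) + trace (A ** A ** B) ^ 2"
    using trace_AAB[of "A ** A ** B"] by (simp add: matrix_mul_assoc e1 power2_eq_square)
  have "trace (A ** A) * (trace (A ** A) * trace (B ** B) - trace (A ** B) ^ 2 + 9)
      + 6 * (trace (A ** A ** A) * trace (A ** B ** B) - trace (A ** A ** B) ^ 2) =
    6 * (trace (A ** A ** B ** A ** A ** B) + trace (A ** A ** A ** B ** A ** B) + trace (A ** A ** A ** A ** B ** B) -
      (trace (A ** B) * trace (A ** A ** A ** B) + trace (A ** A) / 2 * trace (A ** A ** B ** B) + trace (A ** A ** B) ^ 2))"
    unfolding x c j trace_ABAB trace_AABB by (simp add: field_simps power2_eq_square)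
  then show ?thesis by (simp only: h) simp
qed

text \<open>Three swaps lead round a closed cycle through \<open>AABABB\<close>,
  \<open>AABBAB\<close> and \<open>AAABBB\<close>, so their corrections add up to zero. This gives
  the sum of the three \<open>jj\<close> values, while \<open>jj_swap\<close> gives their
  differences.\<close>

lemma jj_AABB_all:
  shows "jj (A ** A ** B ** B) = trace (A ** A ** B ** B) + 1 + trace (A ** B)"
    and "jj (B ** A ** A ** B) = trace (A ** A ** B ** B) - 2"
    and "jj (B ** B ** A ** A) = trace (A ** A ** B ** B) + 1 - trace (A ** B)"
    and trace_AABABB: "trace (A ** A ** B ** A ** B ** B) = trace (A ** A ** A ** B ** B ** B) - jj (B ** B ** A ** A) + trace (A ** A ** B ** B)"
    and trace_AABABB': "trace (A ** A ** B ** A ** B ** B) = trace (A ** A ** B ** B ** A ** B) + jj (B ** A ** A ** B) - trace (A ** A ** B ** B)"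
proof -
  have rot: "trace (B ** A ** A ** B) = trace (A ** A ** B ** B)"
    "trace (B ** B ** A ** A) = trace (A ** A ** B ** B)"
    "trace (A ** A ** B ** B ** B ** A) = trace (A ** A ** A ** B ** B ** B)"
    using trace_mul_sym[of B "A ** A ** B"] trace_mul_sym[of "B ** B" "A ** A"]
       trace_mul_sym[of "A ** A ** B ** B ** B" A] by (simp_all add: matrix_mul_assoc)
  have t: "trace (A ** A ** B ** A ** B ** B) = trace (A ** A ** B ** B ** A ** B) + jj (B ** A ** A ** B) - trace (A ** A ** B ** B)"
    "trace (A ** A ** B ** B ** A ** B) = trace (A ** A ** A ** B ** B ** B) + jj (A ** A ** B ** B) - trace (A ** A ** B ** B)"
    "trace (A ** A ** A ** B ** B ** B) = trace (A ** A ** B ** A ** B ** B) + jj (B ** B ** A ** A) - trace (A ** A ** B ** B)"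
    using trace_swap[of "A ** A ** B" B] trace_swap[of "A ** A ** B ** B" "mat 1"] trace_swap[of "A ** A" "B ** B"]
    by (simp_all add: matrix_mul_assoc rot)
  have j: "jj (A ** A ** B ** B) = jj (A ** B ** A ** B) - jj (A ** B)"
    "jj (A ** B ** A ** B) = jj (B ** A ** A ** B) + 2 * jj (A ** B)"
    "jj (B ** A ** A ** B) = jj (B ** A ** B ** A) + 2 * jj (B ** A)"
    "jj (B ** A ** B ** A) = jj (B ** B ** A ** A) - jj (B ** A)"
    using jj_swap[of A B] jj_swap[of "mat 1" "A ** B"]
      jj_swap[of "B ** A" "mat 1"] jj_swap[of B A]
    by (simp_all add: jj_A jj_B jj_1 matrix_mul_assoc)
  have s: "jj (B ** A ** A ** B) + jj (A ** A ** B ** B) + jj (B ** B ** A ** A) = 3 * trace (A ** A ** B ** B)"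
  proof -
    have "jj (B ** A ** A ** B) = trace (A ** A ** B ** A ** B ** B) - trace (A ** A ** B ** B ** A ** B) + trace (A ** A ** B ** B)"
      "jj (A ** A ** B ** B) = trace (A ** A ** B ** B ** A ** B) - trace (A ** A ** A ** B ** B ** B) + trace (A ** A ** B ** B)"
      "jj (B ** B ** A ** A) = trace (A ** A ** A ** B ** B ** B) - trace (A ** A ** B ** A ** B ** B) + trace (A ** A ** B ** B)"
      using t by (simp_all only: add_diff_cancel_left' add_diff_eq diff_add_cancel add_diff_cancel_right')
        (simp_all add: algebra_simps)
    then show ?thesis by simp
  qed
  have v: "jj (A ** A ** B ** B) = jj (B ** A ** A ** B) + trace (A ** B) + 3"
    "jj (B ** B ** A ** A) = jj (B ** A ** A ** B) - trace (A ** B) + 3"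
    using j by (simp_all add: jj_AB jj_BA algebra_simps)
  have "3 * jj (B ** A ** A ** B) = 3 * (trace (A ** A ** B ** B) - 2)"
    using s unfolding v by (simp add: algebra_simps)
  then have m: "jj (B ** A ** A ** B) = trace (A ** A ** B ** B) - 2"
    by (rule numeral_mult_cancel)
  then show "jj (B ** A ** A ** B) = trace (A ** A ** B ** B) - 2" .
  show "jj (A ** A ** B ** B) = trace (A ** A ** B ** B) + 1 + trace (A ** B)"
    "jj (B ** B ** A ** A) = trace (A ** A ** B ** B) + 1 - trace (A ** B)"
    unfolding v m by simp_all
  show "trace (A ** A ** B ** A ** B ** B) = trace (A ** A ** A ** B ** B ** B) - jj (B ** B ** A ** A) + trace (A ** A ** B ** B)"
    "trace (A ** A ** B ** A ** B ** B) = trace (A ** A ** B ** B ** A ** B) + jj (B ** A ** A ** B) - trace (A ** A ** B ** B)"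
    using t(1,3) by simp_all
qed

text \<open>Words with three letters of each kind, with the polarized identity multiplied by
  \<open>ABB\<close>; \<open>AAABBB\<close> is evaluated by Cayley-Hamilton and the other two words
  differ from it by known swaps.\<close>

lemma rel_r4: "trace (A ** B) * (trace (A ** A) * trace (B ** B) - trace (A ** B) ^ 2 + 9)
    + 3 * (trace (A ** A ** A) * trace (B ** B ** B) - trace (A ** A ** B) * trace (A ** B ** B)) = 0"
proof -
  have e: "trace (A ** B ** A ** A ** B ** B) = trace (A ** A ** B ** B ** A ** B)"
    "trace (B ** A ** A ** A ** B ** B) = trace (A ** A ** A ** B ** B ** B)"
    "trace (B ** A ** B ** B) = trace (B ** B ** B ** A)" "trace (A ** B ** B ** B) = trace (B ** B ** B ** A)"
    "trace (B ** A) = trace (A ** B)"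
    using trace_mul_sym[of "A ** B" "A ** A ** B ** B"] trace_mul_sym[of B "A ** A ** A ** B ** B"]
      trace_mul_sym[of "B ** A" "B ** B"] trace_mul_sym[of A "B ** B ** B"] trace_mul_sym[of B A]
    by (simp_all add: matrix_mul_assoc)
  have c: "trace (A ** A ** A ** B ** B ** B) = trace (A ** A) / 2 * trace (B ** B ** B ** A) + trace (A ** A ** A) / 3 * trace (B ** B ** B)"
    "trace (B ** B ** B ** A) = trace (B ** B) / 2 * trace (A ** B)"
    using trace_AAA[of "B ** B ** B"] trace_BBB[of A]
    by (simp_all add: matrix_mul_assoc e trace_A)
  have "trace (A ** A ** B ** A ** B ** B) + trace (A ** A ** B ** B ** A ** B) + trace (A ** A ** A ** B ** B ** B) =
    trace (A ** B) * trace (A ** A ** B ** B) + trace (A ** A) / 2 * trace (B ** B ** B ** A) + trace (A ** A ** B) * trace (A ** B ** B)"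
    using trace_AAB[of "A ** B ** B"] by (simp add: matrix_mul_assoc e)
  moreover have "trace (A ** A ** B ** B ** A ** B) = trace (A ** A ** B ** A ** B ** B) - jj (B ** A ** A ** B) + trace (A ** A ** B ** B)"
    using trace_AABABB' by simp
  ultimately have h: "3 * trace (A ** A ** A ** B ** B ** B) - 2 * jj (B ** B ** A ** A) - jj (B ** A ** A ** B) + 3 * trace (A ** A ** B ** B) =
    trace (A ** B) * trace (A ** A ** B ** B) + trace (A ** A) / 2 * trace (B ** B ** B ** A) + trace (A ** A ** B) * trace (A ** B ** B)"
    unfolding trace_AABABB by (simp add: algebra_simps)
  have "trace (A ** B) * (trace (A ** A) * trace (B ** B) - trace (A ** B) ^ 2 + 9)
      + 3 * (trace (A ** A ** A) * trace (B ** B ** B) - trace (A ** A ** B) * trace (A ** B ** B)) =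
    3 * (3 * trace (A ** A ** A ** B ** B ** B) - 2 * jj (B ** B ** A ** A) - jj (B ** A ** A ** B) + 3 * trace (A ** A ** B ** B) -
     (trace (A ** B) * trace (A ** A ** B ** B) + trace (A ** A) / 2 * trace (B ** B ** B ** A) + trace (A ** A ** B) * trace (A ** B ** B)))"
    unfolding jj_AABB_all c trace_AABB by (simp add: field_simps power2_eq_square power3_eq_cube)
  then show ?thesis by (simp only: h) simp
qed

text \<open>Passing to \<open>(B, -A)\<close> preserves the commutator and hence \<open>P\<close>.
  This symmetry carries the second relation to the first and the third to the fifth.\<close>

lemma flip: "cm_pair B (- A) i j"
proof
  show "B ** - A - - A ** B + mat 1 = (\<chi> a b. i $ a * j $ b)"
    using rank_one by (simp add: matrix_minus_mult algebra_simps)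
qed (auto simp: trace_uminus trace_A trace_B)

lemma rel_r1: "trace (A ** A) * trace (B ** B ** B) - 2 * trace (A ** B) * trace (A ** B ** B)
    + trace (B ** B) * trace (A ** A ** B) = 0"
proof -
  interpret f: cm_pair B "- A" i j by (rule flip)
  have rot: "trace (B ** A) = trace (A ** B)" "trace (B ** A ** A) = trace (A ** A ** B)"
    "trace (B ** B ** A) = trace (A ** B ** B)"
    using trace_mul_sym[of B A] trace_mul_sym[of B "A ** A"] trace_mul_sym[of "B ** B" A]
    by (simp_all add: matrix_mul_assoc)
  show ?thesis
    using f.rel_r2 by (simp add: matrix_minus_mult trace_uminus rot algebra_simps)
qed

lemma rel_r5: "trace (B ** B) * (trace (A ** A) * trace (B ** B) - trace (A ** B) ^ 2 + 9)
    + 6 * (trace (A ** A ** B) * trace (B ** B ** B) - trace (A ** B ** B) ^ 2) = 0"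
proof -
  interpret f: cm_pair B "- A" i j by (rule flip)
  have rot: "trace (B ** A) = trace (A ** B)" "trace (B ** A ** A) = trace (A ** A ** B)"
    "trace (B ** B ** A) = trace (A ** B ** B)"
    using trace_mul_sym[of B A] trace_mul_sym[of B "A ** A"] trace_mul_sym[of "B ** B" A]
    by (simp_all add: matrix_mul_assoc)
  show ?thesis
    using f.rel_r3 by (simp add: matrix_minus_mult trace_uminus rot algebra_simps)
qed

lemma jj_ABB_all: "jj (A ** B ** B) = trace (A ** B ** B)" "jj (B ** A ** B) = trace (A ** B ** B)"
  "jj (B ** B ** A) = trace (A ** B ** B)"
proof -
  interpret f: cm_pair B "- A" i j by (rule flip)
  have P: "f.P = P" by (simp add: f.P_def P_def matrix_minus_mult)
  have "trace (B ** B ** A) = trace (A ** B ** B)"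
    using trace_mul_sym[of "B ** B" A] by (simp add: matrix_mul_assoc)
  then show "jj (A ** B ** B) = trace (A ** B ** B)" "jj (B ** A ** B) = trace (A ** B ** B)"
  "jj (B ** B ** A) = trace (A ** B ** B)"
    using f.jj_AAB_all by (simp_all add: f.jj_def jj_def P matrix_minus_mult trace_uminus)
qed

end

section \<open>Regular functions given by polynomials in traces\<close>

definition outer :: "complex ^ 3 \<Rightarrow> complex ^ 3 \<Rightarrow> mat3" where
  "outer i j = (\<chi> a b. i $ a * j $ b)"

lemma rank_eq_1_iff_outer: "rank M = 1 \<longleftrightarrow> M \<noteq> 0 \<and> (\<exists>i j. M = outer i j)" for M :: mat3
proof -
  have row: "M $ a \<in> rows M" for a by (auto simp: rows_def row_def)
  show ?thesis
  proof
    assume r: "rank M = 1"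
    obtain B where B: "B \<subseteq> rows M" "rows M \<subseteq> vec.span B" "card B = vec.dim (rows M)"
      using vec.basis_exists[of "rows M"] by metis
    then obtain b where b: "B = {b}"
      using r by (auto simp: row_rank_def_gen card_1_singleton_iff)
    have "\<exists>k. M $ a = k *s b" for a
    proof -
      have "M $ a \<in> rows M" by (auto simp: rows_def row_def)
      then show ?thesis using B(2) unfolding b vec.span_singleton by auto
    qed
    then obtain k where "\<And>a. M $ a = k a *s b" by metis
    then have "M = outer (\<chi> a. k a) b"
      by (simp add: outer_def vec_eq_iff)
    moreover have "M \<noteq> 0"
    proof
      assume "M = 0"
      then have "rows M \<subseteq> {0}" by (auto simp: rows_def row_def vec_eq_iff)
      then have "vec.dim (rows M) = 0" by (simp add: vec.dim_eq_0)
      with r show False by (simp add: row_rank_def_gen)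
    qed
    ultimately show "M \<noteq> 0 \<and> (\<exists>i j. M = outer i j)" by auto
  next
    assume "M \<noteq> 0 \<and> (\<exists>i j. M = outer i j)"
    then obtain i j where M: "M = outer i j" "M \<noteq> 0" by auto
    have "rows M \<subseteq> vec.span {j}"
      unfolding vec.span_singleton by (auto simp: rows_def row_def M outer_def vec_eq_iff image_iff)
    then have "vec.dim (rows M) \<le> 1"
      using vec.dim_le_card[of "rows M" "{j}"] by simp
    moreover have "vec.dim (rows M) \<noteq> 0"
    proof
      assume "vec.dim (rows M) = 0"
      then have "rows M \<subseteq> {0}" by (simp add: vec.dim_eq_0)
      then have "M = 0" using row by (metis empty_iff insertE subsetD vec_eq_iff zero_index)
      with M show False by simp
    qed
    ultimately show "rank M = 1" unfolding row_rank_def_gen by linarith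
  qed
qed

lemma trace_commutator: "trace (X ** Y - Y ** X + mat 1) = 3" for X Y :: mat3
  by (simp add: trace_add trace_sub trace_mat trace_mul_sym[of X Y])

text \<open>The trace 3 excludes the zero matrix, so rank one reduces to being an outer
  product.\<close>

lemma CMbar_iff: "(X, Y) \<in> CMbar \<longleftrightarrow> (\<exists>i j. X ** Y - Y ** X + mat 1 = outer i j)"
proof -
  have "X ** Y - Y ** X + mat 1 \<noteq> 0"
  proof
    assume "X ** Y - Y ** X + mat 1 = 0"
    then have "trace (X ** Y - Y ** X + mat 1) = 0" by (simp add: trace_def)
    then show False unfolding trace_commutator by simp
  qed
  then show ?thesis by (simp add: CMbar_def rank_eq_1_iff_outer[unfolded One_nat_def])
qed

definition tfree :: "mat3 \<Rightarrow> mat3" where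
  "tfree X = X - mat (trace X / 3)"

lemma trace_tfree: "trace (tfree X) = 0"
  by (simp add: tfree_def trace_sub trace_mat)

lemma commutator_tfree: "tfree X ** tfree Y - tfree Y ** tfree X = X ** Y - Y ** X"
  by (simp add: tfree_def matrix_diff_ldistrib matrix_diff_rdistrib mat_mult mult_mat vec_eq_iff)
    (simp add: mat_def field_simps)

definition tA :: "mat3 \<times> mat3 \<Rightarrow> mat3" where "tA z = tfree (fst z)"
definition tB :: "mat3 \<times> mat3 \<Rightarrow> mat3" where "tB z = tfree (snd z)"

text \<open>\<open>i\<close> and \<open>j\<close> are determined only up to reciprocal factors. Any
  choice will do, because what is finally extracted are values \<open>j^T w i\<close>, which do not
  depend on it.\<close>

definition iv :: "mat3 \<times> mat3 \<Rightarrow> complex ^ 3" where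
  "iv z = (SOME i. \<exists>j. tA z ** tB z - tB z ** tA z + mat 1 = outer i j)"
definition jv :: "mat3 \<times> mat3 \<Rightarrow> complex ^ 3" where
  "jv z = (SOME j. tA z ** tB z - tB z ** tA z + mat 1 = outer (iv z) j)"

lemma cm_pair_CMbar:
  assumes "z \<in> CMbar"
  shows "cm_pair (tA z) (tB z) (iv z) (jv z)"
proof
  obtain X Y where z: "z = (X, Y)" by (cases z)
  have "\<exists>i j. tA z ** tB z - tB z ** tA z + mat 1 = outer i j"
    using assms by (simp add: z tA_def tB_def CMbar_iff commutator_tfree)
  then have "\<exists>j. tA z ** tB z - tB z ** tA z + mat 1 = outer (iv z) j"
    unfolding iv_def by (rule someI_ex)
  then have "tA z ** tB z - tB z ** tA z + mat 1 = outer (iv z) (jv z)"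
    unfolding jv_def by (rule someI_ex)
  then show "tA z ** tB z - tB z ** tA z + mat 1 = (\<chi> a b. iv z $ a * jv z $ b)"
    by (simp add: outer_def)
qed (simp_all add: tA_def tB_def trace_tfree)

text \<open>The leading 0 makes the list positions agree with the variable indices 1 to 9. The power
  of \<open>l\<close> is the degree in the traceless parts; the traces of \<open>X\<close> and
  \<open>Y\<close> enter no relation and stay unscaled.\<close>

definition tau :: "complex \<Rightarrow> mat3 \<times> mat3 \<Rightarrow> nat \<Rightarrow> complex" where
  "tau l z = (!) [0, trace (fst z), trace (snd z),
     l ^ 2 * trace (tA z ** tA z), l ^ 2 * trace (tA z ** tB z), l ^ 2 * trace (tB z ** tB z),
     l ^ 3 * trace (tA z ** tA z ** tA z), l ^ 3 * trace (tA z ** tA z ** tB z),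
     l ^ 3 * trace (tA z ** tB z ** tB z), l ^ 3 * trace (tB z ** tB z ** tB z)]"

lemma tau_simps:
  "tau l z 1 = trace (fst z)" "tau l z 2 = trace (snd z)"
  "tau l z 3 = l ^ 2 * trace (tA z ** tA z)" "tau l z 4 = l ^ 2 * trace (tA z ** tB z)"
  "tau l z 5 = l ^ 2 * trace (tB z ** tB z)" "tau l z 6 = l ^ 3 * trace (tA z ** tA z ** tA z)"
  "tau l z 7 = l ^ 3 * trace (tA z ** tA z ** tB z)" "tau l z 8 = l ^ 3 * trace (tA z ** tB z ** tB z)"
  "tau l z 9 = l ^ 3 * trace (tB z ** tB z ** tB z)"
  by (simp_all add: tau_def)

lemma tau_relations:
  assumes z: "z \<in> CMbar" and v: "v = - 3 * l ^ 4"
  shows "ev (tau l z) r1 = 0" "ev (tau l z) r2 = 0" "ev (tau l z) (r3 v) = 0"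
    "ev (tau l z) (r4 v) = 0" "ev (tau l z) (r5 v) = 0"
proof -
  interpret cm_pair "tA z" "tB z" "iv z" "jv z" by (rule cm_pair_CMbar[OF z])
  note [simp] = tau_simps v
  \<comment> \<open>The relations are homogeneous of weight 5 or 6, so a power of \<open>l\<close>
    is a common factor; where \<open>v\<close> occurs, \<open>- 3 * v = 9 * l ^ 4\<close> brings the
    constant 9 to the right weight.\<close>
  have "ev (tau l z) r1 = l ^ 5 * 0"
    unfolding rel_r1[symmetric] by (simp add: r1_def algebra_simps power_numeral_reduce)
  then show "ev (tau l z) r1 = 0" by simp
  have "ev (tau l z) r2 = l ^ 5 * 0"
    unfolding rel_r2[symmetric] by (simp add: r2_def algebra_simps power_numeral_reduce)
  then show "ev (tau l z) r2 = 0" by simp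
  have "ev (tau l z) (r3 v) = l ^ 6 * 0"
    unfolding rel_r3[symmetric] by (simp add: r3_def algebra_simps power_numeral_reduce)
  then show "ev (tau l z) (r3 v) = 0" by simp
  have "ev (tau l z) (r4 v) = l ^ 6 * 0"
    unfolding rel_r4[symmetric] by (simp add: r4_def algebra_simps power_numeral_reduce)
  then show "ev (tau l z) (r4 v) = 0" by simp
  have "ev (tau l z) (r5 v) = l ^ 6 * 0"
    unfolding rel_r5[symmetric] by (simp add: r5_def algebra_simps power_numeral_reduce)
  then show "ev (tau l z) (r5 v) = 0" by simp
qed

locale scaled =
  fixes l :: complex
  assumes l: "l \<noteq> 0"
begin

definition trace_poly :: "(mat3 \<times> mat3 \<Rightarrow> complex) \<Rightarrow> bool" where
  "trace_poly g \<longleftrightarrow> (\<exists>p\<in>polys {1..9}. \<forall>z\<in>CMbar. g z = ev (tau l z) p)"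

lemma trace_poly_cong: "(\<And>z. z \<in> CMbar \<Longrightarrow> g z = h z) \<Longrightarrow> trace_poly g \<longleftrightarrow> trace_poly h"
  by (simp add: trace_poly_def)

lemma trace_poly_const [intro]: "trace_poly (\<lambda>_. c)"
  unfolding trace_poly_def by (intro bexI[of _ "Cst c"]) auto

lemma trace_poly_add [intro]:
  assumes "trace_poly g" "trace_poly h" shows "trace_poly (\<lambda>z. g z + h z)"
proof -
  obtain p q where "p \<in> polys {1..9}" "q \<in> polys {1..9}"
    "\<forall>z\<in>CMbar. g z = ev (tau l z) p" "\<forall>z\<in>CMbar. h z = ev (tau l z) q"
    using assms by (auto simp: trace_poly_def)
  then show ?thesis unfolding trace_poly_def by (intro bexI[of _ "p + q"]) auto
qed

lemma trace_poly_mult [intro]: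
  assumes "trace_poly g" "trace_poly h" shows "trace_poly (\<lambda>z. g z * h z)"
proof -
  obtain p q where "p \<in> polys {1..9}" "q \<in> polys {1..9}"
    "\<forall>z\<in>CMbar. g z = ev (tau l z) p" "\<forall>z\<in>CMbar. h z = ev (tau l z) q"
    using assms by (auto simp: trace_poly_def)
  then show ?thesis unfolding trace_poly_def by (intro bexI[of _ "p * q"]) auto
qed

lemma trace_poly_diff [intro]:
  assumes "trace_poly g" "trace_poly h" shows "trace_poly (\<lambda>z. g z - h z)"
  using trace_poly_add[OF assms(1) trace_poly_mult[OF trace_poly_const[of "- 1"] assms(2)]] by simp

lemma trace_poly_divide [intro]: "trace_poly g \<Longrightarrow> trace_poly (\<lambda>z. g z / c)"
  using trace_poly_mult[OF _ trace_poly_const[of "inverse c"], of g] by (simp add: divide_inverse)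

lemma trace_poly_power [intro]: "trace_poly g \<Longrightarrow> trace_poly (\<lambda>z. g z ^ n)"
  by (induction n) (simp_all add: trace_poly_const trace_poly_mult)

lemma trace_poly_sum [intro]:
  "(\<And>x. x \<in> A \<Longrightarrow> trace_poly (g x)) \<Longrightarrow> trace_poly (\<lambda>z. \<Sum>x\<in>A. g x z)"
  by (induction A rule: infinite_finite_induct) (simp_all add: trace_poly_const trace_poly_add)

lemma trace_poly_tau: "k \<in> {1..9} \<Longrightarrow> trace_poly (\<lambda>z. tau l z k)"
  unfolding trace_poly_def by (intro bexI[of _ "Var k"]) auto

lemma trace_poly_traces:
  "trace_poly (\<lambda>z. trace (fst z))" "trace_poly (\<lambda>z. trace (snd z))"
  "trace_poly (\<lambda>z. trace (tA z ** tA z))" "trace_poly (\<lambda>z. trace (tA z ** tB z))"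
  "trace_poly (\<lambda>z. trace (tB z ** tB z))" "trace_poly (\<lambda>z. trace (tA z ** tA z ** tA z))"
  "trace_poly (\<lambda>z. trace (tA z ** tA z ** tB z))" "trace_poly (\<lambda>z. trace (tA z ** tB z ** tB z))"
  "trace_poly (\<lambda>z. trace (tB z ** tB z ** tB z))"
  using trace_poly_tau[of 1] trace_poly_tau[of 2]
    trace_poly_divide[OF trace_poly_tau[of 3], of "l ^ 2"] trace_poly_divide[OF trace_poly_tau[of 4], of "l ^ 2"]
    trace_poly_divide[OF trace_poly_tau[of 5], of "l ^ 2"] trace_poly_divide[OF trace_poly_tau[of 6], of "l ^ 3"]
    trace_poly_divide[OF trace_poly_tau[of 7], of "l ^ 3"] trace_poly_divide[OF trace_poly_tau[of 8], of "l ^ 3"]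
    trace_poly_divide[OF trace_poly_tau[of 9], of "l ^ 3"]
  by (simp_all add: tau_simps tau_simps(1)[unfolded One_nat_def] l)

end

text \<open>In words, the letter \<^const>\<open>False\<close> stands for \<open>A\<close> and \<^const>\<open>True\<close> for \<open>B\<close>.\<close>

fun wd :: "mat3 \<Rightarrow> mat3 \<Rightarrow> bool list \<Rightarrow> mat3" where
  "wd A B [] = mat 1"
| "wd A B (x # xs) = (if x then B else A) ** wd A B xs"

lemma wd_append: "wd A B (u @ w) = wd A B u ** wd A B w"
  by (induction u) (simp_all add: matrix_mul_assoc)

section \<open>Values of words against the rank one matrix\<close>

definition jw :: "bool list \<Rightarrow> mat3 \<times> mat3 \<Rightarrow> complex" where
  "jw w z = cm_pair.jj (tA z) (tB z) (wd (tA z) (tB z) w)"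

lemma swap_invariant_insort:
  fixes Q :: "bool list \<Rightarrow> bool"
  assumes "\<And>u x y w. Q (u @ [x, y] @ w) \<longleftrightarrow> Q (u @ [y, x] @ w)"
  shows "Q (u @ x # ys) \<longleftrightarrow> Q (u @ insort x ys)"
proof (induction ys arbitrary: u)
  case (Cons y ys)
  have "Q (u @ x # y # ys) \<longleftrightarrow> Q (u @ y # insort x ys)"
    using assms[of u x y ys] Cons[of "u @ [y]"] by (simp only: append_Cons append_Nil append_assoc)
  then show ?case by (auto simp del: append_Cons)
qed simp

text \<open>Insertion sort consists of adjacent transpositions; the arbitrary prefix
  \<open>u\<close> keeps the statement inductive.\<close>

lemma swap_invariant_sort:
  fixes Q :: "bool list \<Rightarrow> bool"
  assumes "\<And>u x y w. Q (u @ [x, y] @ w) \<longleftrightarrow> Q (u @ [y, x] @ w)"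
  shows "Q (u @ ys) \<longleftrightarrow> Q (u @ sort ys)"
proof (induction ys arbitrary: u)
  case (Cons y ys)
  show ?case using Cons[of "u @ [y]"] swap_invariant_insort[of Q, OF assms] by simp
qed simp

lemma sort_bool: "\<exists>a b. sort w = replicate a False @ replicate b True"
proof (induction w)
  case (Cons x w)
  then obtain a b where s: "sort w = replicate a False @ replicate b True" by auto
  have "insort True (replicate a False @ replicate b True) = replicate a False @ replicate (Suc b) True"
    by (induction a) (cases b, simp_all)
  moreover have "insort False (replicate a False @ replicate b True) = replicate (Suc a) False @ replicate b True"
    by (cases a; cases b) simp_all
  ultimately show ?case using s by (cases x) (metis sort_key_simps(2))+
qed simp

lemma jw_traces:
  assumes z: "z \<in> CMbar"
  shows "jw [] z = 3" "jw [False] z = 0" "jw [True] z = 0"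
    "jw [False, False] z = trace (tA z ** tA z)" "jw [True, True] z = trace (tB z ** tB z)"
    "jw [False, True] z = trace (tA z ** tB z) + 3" "jw [True, False] z = trace (tA z ** tB z) - 3"
    "jw [False, False, True] z = trace (tA z ** tA z ** tB z)"
    "jw [True, False, False] z = trace (tA z ** tA z ** tB z)"
    "jw [False, True, True] z = trace (tA z ** tB z ** tB z)"
    "jw [True, True, False] z = trace (tA z ** tB z ** tB z)"
    "jw [False, False, True, True] z =
      (2 * trace (tA z ** tB z) ^ 2 + trace (tA z ** tA z) * trace (tB z ** tB z)) / 6 + trace (tA z ** tB z)"
    "jw [True, True, False, False] z =
      (2 * trace (tA z ** tB z) ^ 2 + trace (tA z ** tA z) * trace (tB z ** tB z)) / 6 - trace (tA z ** tB z)"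
proof -
  interpret cm_pair "tA z" "tB z" "iv z" "jv z" by (rule cm_pair_CMbar[OF z])
  note [simp] = jw_def matrix_mul_assoc
  show "jw [] z = 3" "jw [False] z = 0" "jw [True] z = 0"
    "jw [False, False] z = trace (tA z ** tA z)" "jw [True, True] z = trace (tB z ** tB z)"
    "jw [False, True] z = trace (tA z ** tB z) + 3" "jw [True, False] z = trace (tA z ** tB z) - 3"
    "jw [False, False, True] z = trace (tA z ** tA z ** tB z)"
    "jw [True, False, False] z = trace (tA z ** tA z ** tB z)"
    "jw [False, True, True] z = trace (tA z ** tB z ** tB z)"
    "jw [True, True, False] z = trace (tA z ** tB z ** tB z)"
    by (simp_all add: jj_1 jj_A jj_B jj_AA jj_BB jj_AB jj_BA jj_AAB_all jj_ABB_all)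
  show "jw [False, False, True, True] z =
      (2 * trace (tA z ** tB z) ^ 2 + trace (tA z ** tA z) * trace (tB z ** tB z)) / 6 + trace (tA z ** tB z)"
    "jw [True, True, False, False] z =
      (2 * trace (tA z ** tB z) ^ 2 + trace (tA z ** tA z) * trace (tB z ** tB z)) / 6 - trace (tA z ** tB z)"
    by (simp_all add: jj_AABB_all trace_AABB field_simps)
qed

lemma jw_swap:
  assumes z: "z \<in> CMbar"
  shows "jw (u @ [False, True] @ w) z = jw (u @ [True, False] @ w) z + jw u z * jw w z - jw (u @ w) z"
proof -
  interpret cm_pair "tA z" "tB z" "iv z" "jv z" by (rule cm_pair_CMbar[OF z])
  show ?thesis
    using jj_swap[of "wd (tA z) (tB z) u" "wd (tA z) (tB z) w"]
    by (simp add: jw_def wd_append matrix_mul_assoc)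
qed

lemma jw_cube:
  assumes z: "z \<in> CMbar"
  shows "jw (u @ [False, False, False] @ w) z =
      trace (tA z ** tA z) / 2 * jw (u @ [False] @ w) z + trace (tA z ** tA z ** tA z) / 3 * jw (u @ w) z"
    and "jw (u @ [True, True, True] @ w) z =
      trace (tB z ** tB z) / 2 * jw (u @ [True] @ w) z + trace (tB z ** tB z ** tB z) / 3 * jw (u @ w) z"
proof -
  interpret cm_pair "tA z" "tB z" "iv z" "jv z" by (rule cm_pair_CMbar[OF z])
  let ?w = "wd (tA z) (tB z)"
  have rot: "trace (?w u ** X ** ?w w ** P) = trace (X ** (?w w ** P ** ?w u))" for X
    by (metis matrix_mul_assoc trace_mul_sym)
  have rot0: "trace (?w u ** ?w w ** P) = trace (?w w ** P ** ?w u)"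
    by (metis matrix_mul_assoc trace_mul_sym)
  show "jw (u @ [False, False, False] @ w) z =
      trace (tA z ** tA z) / 2 * jw (u @ [False] @ w) z + trace (tA z ** tA z ** tA z) / 3 * jw (u @ w) z"
    using trace_AAA[of "?w w ** P ** ?w u"] rot[of "tA z ** tA z ** tA z"] rot[of "tA z"] rot0
    by (simp add: jw_def wd_append jj_def matrix_mul_assoc)
  show "jw (u @ [True, True, True] @ w) z =
      trace (tB z ** tB z) / 2 * jw (u @ [True] @ w) z + trace (tB z ** tB z ** tB z) / 3 * jw (u @ w) z"
    using trace_BBB[of "?w w ** P ** ?w u"] rot[of "tB z ** tB z ** tB z"] rot[of "tB z"] rot0
    by (simp add: jw_def wd_append jj_def matrix_mul_assoc)
qed

context scaled
begin

text \<open>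
  Modulo products of shorter words the letters commute, and the Cayley--Hamilton theorem removes
  cubes; only the sorted words with at most two letters of each kind remain.
\<close>

lemma trace_poly_jw: "trace_poly (jw w)"
proof (induction w rule: measure_induct_rule[of length])
  case (less w)
  note IH = less
  \<comment> \<open>The guard on the length makes \<open>Q\<close> stable under every adjacent swap:
    at the length of \<open>w\<close> the corrections are covered by the induction hypothesis, and
    at other lengths \<open>Q\<close> holds trivially.\<close>
  define Q where "Q x \<longleftrightarrow> length x = length w \<longrightarrow> trace_poly (jw x)" for x
  have swap: "trace_poly (jw (u @ [False, True] @ x)) \<longleftrightarrow> trace_poly (jw (u @ [True, False] @ x))"
    if len: "length u + length x + 2 = length w" for u x
  proof -
    have sh: "trace_poly (jw u)" "trace_poly (jw x)" "trace_poly (jw (u @ x))"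
      using IH len by auto
    have d: "trace_poly (\<lambda>z. jw u z * jw x z - jw (u @ x) z)"
      by (intro trace_poly_diff trace_poly_mult sh)
    have e: "trace_poly (jw (u @ [False, True] @ x)) \<longleftrightarrow>
        trace_poly (\<lambda>z. jw (u @ [True, False] @ x) z + (jw u z * jw x z - jw (u @ x) z))"
      by (rule trace_poly_cong) (simp only: jw_swap add_diff_eq)
    show ?thesis
      unfolding e using trace_poly_add[OF _ d, of "jw (u @ [True, False] @ x)"]
        trace_poly_diff[OF _ d, of "\<lambda>z. jw (u @ [True, False] @ x) z + (jw u z * jw x z - jw (u @ x) z)"]
      by (auto simp del: append_Cons)
  qed
  have Q_swap: "Q (u @ [a, b] @ x) \<longleftrightarrow> Q (u @ [b, a] @ x)" for u a b x
  proof (cases "length u + length x + 2 = length w")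
    case True
    show ?thesis
      using swap[OF True] by (cases a; cases b) (simp_all add: Q_def del: append_Cons)
  next
    case False
    then show ?thesis by (simp add: Q_def)
  qed
  obtain a b where s: "sort w = replicate a False @ replicate b True"
    using sort_bool by blast
  have len: "length w = a + b"
    using arg_cong[OF s, of length] by simp
  have "trace_poly (jw (replicate a False @ replicate b True))"
  proof -
    consider "a \<ge> 3" | "b \<ge> 3" | "a \<le> 2" "b \<le> 2" by linarith
    then show ?thesis
    proof cases
      case 1
      then obtain a' where a': "a = 3 + a'" using le_Suc_ex by blast
      define x where "x = replicate a' False @ replicate b True"
      have e: "replicate a False @ replicate b True = [] @ [False, False, False] @ x"
        by (simp add: x_def a' replicate_add numeral_3_eq_3)
      have "trace_poly (jw ([] @ [False] @ x))" "trace_poly (jw ([] @ x))"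
        by (rule IH, use a' len in \<open>simp add: x_def\<close>)+
      then have "trace_poly (\<lambda>z. trace (tA z ** tA z) / 2 * jw ([] @ [False] @ x) z + trace (tA z ** tA z ** tA z) / 3 * jw ([] @ x) z)"
        by (intro trace_poly_add trace_poly_mult trace_poly_divide trace_poly_traces)
      then show ?thesis unfolding e
        by (subst trace_poly_cong[OF jw_cube(1)])
    next
      case 2
      then obtain b' where b': "b = b' + 3" using le_Suc_ex by (metis add.commute)
      define x where "x = replicate a False @ replicate b' True"
      have "replicate b True = replicate b' True @ [True, True, True]"
        by (simp only: b' replicate_add) (simp add: numeral_3_eq_3)
      then have e: "replicate a False @ replicate b True = x @ [True, True, True] @ []"
        by (simp add: x_def)
      have "trace_poly (jw (x @ [True] @ []))" "trace_poly (jw (x @ []))"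
        by (rule IH, use b' len in \<open>simp add: x_def\<close>)+
      then have "trace_poly (\<lambda>z. trace (tB z ** tB z) / 2 * jw (x @ [True] @ []) z + trace (tB z ** tB z ** tB z) / 3 * jw (x @ []) z)"
        by (intro trace_poly_add trace_poly_mult trace_poly_divide trace_poly_traces)
      then show ?thesis unfolding e
        by (subst trace_poly_cong[OF jw_cube(2)])
    next
      case 3
      have "a \<in> {0, 1, 2}" "b \<in> {0, 1, 2}" using 3 by auto
      moreover have "trace_poly (jw [])" "trace_poly (jw [False])" "trace_poly (jw [True])"
        "trace_poly (jw [False, False])" "trace_poly (jw [True, True])" "trace_poly (jw [False, True])"
        "trace_poly (jw [False, False, True])" "trace_poly (jw [False, True, True])"
        "trace_poly (jw [False, False, True, True])"
        by (subst trace_poly_cong, erule jw_traces, intro trace_poly_add trace_poly_mult trace_poly_divide trace_poly_power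
            trace_poly_const trace_poly_traces)+
      ultimately show ?thesis
        by (auto simp: numeral_2_eq_2)
    qed
  qed
  then have "Q ([] @ sort w)" by (simp add: s Q_def)
  then have "Q ([] @ w)" using swap_invariant_sort[of Q, OF Q_swap] by blast
  then show ?case by (simp add: Q_def)
qed

end

section \<open>Charts of the Calogero-Moser space\<close>

lemma matrix_inv_mult:
  fixes g :: mat3
  assumes "invertible g"
  shows "matrix_inv g ** g = mat 1" "g ** matrix_inv g = mat 1"
  using someI_ex[of "\<lambda>h. g ** h = mat 1 \<and> h ** g = mat 1"] assms
  by (auto simp: invertible_def matrix_inv_def)

text \<open>The columns are vectors \<open>w i\<close>, and the rows of \<open>rowmat\<close> are
  covectors \<open>j w\<close>. Neither matrix is invariant, but their product is a matrix of values
  \<open>jw\<close>, hence of polynomials in the traces.\<close>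

definition colmat :: "(3 \<Rightarrow> bool list) \<Rightarrow> mat3 \<times> mat3 \<Rightarrow> mat3" where
  "colmat L z = (\<chi> a b. (wd (tA z) (tB z) (L b) *v iv z) $ a)"

definition rowmat :: "(3 \<Rightarrow> bool list) \<Rightarrow> mat3 \<times> mat3 \<Rightarrow> mat3" where
  "rowmat L z = (\<chi> b a. (jv z v* wd (tA z) (tB z) (L b)) $ a)"

definition jmat :: "(3 \<Rightarrow> bool list) \<Rightarrow> bool list \<Rightarrow> (3 \<Rightarrow> bool list) \<Rightarrow> mat3 \<times> mat3 \<Rightarrow> mat3" where
  "jmat M u L z = (\<chi> b c. jw (M b @ u @ L c) z)"

lemma rowmat_colmat:
  assumes z: "z \<in> CMbar"
  shows "rowmat M z ** wd (tA z) (tB z) u ** colmat L z = jmat M u L z"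
proof -
  interpret cm_pair "tA z" "tB z" "iv z" "jv z" by (rule cm_pair_CMbar[OF z])
  show ?thesis
    by (simp add: vec_eq_iff rowmat_def colmat_def jmat_def jw_def jj_alt wd_append
        matrix_matrix_mult_def matrix_vector_mult_def vector_matrix_mult_def sum_3)
      (simp add: algebra_simps)
qed

definition Dnum :: "(3 \<Rightarrow> bool list) \<Rightarrow> bool list \<Rightarrow> (3 \<Rightarrow> bool list) \<Rightarrow> 3 \<Rightarrow> 3 \<Rightarrow> mat3 \<times> mat3 \<Rightarrow> complex" where
  "Dnum M u L k c z = det (\<chi> r s. if s = k then jmat M u L z $ r $ c else jmat M [] L z $ r $ s :: mat3)"

definition hdet :: "(3 \<Rightarrow> bool list) \<Rightarrow> (3 \<Rightarrow> bool list) \<Rightarrow> mat3 \<times> mat3 \<Rightarrow> complex" where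
  "hdet M L z = det (jmat M [] L z)"

text \<open>If \<open>N\<close> is the matrix of the word \<open>u\<close> in the basis of the
  columns of \<open>colmat L\<close>, and \<open>G = jmat M [] L\<close>, then
  \<open>G ** N = jmat M u L\<close>. Cramer's rule solves this for the entries of \<open>N\<close>,
  with numerators \<open>Dnum\<close> and denominator \<open>hdet\<close>.\<close>

lemma chart_entry:
  assumes z: "z \<in> CMbar" and h: "hdet M L z \<noteq> 0"
  shows "invertible (colmat L z)"
    and "hdet M L z * (matrix_inv (colmat L z) ** wd (tA z) (tB z) u ** colmat L z) $ k $ c = Dnum M u L k c z"
proof -
  let ?V = "colmat L z" and ?W = "rowmat M z" and ?G = "jmat M [] L z"
  let ?N = "matrix_inv ?V ** wd (tA z) (tB z) u ** ?V"
  have G: "?G = ?W ** ?V"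
    using rowmat_colmat[OF z, of M "[]" L] by simp
  then have "det ?W * det ?V \<noteq> 0"
    using h by (simp add: hdet_def det_mul)
  then show inv: "invertible ?V"
    by (simp add: invertible_det_nz)
  have VV: "?V ** matrix_inv ?V = mat 1"
    using inv by (simp add: matrix_inv_mult)
  have "?G ** ?N = ?W ** (?V ** matrix_inv ?V) ** wd (tA z) (tB z) u ** ?V"
    by (simp only: G matrix_mul_assoc)
  also have "\<dots> = jmat M u L z"
    by (simp add: VV rowmat_colmat[OF z])
  finally have GN: "?G ** ?N = jmat M u L z" .
  have "?G *v (\<chi> r. ?N $ r $ c) = (\<chi> r. jmat M u L z $ r $ c)"
    unfolding GN[symmetric] by (simp add: vec_eq_iff matrix_vector_mult_def matrix_matrix_mult_def)
  moreover have "det ?G \<noteq> 0" using h by (simp add: hdet_def)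
  ultimately have "(\<chi> r. ?N $ r $ c) = (\<chi> k. det (\<chi> i j. if j = k then (\<chi> r. jmat M u L z $ r $ c) $ i else ?G $ i $ j) / det ?G)"
    using cramer by blast
  then have "?N $ k $ c = Dnum M u L k c z / hdet M L z"
    by (simp add: vec_eq_iff Dnum_def hdet_def cong: if_cong)
  then show "hdet M L z * ?N $ k $ c = Dnum M u L k c z"
    using h by simp
qed

context scaled
begin

lemma trace_poly_jmat: "trace_poly (\<lambda>z. jmat M u L z $ b $ c)"
  by (simp add: jmat_def trace_poly_jw)

lemma trace_poly_hdet: "trace_poly (hdet M L)"
  unfolding hdet_def det_3
  by (intro trace_poly_add trace_poly_diff trace_poly_mult trace_poly_jmat)

lemma trace_poly_if: "trace_poly f \<Longrightarrow> trace_poly g \<Longrightarrow> trace_poly (\<lambda>z. if b then f z else g z)"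
  by (cases b) simp_all

lemma trace_poly_Dnum: "trace_poly (Dnum M u L k c)"
  unfolding Dnum_def det_3 vec_lambda_beta
  by (intro trace_poly_add trace_poly_diff trace_poly_mult trace_poly_if trace_poly_jmat)

text \<open>A polynomial expression in entries with denominator \<open>h\<close> acquires a power of
  \<open>h\<close> as denominator. \<open>F\<close> itself need not be polynomial, and
  \<open>g\<close> is left free where \<open>h\<close> vanishes.\<close>

lemma polyfun_denominator:
  assumes h: "trace_poly h"
    and X: "\<And>k c. \<exists>g. trace_poly g \<and> (\<forall>z\<in>CMbar. h z \<noteq> 0 \<longrightarrow> g z = h z * fst (F z) $ k $ c)"
    and Y: "\<And>k c. \<exists>g. trace_poly g \<and> (\<forall>z\<in>CMbar. h z \<noteq> 0 \<longrightarrow> g z = h z * snd (F z) $ k $ c)"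
    and f: "f \<in> polyfuns"
  shows "\<exists>n g. trace_poly g \<and> (\<forall>z\<in>CMbar. h z \<noteq> 0 \<longrightarrow> g z = h z ^ n * f (F z))"
  using f
proof induction
  case (const c)
  show ?case by (intro exI[of _ 0] exI[of _ "\<lambda>_. c"]) auto
next
  case (entry_fst i j)
  show ?case using X[of i j] by (intro exI[of _ 1]) (auto simp: case_prod_unfold)
next
  case (entry_snd i j)
  show ?case using Y[of i j] by (intro exI[of _ 1]) (auto simp: case_prod_unfold)
next
  case (add f g)
  then obtain m n f' g' where *: "trace_poly f'" "\<forall>z\<in>CMbar. h z \<noteq> 0 \<longrightarrow> f' z = h z ^ m * f (F z)"
    "trace_poly g'" "\<forall>z\<in>CMbar. h z \<noteq> 0 \<longrightarrow> g' z = h z ^ n * g (F z)"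
    by blast
  show ?case
    by (intro exI[of _ "m + n"] exI[of _ "\<lambda>z. h z ^ n * f' z + h z ^ m * g' z"] conjI
        trace_poly_add trace_poly_mult trace_poly_power h *(1,3))
      (use * in \<open>auto simp: power_add algebra_simps\<close>)
next
  case (mult f g)
  then obtain m n f' g' where *: "trace_poly f'" "\<forall>z\<in>CMbar. h z \<noteq> 0 \<longrightarrow> f' z = h z ^ m * f (F z)"
    "trace_poly g'" "\<forall>z\<in>CMbar. h z \<noteq> 0 \<longrightarrow> g' z = h z ^ n * g (F z)"
    by blast
  show ?case
    by (intro exI[of _ "m + n"] exI[of _ "\<lambda>z. f' z * g' z"] conjI trace_poly_mult *(1,3))
      (use * in \<open>auto simp: power_add algebra_simps\<close>)
qed

end

lemma conj_act_CMbar: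
  assumes z: "z \<in> CMbar" and g: "invertible g"
  shows "conj_act g z \<in> CMbar"
proof -
  obtain X Y where zz: "z = (X, Y)" by (cases z)
  obtain i j where ij: "X ** Y - Y ** X + mat 1 = outer i j"
    using z by (auto simp: zz CMbar_iff)
  let ?h = "matrix_inv g"
  have hg: "?h ** g = mat 1" "g ** ?h = mat 1" using g by (simp_all add: matrix_inv_mult)
  have m: "(g ** U ** ?h) ** (g ** W ** ?h) = g ** (U ** W) ** ?h" for U W
    by (metis hg(1) matrix_mul_assoc matrix_mul_rid)
  have "(g ** X ** ?h) ** (g ** Y ** ?h) - (g ** Y ** ?h) ** (g ** X ** ?h) + mat 1 =
      g ** (X ** Y - Y ** X + mat 1) ** ?h"
    unfolding m by (simp add: matrix_add_ldistrib matrix_add_rdistrib matrix_diff_ldistrib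
        matrix_diff_rdistrib hg)
  also have "\<dots> = outer (g *v i) (j v* ?h)"
    unfolding ij by (simp add: vec_eq_iff outer_def matrix_matrix_mult_def matrix_vector_mult_def
        vector_matrix_mult_def sum_3 algebra_simps)
  finally show ?thesis by (auto simp: zz conj_act_def CMbar_iff)
qed

definition triple :: "'a \<Rightarrow> 'a \<Rightarrow> 'a \<Rightarrow> 3 \<Rightarrow> 'a" where
  "triple a b c k = (if k = 1 then a else if k = 2 then b else c)"

lemma triple_simps: "triple a b c 1 = a" "triple a b c 2 = b" "triple a b c 3 = c"
  by (simp_all add: triple_def)

section \<open>The ideal of denominators of an invariant function\<close>

context scaled
begin

text \<open>Within the trace polynomials this is the radical of the conductor ideal, formed by those
  \<open>s\<close> for which \<open>s f\<close> is a trace polynomial. It suffices to find a nonzero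
  constant in it.\<close>

definition denominators :: "(mat3 \<times> mat3 \<Rightarrow> complex) \<Rightarrow> (mat3 \<times> mat3 \<Rightarrow> complex) set" where
  "denominators f = {t. trace_poly t \<and> (\<exists>n. trace_poly (\<lambda>z. t z ^ n * f z))}"

lemma denominators_cong:
  assumes "t \<in> denominators f" "\<And>z. z \<in> CMbar \<Longrightarrow> s z = t z"
  shows "s \<in> denominators f"
proof -
  have "trace_poly s \<longleftrightarrow> trace_poly t" "\<And>n. trace_poly (\<lambda>z. s z ^ n * f z) \<longleftrightarrow> trace_poly (\<lambda>z. t z ^ n * f z)"
    by (rule trace_poly_cong, simp add: assms)+
  then show ?thesis using assms(1) by (simp add: denominators_def)
qed

lemma denominators_mult:
  assumes "t \<in> denominators f" "trace_poly s"
  shows "(\<lambda>z. s z * t z) \<in> denominators f"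
proof -
  obtain n where n: "trace_poly t" "trace_poly (\<lambda>z. t z ^ n * f z)"
    using assms by (auto simp: denominators_def)
  have "trace_poly (\<lambda>z. s z ^ n * (t z ^ n * f z))"
    by (intro trace_poly_mult trace_poly_power assms n)
  then have "trace_poly (\<lambda>z. (s z * t z) ^ n * f z)"
    by (simp add: power_mult_distrib mult.assoc)
  then show ?thesis using n assms by (auto simp: denominators_def)
qed

lemma denominators_root:
  assumes "(\<lambda>z. t z ^ k) \<in> denominators f" "trace_poly t"
  shows "t \<in> denominators f"
  using assms by (auto simp: denominators_def simp flip: power_mult)

text \<open>In the binomial expansion with exponent \<open>m + n\<close>, every term contains
  \<open>s ^ m\<close> or \<open>t ^ n\<close>.\<close>

lemma denominators_add:
  assumes s: "s \<in> denominators f" and t: "t \<in> denominators f"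
  shows "(\<lambda>z. s z + t z) \<in> denominators f"
proof -
  obtain m n where m: "trace_poly s" "trace_poly (\<lambda>z. s z ^ m * f z)"
    and n: "trace_poly t" "trace_poly (\<lambda>z. t z ^ n * f z)"
    using assms by (auto simp: denominators_def)
  have summand: "trace_poly (\<lambda>z. of_nat ((m + n) choose k) * s z ^ k * t z ^ (m + n - k) * f z)" for k
  proof (cases "m \<le> k")
    case True
    have "trace_poly (\<lambda>z. of_nat ((m + n) choose k) * s z ^ (k - m) * t z ^ (m + n - k) * (s z ^ m * f z))"
      by (intro trace_poly_mult trace_poly_power trace_poly_const m n)
    moreover have "s z ^ k = s z ^ (k - m) * s z ^ m" for z
      using True by (simp flip: power_add)
    ultimately show ?thesis by (simp add: mult_ac)
  next
    case False
    have "trace_poly (\<lambda>z. of_nat ((m + n) choose k) * s z ^ k * t z ^ (m - k) * (t z ^ n * f z))"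
      by (intro trace_poly_mult trace_poly_power trace_poly_const m n)
    moreover have "t z ^ (m + n - k) = t z ^ (m - k) * t z ^ n" for z
      using False by (simp flip: power_add)
    ultimately show ?thesis by (simp add: mult_ac)
  qed
  have "trace_poly (\<lambda>z. (s z + t z) ^ (m + n) * f z)"
    unfolding binomial_ring sum_distrib_right by (intro trace_poly_sum summand)
  then show ?thesis using m n by (auto simp: denominators_def)
qed

text \<open>Conjugation by the inverse of \<open>colmat\<close> writes the pair in the basis of the
  vectors \<open>w i\<close>, where its entries have denominator \<open>hdet\<close>; by invariance,
  \<open>f\<close> takes the same value there.\<close>

lemma hdet_denominator:
  assumes f: "f \<in> polyfuns"
    and inv: "\<And>g z. invertible g \<Longrightarrow> z \<in> CMbar \<Longrightarrow> f (conj_act g z) = f z"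
  shows "hdet M L \<in> denominators f"
proof -
  define F where "F z = conj_act (matrix_inv (colmat L z)) z" for z
  have entries: "hdet M L z * fst (F z) $ k $ c =
        Dnum M [False] L k c z + (if k = c then hdet M L z * (trace (fst z) / 3) else 0)"
      "hdet M L z * snd (F z) $ k $ c =
        Dnum M [True] L k c z + (if k = c then hdet M L z * (trace (snd z) / 3) else 0)"
      "f (F z) = f z"
    if z: "z \<in> CMbar" and h: "hdet M L z \<noteq> 0" for z k c
  proof -
    let ?V = "colmat L z"
    let ?U = "matrix_inv ?V"
    have V: "invertible ?V" by (rule chart_entry(1)[OF z h])
    note UV = matrix_inv_mult[OF V]
    have U: "invertible ?U" using UV by (auto simp: invertible_def)
    have "matrix_inv ?U = ?V"
      by (metis UV(1) matrix_inv_mult(2)[OF U] matrix_inv_mult(1)[OF V] matrix_mul_assoc matrix_mul_lid matrix_mul_rid UV(2))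
    then have F: "F z = (?U ** fst z ** ?V, ?U ** snd z ** ?V)"
      by (simp add: F_def conj_act_def case_prod_unfold)
    have shift: "?U ** X ** ?V = ?U ** tfree X ** ?V + mat (trace X / 3)" for X
    proof -
      have "?U ** X ** ?V = ?U ** (tfree X + mat (trace X / 3)) ** ?V" by (simp add: tfree_def)
      also have "\<dots> = ?U ** tfree X ** ?V + mat (trace X / 3) ** (?U ** ?V)"
        by (simp add: matrix_add_ldistrib matrix_add_rdistrib mat_commute[of ?U] matrix_mul_assoc)
      finally show ?thesis by (simp add: UV)
    qed
    show "hdet M L z * fst (F z) $ k $ c =
        Dnum M [False] L k c z + (if k = c then hdet M L z * (trace (fst z) / 3) else 0)"
      using chart_entry(2)[OF z h, of "[False]" k c]
      by (simp add: F shift[of "fst z"] tA_def distrib_left) (simp add: mat_def)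
    show "hdet M L z * snd (F z) $ k $ c =
        Dnum M [True] L k c z + (if k = c then hdet M L z * (trace (snd z) / 3) else 0)"
      using chart_entry(2)[OF z h, of "[True]" k c]
      by (simp add: F shift[of "snd z"] tB_def distrib_left) (simp add: mat_def)
    show "f (F z) = f z"
      unfolding F_def by (rule inv[OF U z])
  qed
  have "\<exists>n g. trace_poly g \<and> (\<forall>z\<in>CMbar. hdet M L z \<noteq> 0 \<longrightarrow> g z = hdet M L z ^ n * f (F z))"
  proof (rule polyfun_denominator[OF trace_poly_hdet _ _ f])
    show "\<exists>g. trace_poly g \<and> (\<forall>z\<in>CMbar. hdet M L z \<noteq> 0 \<longrightarrow> g z = hdet M L z * fst (F z) $ k $ c)" for k c
      by (intro exI[of _ "\<lambda>z. Dnum M [False] L k c z + (if k = c then hdet M L z * (trace (fst z) / 3) else 0)"]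
        conjI trace_poly_add trace_poly_Dnum trace_poly_if trace_poly_mult trace_poly_hdet
        trace_poly_divide trace_poly_traces trace_poly_const) (simp add: entries)
    show "\<exists>g. trace_poly g \<and> (\<forall>z\<in>CMbar. hdet M L z \<noteq> 0 \<longrightarrow> g z = hdet M L z * snd (F z) $ k $ c)" for k c
      by (intro exI[of _ "\<lambda>z. Dnum M [True] L k c z + (if k = c then hdet M L z * (trace (snd z) / 3) else 0)"]
        conjI trace_poly_add trace_poly_Dnum trace_poly_if trace_poly_mult trace_poly_hdet
        trace_poly_divide trace_poly_traces trace_poly_const) (simp add: entries)
  qed
  then obtain n g where g: "trace_poly g" "\<And>z. z \<in> CMbar \<Longrightarrow> hdet M L z \<noteq> 0 \<Longrightarrow> g z = hdet M L z ^ n * f z"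
    using entries(3) by metis
  \<comment> \<open>Where \<open>hdet\<close> vanishes, \<open>g\<close> is not controlled; one more
    factor \<open>hdet\<close> makes both sides zero there.\<close>
  have "trace_poly (\<lambda>z. hdet M L z * g z)"
    by (intro trace_poly_mult trace_poly_hdet g)
  moreover have "hdet M L z * g z = hdet M L z ^ Suc n * f z" if "z \<in> CMbar" for z
    using g(2)[OF that] by (cases "hdet M L z = 0") auto
  ultimately have "trace_poly (\<lambda>z. hdet M L z ^ Suc n * f z)"
    using trace_poly_cong by (metis (no_types, lifting))
  then show ?thesis
    unfolding denominators_def using trace_poly_hdet by blast
qed

end

text \<open>The triples are the monomial staircases of size three: \<open>1, A, A^2\<close>, then
  \<open>1, A, B\<close>, and \<open>1, B, B^2\<close>. Mixed determinants, with different triples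
  for rows and columns, are antisymmetrized to obtain simpler expressions than the symmetric ones
  give.\<close>

lemma hdet_values:
  assumes z: "z \<in> CMbar"
  defines "L3 \<equiv> triple [] [False] [False, False]" and "L21 \<equiv> triple [] [False] [True]"
    and "L1 \<equiv> triple [] [True] [True, True]"
  shows "hdet L3 L3 z = trace (tA z ** tA z) ^ 3 / 2 - 3 * trace (tA z ** tA z ** tA z) ^ 2"
    and "hdet L1 L1 z = trace (tB z ** tB z) ^ 3 / 2 - 3 * trace (tB z ** tB z ** tB z) ^ 2"
    and "hdet L21 L21 z = 3 * (trace (tA z ** tA z) * trace (tB z ** tB z) - trace (tA z ** tB z) ^ 2 + 9)"
    and "hdet L21 L3 z - hdet L3 L21 z = 18 * trace (tA z ** tA z ** tA z)"
    and "hdet L21 L1 z - hdet L1 L21 z = 18 * trace (tB z ** tB z ** tB z)"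
    and "hdet L3 L1 z - hdet L1 L3 z =
      12 * trace (tA z ** tB z) ^ 2 - 3 * trace (tA z ** tA z) * trace (tB z ** tB z)"
proof -
  have c: "jw [False, False, False] z = trace (tA z ** tA z ** tA z)"
    "jw [True, True, True] z = trace (tB z ** tB z ** tB z)"
    "jw [False, False, False, False] z = trace (tA z ** tA z) ^ 2 / 2"
    "jw [True, True, True, True] z = trace (tB z ** tB z) ^ 2 / 2"
    using jw_cube[OF z, of "[]" "[]"] jw_cube(1)[OF z, of "[]" "[False]"] jw_cube(2)[OF z, of "[]" "[True]"]
    by (simp_all add: jw_traces[OF z] power2_eq_square)
  note d = hdet_def det_3 jmat_def L3_def L21_def L1_def triple_simps jw_traces[OF z] c
  show "hdet L3 L3 z = trace (tA z ** tA z) ^ 3 / 2 - 3 * trace (tA z ** tA z ** tA z) ^ 2"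
    "hdet L1 L1 z = trace (tB z ** tB z) ^ 3 / 2 - 3 * trace (tB z ** tB z ** tB z) ^ 2"
    "hdet L21 L21 z = 3 * (trace (tA z ** tA z) * trace (tB z ** tB z) - trace (tA z ** tB z) ^ 2 + 9)"
    "hdet L21 L3 z - hdet L3 L21 z = 18 * trace (tA z ** tA z ** tA z)"
    "hdet L21 L1 z - hdet L1 L21 z = 18 * trace (tB z ** tB z ** tB z)"
    "hdet L3 L1 z - hdet L1 L3 z =
      12 * trace (tA z ** tB z) ^ 2 - 3 * trace (tA z ** tA z) * trace (tB z ** tB z)"
    by (simp_all add: d) (simp_all add: field_simps power2_eq_square power3_eq_cube)
qed

context scaled
begin

text \<open>The denominators of the charts generate the unit ideal.\<close>

lemma invariant_trace_poly:
  assumes f: "f \<in> polyfuns"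
    and inv: "\<And>g z. invertible g \<Longrightarrow> z \<in> CMbar \<Longrightarrow> f (conj_act g z) = f z"
  shows "trace_poly f"
proof -
  define L3 :: "3 \<Rightarrow> bool list" where "L3 = triple [] [False] [False, False]"
  define L21 :: "3 \<Rightarrow> bool list" where "L21 = triple [] [False] [True]"
  define L1 :: "3 \<Rightarrow> bool list" where "L1 = triple [] [True] [True, True]"
  note hv = hdet_values[folded L3_def L21_def L1_def]
  have H: "hdet M L \<in> denominators f" for M L
    by (rule hdet_denominator[OF f inv])
  have scale: "(\<lambda>z. c * t z) \<in> denominators f" if "t \<in> denominators f" for c t
    by (rule denominators_mult[OF that trace_poly_const])
  have diff: "(\<lambda>z. s z - t z) \<in> denominators f" if "s \<in> denominators f" "t \<in> denominators f" for s t
    using denominators_add[OF that(1) scale[OF that(2), of "- 1"]] by simp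
  define a3 a4 a5 a6 a9 where "a3 z = trace (tA z ** tA z)" and "a4 z = trace (tA z ** tB z)"
    and "a5 z = trace (tB z ** tB z)" and "a6 z = trace (tA z ** tA z ** tA z)"
    and "a9 z = trace (tB z ** tB z ** tB z)" for z
  note adefs = a3_def a4_def a5_def a6_def a9_def
  have tp: "trace_poly a3" "trace_poly a4" "trace_poly a5" "trace_poly a6" "trace_poly a9"
    unfolding adefs by (rule trace_poly_traces)+
  have d6: "a6 \<in> denominators f"
    by (rule denominators_cong[OF scale[OF diff[OF H[of L21 L3] H[of L3 L21]], of "1 / 18"]])
      (simp add: hv adefs)
  have d9: "a9 \<in> denominators f"
    by (rule denominators_cong[OF scale[OF diff[OF H[of L21 L1] H[of L1 L21]], of "1 / 18"]])
      (simp add: hv adefs)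
  \<comment> \<open>Here \<open>a3^3 = 2 hdet L3 L3 + 6 a6^2\<close>, and the radical contains the
    cube root.\<close>
  have "(\<lambda>z. a3 z ^ 3) \<in> denominators f"
    by (rule denominators_cong[OF denominators_add[OF scale[OF H[of L3 L3], of 2]
        scale[OF denominators_mult[OF d6 tp(4)], of 6]]])
      (simp add: hv adefs power2_eq_square field_simps)
  then have d3: "a3 \<in> denominators f" by (rule denominators_root[OF _ tp(1)])
  \<comment> \<open>Adding the last mixed difference to \<open>4 hdet L21 L21\<close> cancels
    \<open>a4^2\<close> and leaves \<open>9 a3 a5 + 108\<close>, where
    \<open>108 = 4 * 3 * 9\<close>.\<close>
  have "(\<lambda>z. 108) \<in> denominators f"
    by (rule denominators_cong[OF denominators_add[OF scale[OF H[of L21 L21], of 4]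
        diff[OF diff[OF H[of L3 L1] H[of L1 L3]] scale[OF denominators_mult[OF d3 tp(3)], of 9]]]])
      (simp add: hv adefs power2_eq_square field_simps)
  then obtain n where "trace_poly (\<lambda>z. 108 ^ n * f z)"
    by (auto simp: denominators_def)
  then have "trace_poly (\<lambda>z. (108 ^ n * f z) / 108 ^ n)"
    by (rule trace_poly_divide)
  then show ?thesis by simp
qed

end

section \<open>The coordinate ring of the deformed variety\<close>

lemma poly_calg_simps [simp]:
  "carrier (poly_calg V) = polys V" "mult (poly_calg V) = (*)" "one (poly_calg V) = 1"
  "zero (poly_calg V) = 0" "add (poly_calg V) = (+)" "scalar (poly_calg V) = Cst"
  by (simp_all add: poly_calg_def polys_def)

lemma cring_poly_calg: "cring (poly_calg V)"
proof (rule cringI)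
  show "abelian_group (poly_calg V)"
    by (rule abelian_groupI)
      (auto simp: algebra_simps intro: bexI[of _ "- _"] exI[of _ "- _"])
  show "comm_monoid (poly_calg V)"
    by (rule comm_monoidI) (auto simp: algebra_simps)
qed (auto simp: algebra_simps)

definition rel_ideal :: "complex \<Rightarrow> cpoly set" where
  "rel_ideal v = genideal (poly_calg {1..9}) {r1, r2, r3 v, r4 v, r5 v}"

lemma relations_in_polys: "{r1, r2, r3 v, r4 v, r5 v} \<subseteq> polys {1..9}"
  unfolding r1_def r2_def r3_def r4_def r5_def
  by (intro insert_subsetI polys_add polys_diff polys_mult polys_power polys_Var polys_Cst empty_subsetI; simp)

lemma ideal_rel_ideal: "ideal (rel_ideal v) (poly_calg {1..9})"
proof -
  interpret R: cring "poly_calg {1..9}" by (rule cring_poly_calg)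
  show ?thesis unfolding rel_ideal_def by (rule R.genideal_ideal) (use relations_in_polys in simp)
qed

lemma relations_in_rel_ideal: "{r1, r2, r3 v, r4 v, r5 v} \<subseteq> rel_ideal v"
proof -
  interpret R: cring "poly_calg {1..9}" by (rule cring_poly_calg)
  show ?thesis unfolding rel_ideal_def by (rule R.genideal_self) (use relations_in_polys in simp)
qed

lemma rel_ideal_add: "p \<in> rel_ideal v \<Longrightarrow> q \<in> rel_ideal v \<Longrightarrow> p + q \<in> rel_ideal v"
  using additive_subgroup.a_closed[OF ideal.axioms(1)[OF ideal_rel_ideal], of p v q] by simp

lemma rel_ideal_mult: "p \<in> rel_ideal v \<Longrightarrow> q \<in> polys {1..9} \<Longrightarrow> q * p \<in> rel_ideal v"
  using ideal.I_l_closed[OF ideal_rel_ideal, of p v q] by simp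

lemma rel_ideal_subset: "rel_ideal v \<subseteq> polys {1..9}"
  using additive_subgroup.a_subset[OF ideal.axioms(1)[OF ideal_rel_ideal], of v] by simp

lemma rel_ideal_zero: "0 \<in> rel_ideal v"
  using additive_subgroup.zero_closed[OF ideal.axioms(1)[OF ideal_rel_ideal], of v] by simp

lemma rel_ideal_uminus: "p \<in> rel_ideal v \<Longrightarrow> - p \<in> rel_ideal v"
  using rel_ideal_mult[of p v "- 1"] by auto

lemma rel_ideal_minimal:
  assumes "ideal J (poly_calg {1..9})" "{r1, r2, r3 v, r4 v, r5 v} \<subseteq> J"
  shows "rel_ideal v \<subseteq> J"
proof -
  interpret R: cring "poly_calg {1..9}" by (rule cring_poly_calg)
  show ?thesis unfolding rel_ideal_def by (rule R.genideal_minimal[OF assms])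
qed

text \<open>These are the traces of powers of \<open>A\<close> and of \<open>B\<close> separately,
  together with those of \<open>X\<close> and \<open>Y\<close>: the spectra of the two matrices. The
  mixed traces 4, 7 and 8 are finite over them.\<close>

abbreviation base_vars :: "nat set" where
  "base_vars \<equiv> {1, 2, 3, 5, 6, 9}"

definition nf :: "(nat \<Rightarrow> cpoly) \<Rightarrow> cpoly" where
  "nf c = c 0 + c 1 * Var 4 + c 2 * Var 4 ^ 2 + c 3 * Var 4 ^ 3 + c 4 * Var 7 + c 5 * Var 8"

text \<open>
  The coordinate ring will turn out to be free over the polynomials in the base variables, with
  the six basis elements occurring in \<^const>\<open>nf\<close>.
\<close>

definition nf_span :: "complex \<Rightarrow> cpoly set" where
  "nf_span v = {p. \<exists>c. (\<forall>i. c i \<in> polys base_vars) \<and> p - nf c \<in> rel_ideal v}"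

lemma nf_spanI: "(\<And>i. c i \<in> polys base_vars) \<Longrightarrow> p - nf c \<in> rel_ideal v \<Longrightarrow> p \<in> nf_span v"
  by (auto simp: nf_span_def)

lemma nf_span_add:
  assumes "p \<in> nf_span v" "q \<in> nf_span v" shows "p + q \<in> nf_span v"
proof -
  obtain c d where *: "\<And>i. c i \<in> polys base_vars" "p - nf c \<in> rel_ideal v"
    "\<And>i. d i \<in> polys base_vars" "q - nf d \<in> rel_ideal v"
    using assms by (auto simp: nf_span_def)
  have e: "p + q - nf (\<lambda>i. c i + d i) = (p - nf c) + (q - nf d)"
    by (simp add: nf_def algebra_simps)
  show ?thesis
    by (rule nf_spanI[of "\<lambda>i. c i + d i"], rule polys_add, rule *, rule *, subst e, rule rel_ideal_add[OF *(2,4)])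
qed

lemma nf_span_base_mult:
  assumes "p \<in> nf_span v" "b \<in> polys base_vars" shows "b * p \<in> nf_span v"
proof -
  obtain c where *: "\<And>i. c i \<in> polys base_vars" "p - nf c \<in> rel_ideal v"
    using assms by (auto simp: nf_span_def)
  have "b * p - nf (\<lambda>i. b * c i) = b * (p - nf c)"
    by (simp add: nf_def algebra_simps)
  moreover have "b \<in> polys {1..9}" using assms(2) polys_mono[of base_vars "{1..9}"] by auto
  ultimately show ?thesis using * assms(2) rel_ideal_mult by (intro nf_spanI[of "\<lambda>i. b * c i"]) auto
qed

lemma nf_span_cong:
  assumes "q \<in> nf_span v" "p - q \<in> rel_ideal v" shows "p \<in> nf_span v"
proof -
  obtain c where *: "\<And>i. c i \<in> polys base_vars" "q - nf c \<in> rel_ideal v"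
    using assms by (auto simp: nf_span_def)
  have "p - nf c = (p - q) + (q - nf c)" by simp
  then show ?thesis using * assms(2) rel_ideal_add by (metis nf_spanI)
qed

lemma nf_span_base: "b \<in> polys base_vars \<Longrightarrow> b \<in> nf_span v"
  by (rule nf_spanI[of "\<lambda>i. if i = 0 then b else 0"]) (auto simp: nf_def rel_ideal_zero)

lemma nf_span_basis:
  "Var 4 \<in> nf_span v" "Var 4 ^ 2 \<in> nf_span v" "Var 4 ^ 3 \<in> nf_span v" "Var 7 \<in> nf_span v" "Var 8 \<in> nf_span v"
proof -
  have *: "(if i = k then 1 else 0) \<in> polys base_vars" for i k :: nat by auto
  show "Var 4 \<in> nf_span v" "Var 4 ^ 2 \<in> nf_span v" "Var 4 ^ 3 \<in> nf_span v" "Var 7 \<in> nf_span v" "Var 8 \<in> nf_span v"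
    by (rule nf_spanI[of "\<lambda>i. if i = 1 then 1 else 0"], rule *, simp add: nf_def rel_ideal_zero)
      (rule nf_spanI[of "\<lambda>i. if i = 2 then 1 else 0"], rule *, simp add: nf_def rel_ideal_zero,
       rule nf_spanI[of "\<lambda>i. if i = 3 then 1 else 0"], rule *, simp add: nf_def rel_ideal_zero,
       rule nf_spanI[of "\<lambda>i. if i = 4 then 1 else 0"], rule *, simp add: nf_def rel_ideal_zero,
       rule nf_spanI[of "\<lambda>i. if i = 5 then 1 else 0"], rule *, simp add: nf_def rel_ideal_zero)
qed

lemma nf_span_cancel:
  assumes "numeral n * p \<in> nf_span v" shows "p \<in> nf_span v"
proof -
  have "Cst (1 / numeral n) * (numeral n * p) = Cst (1 / numeral n * numeral n) * p"
    by (simp only: Cst_mult Cst_numeral mult.assoc)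
  then have e: "Cst (1 / numeral n) * (numeral n * p) = p" by (simp add: Cst_1)
  have "Cst (1 / numeral n) * (numeral n * p) \<in> nf_span v"
    by (rule nf_span_base_mult[OF assms]) simp
  then show ?thesis by (simp only: e)
qed

lemma polys_base_Var:
  "Var 1 \<in> polys base_vars" "Var 2 \<in> polys base_vars" "Var 3 \<in> polys base_vars"
  "Var 5 \<in> polys base_vars" "Var 6 \<in> polys base_vars" "Var 9 \<in> polys base_vars"
  by (auto intro: polys_Var)

text \<open>Each relation serves as a rewrite rule for one product: the first for
  \<open>a4 a8\<close>, the second for \<open>a4 a7\<close>, the third for \<open>a7^2\<close>, the
  fourth for \<open>a7 a8\<close>, the fifth for \<open>a8^2\<close>.\<close>

lemma nf_span_products:
  "Var 4 * Var 8 \<in> nf_span v" "Var 4 * Var 7 \<in> nf_span v" "Var 7 * Var 7 \<in> nf_span v"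
  "Var 7 * Var 8 \<in> nf_span v" "Var 8 * Var 8 \<in> nf_span v" "Var 4 ^ 4 \<in> nf_span v"
proof -
  note B = polys_base_Var polys_numeral polys_Cst
  note base = nf_span_base_mult[OF _ polys_mult] nf_span_base_mult
  have rels: "r1 \<in> rel_ideal v" "r2 \<in> rel_ideal v" "r3 v \<in> rel_ideal v" "r4 v \<in> rel_ideal v" "r5 v \<in> rel_ideal v"
    using relations_in_rel_ideal by auto
  have neg: "Cst (3 * v) = 3 * Cst v" by (simp add: Cst_mult Cst_numeral)
  have s: "p + q \<in> nf_span v" "p - q \<in> nf_span v" if "p \<in> nf_span v" "q \<in> nf_span v" for p q
    using nf_span_add[OF that] nf_span_add[OF that(1) nf_span_base_mult[OF that(2), of "- 1"]] by auto
  have b: "b * p \<in> nf_span v" if "p \<in> nf_span v" "b \<in> polys base_vars" for b p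
    by (rule nf_span_base_mult[OF that])
  have one: "1 \<in> nf_span v" by (rule nf_span_base) simp
  have D: "x * (Var 3 * Var 5 - Var 4 ^ 2 - Cst (3 * v)) \<in> nf_span v"
    if "x \<in> nf_span v" "x * Var 4 ^ 2 \<in> nf_span v" for x
  proof -
    have "(Var 3 * Var 5) * x - x * Var 4 ^ 2 - Cst (3 * v) * x \<in> nf_span v"
      by (intro s b that polys_mult B)
    then show ?thesis by (simp add: algebra_simps)
  qed
  have D': "Var 3 * (Var 3 * Var 5 - Var 4 ^ 2 - Cst (3 * v)) \<in> nf_span v"
    "Var 5 * (Var 3 * Var 5 - Var 4 ^ 2 - Cst (3 * v)) \<in> nf_span v"
    using D[OF one] nf_span_basis(2) by (simp_all only: mult_1 b B)
  have "2 * (Var 4 * Var 8) \<in> nf_span v"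
  proof (rule nf_span_cong)
    show "Var 3 * Var 9 + Var 5 * Var 7 \<in> nf_span v"
      by (intro s b nf_span_basis B nf_span_base)
    have "2 * (Var 4 * Var 8) - (Var 3 * Var 9 + Var 5 * Var 7) = - r1"
      by (simp add: r1_def Cst_numeral algebra_simps)
    then show "2 * (Var 4 * Var 8) - (Var 3 * Var 9 + Var 5 * Var 7) \<in> rel_ideal v"
      using rel_ideal_uminus rels by simp
  qed
  then show "Var 4 * Var 8 \<in> nf_span v" by (rule nf_span_cancel)
  have "2 * (Var 4 * Var 7) \<in> nf_span v"
  proof (rule nf_span_cong)
    show "Var 3 * Var 8 + Var 5 * Var 6 \<in> nf_span v"
      by (intro s b nf_span_basis B nf_span_base)
    have "2 * (Var 4 * Var 7) - (Var 3 * Var 8 + Var 5 * Var 6) = - r2"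
      by (simp add: r2_def Cst_numeral algebra_simps)
    then show "2 * (Var 4 * Var 7) - (Var 3 * Var 8 + Var 5 * Var 6) \<in> rel_ideal v"
      using rel_ideal_uminus rels by simp
  qed
  then show "Var 4 * Var 7 \<in> nf_span v" by (rule nf_span_cancel)
  have "6 * (Var 7 * Var 7) \<in> nf_span v"
  proof (rule nf_span_cong)
    show "6 * (Var 6 * Var 8) + Var 3 * (Var 3 * Var 5 - Var 4 ^ 2 - Cst (3 * v)) \<in> nf_span v"
      by (intro s b nf_span_basis B nf_span_base D')
    have "6 * (Var 7 * Var 7) - (6 * (Var 6 * Var 8) + Var 3 * (Var 3 * Var 5 - Var 4 ^ 2 - Cst (3 * v))) = - r3 v"
      by (simp add: r3_def Cst_numeral algebra_simps power2_eq_square)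
    then show "6 * (Var 7 * Var 7) - (6 * (Var 6 * Var 8) + Var 3 * (Var 3 * Var 5 - Var 4 ^ 2 - Cst (3 * v))) \<in> rel_ideal v"
      using rel_ideal_uminus rels by simp
  qed
  then show 77: "Var 7 * Var 7 \<in> nf_span v" by (rule nf_span_cancel)
  have "6 * (Var 8 * Var 8) \<in> nf_span v"
  proof (rule nf_span_cong)
    show "6 * (Var 9 * Var 7) + Var 5 * (Var 3 * Var 5 - Var 4 ^ 2 - Cst (3 * v)) \<in> nf_span v"
      by (intro s b nf_span_basis B nf_span_base D')
    have "6 * (Var 8 * Var 8) - (6 * (Var 9 * Var 7) + Var 5 * (Var 3 * Var 5 - Var 4 ^ 2 - Cst (3 * v))) = - r5 v"
      by (simp add: r5_def Cst_numeral algebra_simps power2_eq_square)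
    then show "6 * (Var 8 * Var 8) - (6 * (Var 9 * Var 7) + Var 5 * (Var 3 * Var 5 - Var 4 ^ 2 - Cst (3 * v))) \<in> rel_ideal v"
      using rel_ideal_uminus rels by simp
  qed
  then show "Var 8 * Var 8 \<in> nf_span v" by (rule nf_span_cancel)
  have 4: "Var 4 * (Var 3 * Var 5 - Var 4 ^ 2 - Cst (3 * v)) \<in> nf_span v"
    by (rule D) (use nf_span_basis in \<open>simp_all flip: power_Suc\<close>)
  have "3 * (Var 7 * Var 8) \<in> nf_span v"
  proof (rule nf_span_cong)
    show "3 * (Var 6 * Var 9) + Var 4 * (Var 3 * Var 5 - Var 4 ^ 2 - Cst (3 * v)) \<in> nf_span v"
      by (intro s b nf_span_basis B nf_span_base 4)
    have "3 * (Var 7 * Var 8) - (3 * (Var 6 * Var 9) + Var 4 * (Var 3 * Var 5 - Var 4 ^ 2 - Cst (3 * v))) = - r4 v"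
      by (simp add: r4_def Cst_numeral algebra_simps power2_eq_square)
    then show "3 * (Var 7 * Var 8) - (3 * (Var 6 * Var 9) + Var 4 * (Var 3 * Var 5 - Var 4 ^ 2 - Cst (3 * v))) \<in> rel_ideal v"
      using rel_ideal_uminus rels by simp
  qed
  then show "Var 7 * Var 8 \<in> nf_span v" by (rule nf_span_cancel)
  have "2 * Var 4 ^ 4 \<in> nf_span v"
  proof (rule nf_span_cong)
    let ?q = "(2 * (Var 3 * Var 5)) * Var 4 ^ 2 - (2 * Cst (3 * v)) * Var 4 ^ 2 + (6 * (Var 6 * Var 9)) * Var 4 -
      (3 * (Var 3 * Var 9)) * Var 7 - (3 * Var 5) * (Var 7 * Var 7)"
    show "?q \<in> nf_span v"
      by (intro s b nf_span_basis B nf_span_base 77 polys_mult)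
    \<comment> \<open>In \<open>3 a7 r1 - 2 a4 r4\<close> the term \<open>a4 a7 a8\<close> cancels,
      and \<open>2 a4^4\<close> remains to be rewritten.\<close>
    have "2 * Var 4 ^ 4 - ?q = (3 * Var 7) * r1 + (- 2 * Var 4) * r4 v"
      by (simp add: r4_def r1_def Cst_numeral algebra_simps power_numeral_reduce)
    moreover have "(3 * Var 7) * r1 + (- 2 * Var 4) * r4 v \<in> rel_ideal v"
      by (intro rel_ideal_add rel_ideal_mult rels polys_mult polys_uminus polys_numeral polys_Var) auto
    ultimately show "2 * Var 4 ^ 4 - ?q \<in> rel_ideal v" by simp
  qed
  then show "Var 4 ^ 4 \<in> nf_span v" by (rule nf_span_cancel)
qed

text \<open>The span is a module over the base polynomials modulo an ideal, so stability under
  \<open>x\<close> can be tested on the six basis elements.\<close>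

lemma nf_span_mult:
  assumes x: "x \<in> polys {1..9}" and p: "p \<in> nf_span v"
    and basis: "x \<in> nf_span v" "x * Var 4 \<in> nf_span v" "x * Var 4 ^ 2 \<in> nf_span v" "x * Var 4 ^ 3 \<in> nf_span v"
      "x * Var 7 \<in> nf_span v" "x * Var 8 \<in> nf_span v"
  shows "x * p \<in> nf_span v"
proof -
  obtain c where *: "\<And>i. c i \<in> polys base_vars" "p - nf c \<in> rel_ideal v"
    using p by (auto simp: nf_span_def)
  have "c 0 * x + c 1 * (x * Var 4) + c 2 * (x * Var 4 ^ 2) + c 3 * (x * Var 4 ^ 3) + c 4 * (x * Var 7) + c 5 * (x * Var 8) \<in> nf_span v"
    by (intro nf_span_add nf_span_base_mult basis *)
  moreover have "x * p - (c 0 * x + c 1 * (x * Var 4) + c 2 * (x * Var 4 ^ 2) + c 3 * (x * Var 4 ^ 3) + c 4 * (x * Var 7) + c 5 * (x * Var 8)) = x * (p - nf c)"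
    by (simp add: nf_def algebra_simps)
  ultimately show ?thesis
    using rel_ideal_mult[OF *(2) x] by (metis nf_span_cong)
qed

lemma polys_subset_nf_span:
  assumes "p \<in> polys {1..9}" shows "p \<in> nf_span v"
proof -
  have V4: "Var 4 * p \<in> nf_span v" if "p \<in> nf_span v" for p
    by (rule nf_span_mult[OF _ that])
      (use nf_span_basis nf_span_products in \<open>auto simp: numeral_eq_Suc\<close>)
  have V47: "Var 7 * Var 4 ^ n \<in> nf_span v" "Var 8 * Var 4 ^ n \<in> nf_span v" for n
    by (induction n) (auto simp: nf_span_basis mult.left_commute V4)
  have V7: "Var 7 * p \<in> nf_span v" if "p \<in> nf_span v" for p
    by (rule nf_span_mult[OF _ that])
      (use nf_span_basis nf_span_products V47 V47(1)[of 1] in auto)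
  have V8: "Var 8 * p \<in> nf_span v" if "p \<in> nf_span v" for p
    by (rule nf_span_mult[OF _ that])
      (use nf_span_basis nf_span_products V47 V47(2)[of 1] in \<open>auto simp: mult.commute\<close>)
  show ?thesis using assms
  proof (induction rule: polys_induct)
    case (Cst c)
    then show ?case by (simp add: nf_span_base)
  next
    case (add p q)
    then show ?case by (rule nf_span_add)
  next
    case (Var i p)
    then have "i \<in> base_vars \<or> i = 4 \<or> i = 7 \<or> i = 8" by auto
    then show ?case using Var V4 V7 V8 nf_span_base_mult[OF Var(3) polys_Var] by metis
  qed
qed

section \<open>Points of the deformed variety\<close>

text \<open>Given \<open>a3\<close>, \<open>a4\<close>, \<open>a6\<close>, \<open>a7\<close>, the
  second and third relations are linear in \<open>a5\<close> and \<open>a8\<close>, and then the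
  first and fourth are linear in \<open>a9\<close>. The common factor is, for traces of powers of
  \<open>A\<close>, twice the discriminant of its characteristic polynomial.\<close>

lemma eliminate:
  assumes "ev \<phi> r1 = 0" "ev \<phi> r2 = 0" "ev \<phi> (r3 v) = 0" "ev \<phi> (r4 v) = 0"
  shows "(\<phi> 3 ^ 3 - 6 * \<phi> 6 ^ 2) * \<phi> 5 =
      \<phi> 3 ^ 2 * (\<phi> 4 ^ 2 + 3 * v) + 6 * \<phi> 3 * \<phi> 7 ^ 2 - 12 * \<phi> 4 * \<phi> 6 * \<phi> 7"
    and "(\<phi> 3 ^ 3 - 6 * \<phi> 6 ^ 2) * \<phi> 8 =
      2 * \<phi> 3 ^ 2 * \<phi> 4 * \<phi> 7 - \<phi> 6 * (\<phi> 3 * \<phi> 4 ^ 2 + 3 * v * \<phi> 3 + 6 * \<phi> 7 ^ 2)"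
    and "(\<phi> 3 ^ 3 - 6 * \<phi> 6 ^ 2) * \<phi> 9 =
      2 * \<phi> 3 ^ 2 * \<phi> 4 * \<phi> 8 - \<phi> 3 ^ 2 * \<phi> 5 * \<phi> 7 +
      2 * \<phi> 6 * \<phi> 4 * (\<phi> 3 * \<phi> 5 - \<phi> 4 ^ 2 - 3 * v) - 6 * \<phi> 6 * \<phi> 7 * \<phi> 8"
proof -
  define x3 x4 x5 x6 x7 x8 x9 where x: "x3 = \<phi> 3" "x4 = \<phi> 4" "x5 = \<phi> 5" "x6 = \<phi> 6" "x7 = \<phi> 7" "x8 = \<phi> 8" "x9 = \<phi> 9"
  have r: "x3 * x9 - 2 * x4 * x8 + x5 * x7 = 0"
    "x3 * x8 - 2 * x4 * x7 + x5 * x6 = 0"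
    "x3 * (x3 * x5 - x4 ^ 2 - 3 * v) + 6 * (x6 * x8 - x7 ^ 2) = 0"
    "x4 * (x3 * x5 - x4 ^ 2 - 3 * v) + 3 * (x6 * x9 - x7 * x8) = 0"
    using assms by (simp_all add: r1_def r2_def r3_def r4_def x)
  have "(x3 ^ 3 - 6 * x6 ^ 2) * x5 - (x3 ^ 2 * (x4 ^ 2 + 3 * v) + 6 * x3 * x7 ^ 2 - 12 * x4 * x6 * x7) =
      x3 * (x3 * (x3 * x5 - x4 ^ 2 - 3 * v) + 6 * (x6 * x8 - x7 ^ 2)) - 6 * x6 * (x3 * x8 - 2 * x4 * x7 + x5 * x6)"
    by (simp add: algebra_simps power2_eq_square power3_eq_cube)
  then show "(\<phi> 3 ^ 3 - 6 * \<phi> 6 ^ 2) * \<phi> 5 =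
      \<phi> 3 ^ 2 * (\<phi> 4 ^ 2 + 3 * v) + 6 * \<phi> 3 * \<phi> 7 ^ 2 - 12 * \<phi> 4 * \<phi> 6 * \<phi> 7"
    unfolding r by (simp add: x)
  have "(x3 ^ 3 - 6 * x6 ^ 2) * x8 - (2 * x3 ^ 2 * x4 * x7 - x6 * (x3 * x4 ^ 2 + 3 * v * x3 + 6 * x7 ^ 2)) =
      x3 ^ 2 * (x3 * x8 - 2 * x4 * x7 + x5 * x6) - x6 * (x3 * (x3 * x5 - x4 ^ 2 - 3 * v) + 6 * (x6 * x8 - x7 ^ 2))"
    by (simp add: algebra_simps power2_eq_square power3_eq_cube)
  then show "(\<phi> 3 ^ 3 - 6 * \<phi> 6 ^ 2) * \<phi> 8 =
      2 * \<phi> 3 ^ 2 * \<phi> 4 * \<phi> 7 - \<phi> 6 * (\<phi> 3 * \<phi> 4 ^ 2 + 3 * v * \<phi> 3 + 6 * \<phi> 7 ^ 2)"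
    unfolding r by (simp add: x)
  have "(x3 ^ 3 - 6 * x6 ^ 2) * x9 - (2 * x3 ^ 2 * x4 * x8 - x3 ^ 2 * x5 * x7 +
      2 * x6 * x4 * (x3 * x5 - x4 ^ 2 - 3 * v) - 6 * x6 * x7 * x8) =
      x3 ^ 2 * (x3 * x9 - 2 * x4 * x8 + x5 * x7) - 2 * x6 * (x4 * (x3 * x5 - x4 ^ 2 - 3 * v) + 3 * (x6 * x9 - x7 * x8))"
    by (simp add: algebra_simps power2_eq_square power3_eq_cube)
  then show "(\<phi> 3 ^ 3 - 6 * \<phi> 6 ^ 2) * \<phi> 9 =
      2 * \<phi> 3 ^ 2 * \<phi> 4 * \<phi> 8 - \<phi> 3 ^ 2 * \<phi> 5 * \<phi> 7 +
      2 * \<phi> 6 * \<phi> 4 * (\<phi> 3 * \<phi> 5 - \<phi> 4 ^ 2 - 3 * v) - 6 * \<phi> 6 * \<phi> 7 * \<phi> 8"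
    unfolding r by (simp add: x)
qed

lemma power_sums_surj:
  fixes b3 b6 :: complex
  obtains x y z :: complex where "x + y + z = 0" "x ^ 2 + y ^ 2 + z ^ 2 = b3" "x ^ 3 + y ^ 3 + z ^ 3 = b6"
proof -
  have "\<not> constant (poly [:- b6 / 3, - b3 / 2, 0, 1:])"
    by (subst constant_degree) simp
  then obtain x where "poly [:- b6 / 3, - b3 / 2, 0, 1:] x = 0"
    using fundamental_theorem_of_algebra by blast
  then have x: "3 * x ^ 3 - 3 / 2 * b3 * x = b6"
    by (simp add: field_simps power3_eq_cube)
  \<comment> \<open>The two remaining numbers have sum \<open>- x\<close>, and \<open>s\<close> is
    their difference.\<close>
  define s where "s = csqrt (2 * b3 - 3 * x ^ 2)"
  have s: "s ^ 2 = 2 * b3 - 3 * x ^ 2" by (simp add: s_def)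
  show ?thesis
  proof
    show "x + (- x + s) / 2 + (- x - s) / 2 = 0" by (simp add: field_simps)
    have "x ^ 2 + ((- x + s) / 2) ^ 2 + ((- x - s) / 2) ^ 2 = (3 * x ^ 2 + s ^ 2) / 2"
      by (simp add: field_simps power2_eq_square)
    then show "x ^ 2 + ((- x + s) / 2) ^ 2 + ((- x - s) / 2) ^ 2 = b3" by (simp add: s)
    have "x ^ 3 + ((- x + s) / 2) ^ 3 + ((- x - s) / 2) ^ 3 = (3 * x ^ 3 - 3 * x * s ^ 2) / 4"
      by (simp add: field_simps power3_eq_cube power2_eq_square)
    also have "\<dots> = 3 * x ^ 3 - 3 / 2 * b3 * x"
      unfolding s by (simp add: field_simps power3_eq_cube power2_eq_square)
    finally show "x ^ 3 + ((- x + s) / 2) ^ 3 + ((- x - s) / 2) ^ 3 = b6" by (simp only: x)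
  qed
qed

text \<open>Off the diagonal the commutator has entries
  \<open>(x i - x j) / (x i - x j) = 1\<close>, and on it 0, so adding the identity gives the
  all-ones matrix for every choice of \<open>p\<close>. The numbers \<open>a\<close> and
  \<open>b\<close> are the scalar parts.\<close>

definition calogero_point :: "(3 \<Rightarrow> complex) \<Rightarrow> (3 \<Rightarrow> complex) \<Rightarrow> complex \<Rightarrow> complex \<Rightarrow> mat3 \<times> mat3" where
  "calogero_point x p a b =
    ((\<chi> i j. if i = j then x i + a else 0), (\<chi> i j. if i = j then p i + b else 1 / (x i - x j)))"

lemma calogero_point:
  fixes x p :: "3 \<Rightarrow> complex" and a b :: complex
  assumes x: "inj x" and x0: "x 1 + x 2 + x 3 = 0" and p0: "p 1 + p 2 + p 3 = 0"
  defines "z \<equiv> calogero_point x p (a / 3) (b / 3)"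
  shows "z \<in> CMbar" "trace (fst z) = a" "trace (snd z) = b"
    "trace (tA z ** tA z) = x 1 ^ 2 + x 2 ^ 2 + x 3 ^ 2"
    "trace (tA z ** tB z) = x 1 * p 1 + x 2 * p 2 + x 3 * p 3"
    "trace (tA z ** tA z ** tA z) = x 1 ^ 3 + x 2 ^ 3 + x 3 ^ 3"
    "trace (tA z ** tA z ** tB z) = x 1 ^ 2 * p 1 + x 2 ^ 2 * p 2 + x 3 ^ 2 * p 3"
proof -
  have ne: "x 1 \<noteq> x 2" "x 1 \<noteq> x 3" "x 2 \<noteq> x 3" "x 2 \<noteq> x 1" "x 3 \<noteq> x 1" "x 3 \<noteq> x 2"
    by (simp_all add: inj_eq[OF x])
  show tr: "trace (fst z) = a" "trace (snd z) = b"
    using x0 p0 by (simp_all add: z_def calogero_point_def trace_def sum_3 algebra_simps)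
  have A: "tA z = (\<chi> i j. if i = j then x i else 0)"
    unfolding tA_def tfree_def tr by (simp add: z_def calogero_point_def vec_eq_iff mat_def)
  have B: "tB z = (\<chi> i j. if i = j then p i else 1 / (x i - x j))"
    unfolding tB_def tfree_def tr by (simp add: z_def calogero_point_def vec_eq_iff mat_def)
  have q: "x u / (x u - x w) - x w / (x u - x w) = 1" if "x u \<noteq> x w" for u w
    using that by (simp flip: diff_divide_distrib)
  have "tA z ** tB z - tB z ** tA z + mat 1 = outer 1 1"
    by (simp add: A B vec_eq_iff forall_3 matrix_matrix_mult_def sum_3 mat_def outer_def q ne)
  then have "fst z ** snd z - snd z ** fst z + mat 1 = outer 1 1"
    by (simp add: tA_def tB_def commutator_tfree)
  then show "z \<in> CMbar" using CMbar_iff[of "fst z" "snd z"] by auto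
  show "trace (tA z ** tA z) = x 1 ^ 2 + x 2 ^ 2 + x 3 ^ 2"
    "trace (tA z ** tB z) = x 1 * p 1 + x 2 * p 2 + x 3 * p 3"
    "trace (tA z ** tA z ** tA z) = x 1 ^ 3 + x 2 ^ 3 + x 3 ^ 3"
    "trace (tA z ** tA z ** tB z) = x 1 ^ 2 * p 1 + x 2 ^ 2 * p 2 + x 3 ^ 2 * p 3"
    by (simp_all add: A B trace_def sum_3 matrix_matrix_mult_def power2_eq_square power3_eq_cube)
qed

text \<open>The traces of \<open>A^2\<close> and \<open>A^3\<close> fix the eigenvalues of
  \<open>A\<close>, and those of \<open>AB\<close> and \<open>A^2 B\<close> fix the diagonal of
  \<open>B\<close>. Coordinates 5, 8 and 9 then agree because both sides satisfy the relations and
  \<open>eliminate\<close> determines these values.\<close>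

lemma (in scaled) point_lift:
  assumes rel: "ev \<phi> r1 = 0" "ev \<phi> r2 = 0" "ev \<phi> (r3 v) = 0" "ev \<phi> (r4 v) = 0"
    and v: "v = - 3 * l ^ 4" and disc: "\<phi> 3 ^ 3 - 6 * \<phi> 6 ^ 2 \<noteq> 0"
  obtains z where "z \<in> CMbar" "\<And>i. i \<in> {1..9} \<Longrightarrow> tau l z i = \<phi> i"
proof -
  define b3 b4 b6 b7 where b: "b3 = \<phi> 3 / l ^ 2" "b4 = \<phi> 4 / l ^ 2" "b6 = \<phi> 6 / l ^ 3" "b7 = \<phi> 7 / l ^ 3"
  obtain x1 x2 x3 where x: "x1 + x2 + x3 = 0" "x1 ^ 2 + x2 ^ 2 + x3 ^ 2 = b3" "x1 ^ 3 + x2 ^ 3 + x3 ^ 3 = b6"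
    using power_sums_surj by metis
  have x3: "x3 = - x1 - x2" using x(1) by (simp add: algebra_simps add_eq_0_iff)
  have "b3 ^ 3 - 6 * b6 ^ 2 = 2 * ((x1 - x2) * (x1 - x3) * (x2 - x3)) ^ 2"
    unfolding x(2,3)[symmetric] x3 by (simp add: algebra_simps power2_eq_square power3_eq_cube)
  moreover have "l ^ 6 * (b3 ^ 3 - 6 * b6 ^ 2) = \<phi> 3 ^ 3 - 6 * \<phi> 6 ^ 2"
    using l by (simp add: b field_simps flip: power_mult power_add)
  ultimately have ne: "x1 \<noteq> x2" "x1 \<noteq> x3" "x2 \<noteq> x3"
    using disc by auto
  \<comment> \<open>Lagrange's solution of the Vandermonde system with right-hand sides 0,
    \<open>b4\<close>, \<open>b7\<close>, simplified by \<open>x1 + x2 + x3 = 0\<close>.\<close>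
  define p1 p2 p3 where p: "p1 = (b7 + x1 * b4) / ((x1 - x2) * (x1 - x3))"
    "p2 = (b7 + x2 * b4) / ((x2 - x1) * (x2 - x3))" "p3 = (b7 + x3 * b4) / ((x3 - x1) * (x3 - x2))"
  have nn: "x1 - x2 \<noteq> 0" "x1 - x3 \<noteq> 0" "x2 - x3 \<noteq> 0" "x2 - x1 \<noteq> 0" "x3 - x1 \<noteq> 0" "x3 - x2 \<noteq> 0"
    using ne by auto
  have P: "p1 + p2 + p3 = 0" "x1 * p1 + x2 * p2 + x3 * p3 = b4" "x1 ^ 2 * p1 + x2 ^ 2 * p2 + x3 ^ 2 * p3 = b7"
  proof -
    have w: "p1 = (b7 + x1 * b4) * (x2 - x3) / ((x1 - x2) * (x1 - x3) * (x2 - x3))"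
      "p2 = - (b7 + x2 * b4) * (x1 - x3) / ((x1 - x2) * (x1 - x3) * (x2 - x3))"
      "p3 = (b7 + x3 * b4) * (x1 - x2) / ((x1 - x2) * (x1 - x3) * (x2 - x3))"
      unfolding p using nn by (simp_all add: divide_simps) (simp_all add: algebra_simps)
    have d: "(x1 - x2) * (x1 - x3) * (x2 - x3) \<noteq> 0" using nn by simp
    have "(b7 + x1 * b4) * (x2 - x3) + - (b7 + x2 * b4) * (x1 - x3) + (b7 + x3 * b4) * (x1 - x2) = 0"
      by (simp add: algebra_simps power2_eq_square power3_eq_cube)
    then show "p1 + p2 + p3 = 0" unfolding w add_divide_distrib[symmetric] by simp
    have "x1 * ((b7 + x1 * b4) * (x2 - x3)) + x2 * (- (b7 + x2 * b4) * (x1 - x3)) + x3 * ((b7 + x3 * b4) * (x1 - x2)) =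
      b4 * ((x1 - x2) * (x1 - x3) * (x2 - x3))"
      by (simp add: algebra_simps power2_eq_square power3_eq_cube)
    then show "x1 * p1 + x2 * p2 + x3 * p3 = b4"
      unfolding w times_divide_eq_right add_divide_distrib[symmetric] using d by simp
    have "x1 ^ 2 * ((b7 + x1 * b4) * (x2 - x3)) + x2 ^ 2 * (- (b7 + x2 * b4) * (x1 - x3)) + x3 ^ 2 * ((b7 + x3 * b4) * (x1 - x2)) =
      b7 * ((x1 - x2) * (x1 - x3) * (x2 - x3))"
      unfolding x3 by (simp add: algebra_simps power2_eq_square power3_eq_cube)
    then show "x1 ^ 2 * p1 + x2 ^ 2 * p2 + x3 ^ 2 * p3 = b7"
      unfolding w times_divide_eq_right add_divide_distrib[symmetric] using d by simp
  qed
  define z where "z = calogero_point (triple x1 x2 x3) (triple p1 p2 p3) (\<phi> 1 / 3) (\<phi> 2 / 3)"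
  have "inj (triple x1 x2 x3)"
    unfolding inj_def by (simp add: forall_3 triple_simps ne ne[symmetric])
  note c = calogero_point[OF this, of "triple p1 p2 p3" "\<phi> 1" "\<phi> 2", folded z_def, unfolded triple_simps, OF x(1) P(1)]
  have t: "tau l z 1 = \<phi> 1" "tau l z 2 = \<phi> 2" "tau l z 3 = \<phi> 3" "tau l z 4 = \<phi> 4" "tau l z 6 = \<phi> 6" "tau l z 7 = \<phi> 7"
    unfolding tau_simps c x P using l by (simp_all add: b)
  have rel': "ev (tau l z) r1 = 0" "ev (tau l z) r2 = 0" "ev (tau l z) (r3 v) = 0" "ev (tau l z) (r4 v) = 0"
    using tau_relations[OF c(1) v] by auto
  have t5: "tau l z 5 = \<phi> 5" and t8: "tau l z 8 = \<phi> 8"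
    using eliminate(1,2)[OF rel] eliminate(1,2)[OF rel'] disc unfolding t by (metis mult_left_cancel)+
  have "tau l z 9 = \<phi> 9"
    using eliminate(3)[OF rel] eliminate(3)[OF rel'] disc unfolding t t5 t8 by (metis mult_left_cancel)
  then have "tau l z i = \<phi> i" if "i \<in> {1..9}" for i
  proof -
    have "i = 1 \<or> i = 2 \<or> i = 3 \<or> i = 4 \<or> i = 5 \<or> i = 6 \<or> i = 7 \<or> i = 8 \<or> i = 9" using that by auto
    then show ?thesis using t t5 t8 \<open>tau l z 9 = \<phi> 9\<close> by metis
  qed
  with c(1) show ?thesis by (rule that)
qed

section \<open>Independence of the normal form\<close>

lemma zero_by_continuity:
  fixes f :: "complex \<Rightarrow> complex"
  assumes "isCont f 0" "finite F" "\<And>t. t \<notin> F \<Longrightarrow> f t = 0"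
  shows "f 0 = 0"
proof -
  have "closed (F - {0})"
    by (rule finite_imp_closed) (use assms(2) in simp)
  then have "open (- (F - {0}))" by (rule open_Compl)
  then have "eventually (\<lambda>t. t \<notin> F) (at 0)"
    unfolding eventually_at_topological by (intro exI[of _ "- (F - {0})"]) auto
  then have "eventually (\<lambda>t. f t = 0) (at 0)"
    by eventually_elim (rule assms(3))
  then have "(f \<longlongrightarrow> 0) (at 0)" by (rule tendsto_eventually)
  moreover have "(f \<longlongrightarrow> f 0) (at 0)" using assms(1) by (simp add: isCont_def)
  ultimately show ?thesis using tendsto_unique[of "at (0::complex)"] by auto
qed

text \<open>
  With \<open>s = a\<^sub>3 a\<^sub>5\<close>, \<open>m = a\<^sub>6 a\<^sub>9\<close>, \<open>k = a\<^sub>5\<^sup>3 a\<^sub>6\<^sup>2 + a\<^sub>3\<^sup>3 a\<^sub>9\<^sup>2\<close>, eliminating \<open>a\<^sub>7\<close> and \<open>a\<^sub>8\<close>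
  from the relations leaves the equation that this polynomial takes the value \<open>6k\<close> at \<open>a\<^sub>4\<close>.
  Since \<open>k\<close> can be varied with \<open>s\<close> and \<open>m\<close> fixed, its roots are generically simple.
\<close>

definition sextic :: "complex \<Rightarrow> complex \<Rightarrow> complex \<Rightarrow> complex poly" where
  "sextic v s m = [:(s - 3 * v) * s ^ 2, - 36 * m * s, - 8 * s * (s - 3 * v) - s ^ 2, 48 * m,
     16 * (s - 3 * v) + 8 * s, 0, - 16:]"

lemma poly_sextic:
  "poly (sextic v s m) t = (s - t ^ 2 - 3 * v) * (4 * t ^ 2 - s) ^ 2 + 12 * m * t * (4 * t ^ 2 - 3 * s)"
  by (simp add: sextic_def algebra_simps power_numeral_reduce)

text \<open>Besides the values with a multiple root, those with a root satisfying
  \<open>4 t^2 = s\<close> are excluded, since \<open>4 t^2 - s\<close> is the denominator of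
  coordinates 7 and 8 over \<open>t\<close>.\<close>

definition bad_values :: "complex \<Rightarrow> complex \<Rightarrow> complex \<Rightarrow> complex set" where
  "bad_values v s m = {k. \<exists>t. poly (sextic v s m) t = 6 * k \<and> (poly (pderiv (sextic v s m)) t = 0 \<or> 4 * t ^ 2 = s)}"

lemma finite_bad_values: "finite (bad_values v s m)"
proof -
  let ?T = "sextic v s m"
  have "degree ?T = 6" by (simp add: sextic_def)
  then have "pderiv ?T \<noteq> 0" by (simp add: pderiv_eq_0_iff)
  then have 1: "finite {t. poly (pderiv ?T) t = 0}" by (rule poly_roots_finite)
  have "{t. 4 * t ^ 2 = s} = {t. poly [:- s, 0, 4:] t = 0}"
    by (auto simp: algebra_simps power2_eq_square)
  moreover have "finite {t. poly [:- s, 0, 4:] t = 0}" by (rule poly_roots_finite) simp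
  ultimately have 2: "finite {t. 4 * t ^ 2 = s}" by simp
  have "bad_values v s m \<subseteq> (\<lambda>t. poly ?T t / 6) ` ({t. poly (pderiv ?T) t = 0} \<union> {t. 4 * t ^ 2 = s})"
    by (force simp: bad_values_def)
  then show ?thesis using 1 2 by (meson finite_UnI finite_imageI finite_subset)
qed

lemma card_sextic_roots:
  assumes "k \<notin> bad_values v s m"
  shows "card {t. poly (sextic v s m) t = 6 * k} = 6"
proof -
  let ?S = "sextic v s m - [:6 * k:]"
  have deg: "degree ?S = 6" by (simp add: sextic_def)
  have pd: "pderiv ?S = pderiv (sextic v s m)" by (simp add: pderiv_diff pderiv_pCons)
  have "rsquarefree ?S"
    unfolding rsquarefree_roots pd using assms by (auto simp: bad_values_def)
  then have "smult (lead_coeff ?S) (\<Prod>z | poly ?S z = 0. [:- z, 1:]) = ?S"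
    by (rule complex_poly_decompose_rsquarefree)
  then have "degree (smult (lead_coeff ?S) (\<Prod>z | poly ?S z = 0. [:- z, 1:])) = 6" using deg by simp
  moreover have "lead_coeff ?S \<noteq> 0" using deg by (metis degree_0 leading_coeff_0_iff zero_neq_numeral)
  ultimately have "degree (\<Prod>z | poly ?S z = 0. [:- z, 1:]) = 6" by simp
  then have "card {z. poly ?S z = 0} = 6"
    by (subst (asm) degree_prod_sum_eq) auto
  then show ?thesis by simp
qed

lemma nf_polys:
  assumes "\<And>i. c i \<in> polys base_vars" shows "nf c \<in> polys {1..9}"
proof -
  have "c i \<in> polys {1..9}" for i
    using assms[of i] polys_mono[of base_vars "{1..9}"] by auto
  then show ?thesis unfolding nf_def
    by (intro polys_add polys_mult polys_power polys_Var) auto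
qed

text \<open>The first two relations form a linear system for \<open>a7\<close> and \<open>a8\<close>
  with determinant \<open>s - 4 t^2\<close>; its solution by Cramer's rule turns the third into the
  sextic equation times \<open>a3\<close>.\<close>

lemma ev_fiber_point:
  fixes \<phi> :: "nat \<Rightarrow> complex" and t :: complex
  defines "s \<equiv> \<phi> 3 * \<phi> 5"
  defines "\<psi> \<equiv> \<phi>(4 := t, 7 := (\<phi> 3 ^ 2 * \<phi> 9 + 2 * t * \<phi> 5 * \<phi> 6) / (4 * t ^ 2 - s),
      8 := (\<phi> 5 ^ 2 * \<phi> 6 + 2 * t * \<phi> 3 * \<phi> 9) / (4 * t ^ 2 - s))"
  assumes ne: "\<phi> 3 \<noteq> 0" "4 * t ^ 2 \<noteq> s"
    and root: "poly (sextic v s (\<phi> 6 * \<phi> 9)) t = 6 * (\<phi> 5 ^ 3 * \<phi> 6 ^ 2 + \<phi> 3 ^ 3 * \<phi> 9 ^ 2)"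
  shows "ev \<psi> r1 = 0" "ev \<psi> r2 = 0" "ev \<psi> (r3 v) = 0" "ev \<psi> (r4 v) = 0"
proof -
  define a3 a5 a6 a9 where a: "a3 = \<phi> 3" "a5 = \<phi> 5" "a6 = \<phi> 6" "a9 = \<phi> 9"
  define d where "d = 4 * t ^ 2 - s"
  define a7 where "a7 = (a3 ^ 2 * a9 + 2 * t * a5 * a6) / d"
  define a8 where "a8 = (a5 ^ 2 * a6 + 2 * t * a3 * a9) / d"
  have d: "d \<noteq> 0" using ne by (simp add: d_def)
  have s: "s = a3 * a5" by (simp add: s_def a)
  have d7: "d * a7 = a3 ^ 2 * a9 + 2 * t * a5 * a6" and d8: "d * a8 = a5 ^ 2 * a6 + 2 * t * a3 * a9"
    using d by (simp_all add: a7_def a8_def)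
  have psi: "\<psi> 3 = a3" "\<psi> 4 = t" "\<psi> 5 = a5" "\<psi> 6 = a6" "\<psi> 7 = a7" "\<psi> 8 = a8" "\<psi> 9 = a9"
    by (simp_all add: \<psi>_def a a7_def a8_def d_def)
  have "d * (a3 * a9 - 2 * t * a8 + a5 * a7) = d * (a3 * a9) - 2 * t * (d * a8) + a5 * (d * a7)"
    by (simp add: algebra_simps)
  also have "\<dots> = 0"
    unfolding d7 d8 by (simp add: d_def s algebra_simps power2_eq_square)
  finally have R1: "a3 * a9 - 2 * t * a8 + a5 * a7 = 0" using d by simp
  have "d * (a3 * a8 - 2 * t * a7 + a5 * a6) = a3 * (d * a8) - 2 * t * (d * a7) + d * (a5 * a6)"
    by (simp add: algebra_simps)
  also have "\<dots> = 0"
    unfolding d7 d8 by (simp add: d_def s algebra_simps power2_eq_square)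
  finally have R2: "a3 * a8 - 2 * t * a7 + a5 * a6 = 0" using d by simp
  have "d ^ 2 * (a3 * (a3 * a5 - t ^ 2 - 3 * v) + 6 * (a6 * a8 - a7 ^ 2)) =
      d ^ 2 * (a3 * (a3 * a5 - t ^ 2 - 3 * v)) + 6 * (a6 * d * (d * a8) - (d * a7) ^ 2)"
    by (simp add: algebra_simps power2_eq_square)
  also have "\<dots> = a3 * (poly (sextic v s (a6 * a9)) t - 6 * (a5 ^ 3 * a6 ^ 2 + a3 ^ 3 * a9 ^ 2))"
    unfolding d7 d8 poly_sextic by (simp add: d_def s algebra_simps power_numeral_reduce)
  also have "\<dots> = 0" using root by (simp add: a)
  finally have R3: "a3 * (a3 * a5 - t ^ 2 - 3 * v) + 6 * (a6 * a8 - a7 ^ 2) = 0" using d by simp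
  \<comment> \<open>A syzygy expresses \<open>a3\<close> times the fourth relation through the first
    three, and \<open>a3\<close> is nonzero.\<close>
  have "a3 * (t * (a3 * a5 - t ^ 2 - 3 * v) + 3 * (a6 * a9 - a7 * a8)) =
      t * (a3 * (a3 * a5 - t ^ 2 - 3 * v) + 6 * (a6 * a8 - a7 ^ 2)) +
      3 * a6 * (a3 * a9 - 2 * t * a8 + a5 * a7) - 3 * a7 * (a3 * a8 - 2 * t * a7 + a5 * a6)"
    by (simp add: algebra_simps power2_eq_square)
  also have "\<dots> = 0" unfolding R1 R2 R3 by simp
  finally have R4: "t * (a3 * a5 - t ^ 2 - 3 * v) + 3 * (a6 * a9 - a7 * a8) = 0" using ne a by simp
  show "ev \<psi> r1 = 0" "ev \<psi> r2 = 0" "ev \<psi> (r3 v) = 0" "ev \<psi> (r4 v) = 0"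
    using R1 R2 R3 R4 by (simp_all add: r1_def r2_def r3_def r4_def psi)
qed

lemma power4_split: "p * u ^ 2 * u ^ 2 = p * u ^ 4" for p u :: complex
  by (simp only: mult.assoc power_add[symmetric] numeral_plus_numeral semiring_norm)

lemma ratio_eq_power4:
  fixes p q u :: complex
  assumes "u \<noteq> 0" "q / u ^ 2 = p * u ^ 2" shows "q = p * u ^ 4"
proof -
  have "q = q / u ^ 2 * u ^ 2" using assms(1) by simp
  then show ?thesis unfolding assms(2) power4_split .
qed

lemma pencil_zero:
  fixes p q u :: complex
  assumes "u \<noteq> 0" shows "p * u ^ 4 - (p * u ^ 2 + q / u ^ 2) * u ^ 2 + q = 0"
proof -
  have "q / u ^ 2 * u ^ 2 = q" using assms by simp
  then show ?thesis unfolding distrib_right power4_split by simp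
qed

context scaled
begin

text \<open>
  Over a generic value of the six base variables there are six points of the variety; after
  multiplication by \<open>4t\<^sup>2 - s\<close> the normal form becomes a polynomial of degree five in the value
  \<open>t\<close> of variable 4.
\<close>

lemma generic_coefficients_zero:
  assumes v: "v = - 3 * l ^ 4"
    and c: "\<And>i. c i \<in> polys base_vars"
    and zero: "\<And>z. z \<in> CMbar \<Longrightarrow> ev (tau l z) (nf c) = 0"
    and ne: "\<phi> 3 \<noteq> 0" and disc: "\<phi> 3 ^ 3 - 6 * \<phi> 6 ^ 2 \<noteq> 0"
    and good: "\<phi> 5 ^ 3 * \<phi> 6 ^ 2 + \<phi> 3 ^ 3 * \<phi> 9 ^ 2 \<notin> bad_values v (\<phi> 3 * \<phi> 5) (\<phi> 6 * \<phi> 9)"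
    and det: "\<phi> 3 ^ 3 * \<phi> 9 ^ 2 \<noteq> \<phi> 5 ^ 3 * \<phi> 6 ^ 2"
    and i: "i < 6"
  shows "ev \<phi> (c i) = 0"
proof -
  define a3 a5 a6 a9 where a: "a3 = \<phi> 3" "a5 = \<phi> 5" "a6 = \<phi> 6" "a9 = \<phi> 9"
  define s where "s = a3 * a5"
  define C where "C i = ev \<phi> (c i)" for i
  define R where "R = {t. poly (sextic v s (a6 * a9)) t = 6 * (a5 ^ 3 * a6 ^ 2 + a3 ^ 3 * a9 ^ 2)}"
  have card: "card R = 6"
    unfolding R_def by (rule card_sextic_roots) (use good in \<open>simp add: a s_def\<close>)
  define q where "q = [:- s * C 0 + a3 ^ 2 * a9 * C 4 + a5 ^ 2 * a6 * C 5,
    - s * C 1 + 2 * a5 * a6 * C 4 + 2 * a3 * a9 * C 5, 4 * C 0 - s * C 2, 4 * C 1 - s * C 3, 4 * C 2, 4 * C 3:]"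
  have root: "poly q t = 0" if t: "t \<in> R" for t
  proof -
    have ds: "4 * t ^ 2 - s \<noteq> 0"
      using t good by (auto simp: R_def bad_values_def a s_def)
    define \<psi> where "\<psi> = \<phi>(4 := t, 7 := (\<phi> 3 ^ 2 * \<phi> 9 + 2 * t * \<phi> 5 * \<phi> 6) / (4 * t ^ 2 - \<phi> 3 * \<phi> 5),
      8 := (\<phi> 5 ^ 2 * \<phi> 6 + 2 * t * \<phi> 3 * \<phi> 9) / (4 * t ^ 2 - \<phi> 3 * \<phi> 5))"
    have rels: "ev \<psi> r1 = 0" "ev \<psi> r2 = 0" "ev \<psi> (r3 v) = 0" "ev \<psi> (r4 v) = 0"
      unfolding \<psi>_def by (rule ev_fiber_point; use t ds ne in \<open>simp add: R_def s_def a\<close>)+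
    have "\<psi> 3 ^ 3 - 6 * \<psi> 6 ^ 2 \<noteq> 0" using disc by (simp add: \<psi>_def)
    then obtain z where z: "z \<in> CMbar" "\<And>i. i \<in> {1..9} \<Longrightarrow> tau l z i = \<psi> i"
      using point_lift[OF rels v] by blast
    have "ev \<psi> (nf c) = ev (tau l z) (nf c)"
      by (rule ev_cong[OF nf_polys[OF c]]) (simp add: z)
    then have N: "ev \<psi> (nf c) = 0" using zero[OF z(1)] by simp
    have "ev \<psi> (c i) = C i" for i
      unfolding C_def by (rule ev_cong[OF c]) (auto simp: \<psi>_def)
    then have e: "ev \<psi> (nf c) = C 0 + C 1 * t + C 2 * t ^ 2 + C 3 * t ^ 3 +
        C 4 * ((a3 ^ 2 * a9 + 2 * t * a5 * a6) / (4 * t ^ 2 - s)) + C 5 * ((a5 ^ 2 * a6 + 2 * t * a3 * a9) / (4 * t ^ 2 - s))"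
      by (simp add: nf_def) (simp add: \<psi>_def a s_def)
    have clear: "d * (A + C 4 * (y / d) + C 5 * (y' / d)) = d * A + C 4 * y + C 5 * y'"
      if "d \<noteq> 0" for d A y y'
    proof -
      have "d * (y / d) = y" "d * (y' / d) = y'" using that by simp_all
      then show ?thesis
        by (simp only: distrib_left mult.left_commute[of d "C 4"] mult.left_commute[of d "C 5"])
    qed
    have "(4 * t ^ 2 - s) * (C 0 + C 1 * t + C 2 * t ^ 2 + C 3 * t ^ 3) +
        C 4 * (a3 ^ 2 * a9 + 2 * t * a5 * a6) + C 5 * (a5 ^ 2 * a6 + 2 * t * a3 * a9) = (4 * t ^ 2 - s) * ev \<psi> (nf c)"
      unfolding e by (rule clear[OF ds, symmetric])
    then show "poly q t = 0"
      unfolding N by (simp add: q_def algebra_simps power_numeral_reduce)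
  qed
  have "q = 0"
  proof (rule ccontr)
    assume "q \<noteq> 0"
    have "card R \<le> card {t. poly q t = 0}"
      using root by (intro card_mono poly_roots_finite \<open>q \<noteq> 0\<close>) auto
    also have "\<dots> \<le> degree q" by (rule card_poly_roots_bound[OF \<open>q \<noteq> 0\<close>])
    also have "degree q \<le> 5"
      unfolding q_def by (intro degree_le) (auto simp: coeff_pCons split: nat.splits)
    finally show False using card by simp
  qed
  then have z: "- s * C 0 + a3 ^ 2 * a9 * C 4 + a5 ^ 2 * a6 * C 5 = 0"
    "- s * C 1 + 2 * a5 * a6 * C 4 + 2 * a3 * a9 * C 5 = 0"
    "4 * C 0 - s * C 2 = 0" "4 * C 1 - s * C 3 = 0" "4 * C 2 = 0" "4 * C 3 = 0"
    unfolding q_def pCons_eq_0_iff by blast+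
  then have C32: "C 3 = 0" "C 2 = 0" by simp_all
  then have C10: "C 1 = 0" "C 0 = 0" using z(3,4) by simp_all
  have e1: "a3 ^ 2 * a9 * C 4 + a5 ^ 2 * a6 * C 5 = 0" using z(1) C10 by simp
  have "2 * (a5 * a6 * C 4 + a3 * a9 * C 5) = 0" using z(2) C10 by (simp add: algebra_simps)
  then have e2: "a5 * a6 * C 4 + a3 * a9 * C 5 = 0" by (simp only: mult_eq_0_iff) simp
  \<comment> \<open>The equations left for \<open>C 4\<close> and \<open>C 5\<close> form a linear
    system whose determinant is nonzero by \<open>det\<close>.\<close>
  have "(a3 ^ 3 * a9 ^ 2 - a5 ^ 3 * a6 ^ 2) * C 4 =
      a3 * a9 * (a3 ^ 2 * a9 * C 4 + a5 ^ 2 * a6 * C 5) - a5 ^ 2 * a6 * (a5 * a6 * C 4 + a3 * a9 * C 5)"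
    by (simp add: algebra_simps power2_eq_square power3_eq_cube)
  then have C4: "C 4 = 0" using det unfolding e1 e2 by (simp add: a)
  have "(a3 ^ 3 * a9 ^ 2 - a5 ^ 3 * a6 ^ 2) * C 5 =
      a3 ^ 2 * a9 * (a5 * a6 * C 4 + a3 * a9 * C 5) - a5 * a6 * (a3 ^ 2 * a9 * C 4 + a5 ^ 2 * a6 * C 5)"
    by (simp add: algebra_simps power2_eq_square power3_eq_cube)
  then have C5: "C 5 = 0" using det unfolding e1 e2 by (simp add: a)
  have "i = 0 \<or> i = 1 \<or> i = 2 \<or> i = 3 \<or> i = 4 \<or> i = 5" using i by auto
  then show ?thesis using C32 C10 C4 C5 unfolding C_def by metis
qed

text \<open>Genericity is removed by continuity twice: along a curve that avoids the exceptional
  conditions except at finitely many parameters, and then along a translation that makes coordinates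
  3, 5 and 6 nonzero.\<close>

lemma coefficients_zero:
  assumes v: "v = - 3 * l ^ 4"
    and c: "\<And>i. c i \<in> polys base_vars"
    and zero: "\<And>z. z \<in> CMbar \<Longrightarrow> ev (tau l z) (nf c) = 0"
    and i: "i < 6"
  shows "c i = 0"
proof -
  have nz: "ev \<phi> (c i) = 0" if ne: "\<phi> 3 \<noteq> 0" "\<phi> 5 \<noteq> 0" "\<phi> 6 \<noteq> 0" for \<phi>
  proof -
    define p q where "p = \<phi> 5 ^ 3 * \<phi> 6 ^ 2" and "q = \<phi> 3 ^ 3 * \<phi> 9 ^ 2"
    have p: "p \<noteq> 0" using ne by (simp add: p_def)
    \<comment> \<open>Scaling coordinates 6 and 9 inversely keeps \<open>s\<close> and
      \<open>m\<close> fixed, while \<open>k\<close> becomes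
      \<open>p (1 + t)^2 + q / (1 + t)^2\<close>.\<close>
    define \<psi> where "\<psi> t = \<phi>(6 := \<phi> 6 * (1 + t), 9 := \<phi> 9 / (1 + t))" for t
    \<comment> \<open>The expansion of \<open>p (1 + t)^4 - k (1 + t)^2 + q\<close>, a nonzero
      polynomial because \<open>p\<close> is nonzero.\<close>
    define g where "g k = [:p - k + q, 4 * p - 2 * k, 6 * p - k, 4 * p, p:]" for k
    define B where "B = bad_values v (\<phi> 3 * \<phi> 5) (\<phi> 6 * \<phi> 9)"
    \<comment> \<open>Excluded are the pole of the curve, the zeros of the discriminant and of the
      determinant, and the parameters at which \<open>k\<close> is a bad value.\<close>
    define F where "F = {- 1} \<union> {t. poly [:\<phi> 3 ^ 3 - 6 * \<phi> 6 ^ 2, - 12 * \<phi> 6 ^ 2, - 6 * \<phi> 6 ^ 2:] t = 0} \<union>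
      {t. poly [:p - q, 4 * p, 6 * p, 4 * p, p:] t = 0} \<union> (\<Union>k\<in>B. {t. poly (g k) t = 0})"
    have "finite F"
      unfolding F_def B_def
      by (intro finite_UnI finite_UN_I finite_bad_values poly_roots_finite) (use p ne in \<open>auto simp: g_def\<close>)
    moreover have "isCont (\<lambda>t. ev (\<psi> t) (c i)) 0"
    proof (rule continuous_ev)
      fix j show "isCont (\<lambda>t. \<psi> t j) 0"
      proof -
        have "isCont (\<lambda>t. \<phi> 6 * (1 + t)) 0" by (intro continuous_intros)
        moreover have "isCont (\<lambda>t. \<phi> 9 / (1 + t)) 0" by (intro continuous_intros) simp
        ultimately show ?thesis by (cases "j = 6"; cases "j = 9") (simp_all add: \<psi>_def)
      qed
    qed
    moreover have "ev (\<psi> t) (c i) = 0" if t: "t \<notin> F" for t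
    proof (rule generic_coefficients_zero[OF v c zero _ _ _ _ i])
      have tF: "t \<noteq> - 1" "poly [:\<phi> 3 ^ 3 - 6 * \<phi> 6 ^ 2, - 12 * \<phi> 6 ^ 2, - 6 * \<phi> 6 ^ 2:] t \<noteq> 0"
        "poly [:p - q, 4 * p, 6 * p, 4 * p, p:] t \<noteq> 0" "\<And>k. poly (g k) t = 0 \<Longrightarrow> k \<notin> B"
        using t unfolding F_def by blast+
      have t1: "1 + t \<noteq> 0" using tF(1) by (simp add: add_eq_0_iff)
      have e: "\<psi> t 5 ^ 3 * \<psi> t 6 ^ 2 = p * (1 + t) ^ 2" "\<psi> t 3 ^ 3 * \<psi> t 9 ^ 2 = q / (1 + t) ^ 2"
        "\<psi> t 6 * \<psi> t 9 = \<phi> 6 * \<phi> 9"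
        using t1 by (simp_all add: \<psi>_def p_def q_def power_mult_distrib power_divide)
      show "\<psi> t 3 \<noteq> 0" using ne by (simp add: \<psi>_def)
      have disc: "\<psi> t 3 ^ 3 - 6 * \<psi> t 6 ^ 2 = poly [:\<phi> 3 ^ 3 - 6 * \<phi> 6 ^ 2, - 12 * \<phi> 6 ^ 2, - 6 * \<phi> 6 ^ 2:] t"
        by (simp add: \<psi>_def algebra_simps power2_eq_square)
      show "\<psi> t 3 ^ 3 - 6 * \<psi> t 6 ^ 2 \<noteq> 0" unfolding disc by (rule tF(2))
      show "\<psi> t 3 ^ 3 * \<psi> t 9 ^ 2 \<noteq> \<psi> t 5 ^ 3 * \<psi> t 6 ^ 2"
      proof
        assume "\<psi> t 3 ^ 3 * \<psi> t 9 ^ 2 = \<psi> t 5 ^ 3 * \<psi> t 6 ^ 2"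
        then have "q / (1 + t) ^ 2 = p * (1 + t) ^ 2" unfolding e .
        then have q: "q = p * (1 + t) ^ 4" by (rule ratio_eq_power4[OF t1])
        have "poly [:p - q, 4 * p, 6 * p, 4 * p, p:] t = p * (1 + t) ^ 4 - q"
          by (simp add: algebra_simps power4_eq_xxxx)
        also have "\<dots> = 0" unfolding q[symmetric] by (rule diff_self)
        finally show False using tF(3) by contradiction
      qed
      have "poly (g k) t = 0" if k: "p * (1 + t) ^ 2 + q / (1 + t) ^ 2 = k" for k
      proof -
        have "poly (g k) t = p * (1 + t) ^ 4 - k * (1 + t) ^ 2 + q"
          by (simp add: g_def algebra_simps power4_eq_xxxx power2_eq_square)
        also have "\<dots> = 0"
          unfolding k[symmetric] by (rule pencil_zero[OF t1])
        finally show ?thesis .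
      qed
      then have "p * (1 + t) ^ 2 + q / (1 + t) ^ 2 \<notin> B"
        using tF(4) by blast
      then show "\<psi> t 5 ^ 3 * \<psi> t 6 ^ 2 + \<psi> t 3 ^ 3 * \<psi> t 9 ^ 2 \<notin> bad_values v (\<psi> t 3 * \<psi> t 5) (\<psi> t 6 * \<psi> t 9)"
        unfolding e B_def by (simp add: \<psi>_def)
    qed
    ultimately have "ev (\<psi> 0) (c i) = 0"
      using zero_by_continuity[of "\<lambda>t. ev (\<psi> t) (c i)" F] by blast
    moreover have "\<psi> 0 = \<phi>" by (auto simp: \<psi>_def)
    ultimately show ?thesis by simp
  qed
  have "ev \<phi> (c i) = 0" for \<phi>
  proof -
    define \<psi> where "\<psi> t j = \<phi> j + t" for t :: complex and j :: nat
    have "ev (\<psi> 0) (c i) = 0"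
    proof (rule zero_by_continuity[where F = "{- \<phi> 3, - \<phi> 5, - \<phi> 6}" and f = "\<lambda>t. ev (\<psi> t) (c i)"])
      show "isCont (\<lambda>t. ev (\<psi> t) (c i)) 0"
        by (rule continuous_ev) (auto simp: \<psi>_def intro!: continuous_intros)
      show "ev (\<psi> t) (c i) = 0" if "t \<notin> {- \<phi> 3, - \<phi> 5, - \<phi> 6}" for t
        by (rule nz) (use that in \<open>simp_all add: \<psi>_def add_eq_0_iff\<close>)
    qed simp
    moreover have "\<psi> 0 = \<phi>" by (auto simp: \<psi>_def)
    ultimately show ?thesis by simp
  qed
  then show ?thesis by (rule poly_eq_zero_if_ev_zero)
qed

section \<open>The kernel of evaluation at Calogero-Moser pairs\<close>

lemma ev_rel_ideal:
  assumes v: "v = - 3 * l ^ 4" and p: "p \<in> rel_ideal v" and z: "z \<in> CMbar"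
  shows "ev (tau l z) p = 0"
proof -
  interpret R: cring "poly_calg {1..9}" by (rule cring_poly_calg)
  have "ideal {p \<in> polys {1..9}. ev (tau l z) p = 0} (poly_calg {1..9})"
  proof (rule idealI)
    show "ring (poly_calg {1..9})" by (rule R.ring_axioms)
    show "subgroup {p \<in> polys {1..9}. ev (tau l z) p = 0} (add_monoid (poly_calg {1..9}))"
    proof (rule R.add.subgroupI)
      fix a assume a: "a \<in> {p \<in> polys {1..9}. ev (tau l z) p = 0}"
      have "\<ominus>\<^bsub>poly_calg {1..9}\<^esub> a = - a"
        by (rule R.minus_equality) (use a in auto)
      then show "\<ominus>\<^bsub>poly_calg {1..9}\<^esub> a \<in> {p \<in> polys {1..9}. ev (tau l z) p = 0}"
        using a by auto
    qed (auto intro: exI[of _ 0])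
  qed auto
  then have "rel_ideal v \<subseteq> {p \<in> polys {1..9}. ev (tau l z) p = 0}"
    by (rule rel_ideal_minimal) (use relations_in_polys tau_relations[OF z v] in auto)
  then show ?thesis using p by auto
qed

lemma rel_ideal_iff:
  assumes v: "v = - 3 * l ^ 4" and p: "p \<in> polys {1..9}"
  shows "p \<in> rel_ideal v \<longleftrightarrow> (\<forall>z\<in>CMbar. ev (tau l z) p = 0)"
proof
  assume *: "\<forall>z\<in>CMbar. ev (tau l z) p = 0"
  obtain c where c: "\<And>i. c i \<in> polys base_vars" "p - nf c \<in> rel_ideal v"
    using polys_subset_nf_span[OF p, of v] by (auto simp: nf_span_def)
  have "ev (tau l z) (nf c) = 0" if "z \<in> CMbar" for z
    using * ev_rel_ideal[OF v c(2) that] that by simp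
  then have "c i = 0" if "i < 6" for i
    by (rule coefficients_zero[OF v c(1) _ that])
  then have "nf c = 0" by (simp add: nf_def)
  then show "p \<in> rel_ideal v" using c(2) by simp
qed (use ev_rel_ideal[OF v] in auto)

end

section \<open>Isomorphisms of varieties from isomorphisms of algebras\<close>

text \<open>Closure lets the inverse of a bijective homomorphism be one again, and makes the
  pullback of a point a point; it makes sense for bare records and so applies to both algebras
  alike.\<close>

definition closed_alg :: "'a calg \<Rightarrow> bool" where
  "closed_alg A \<longleftrightarrow> (\<forall>x\<in>carrier A. \<forall>y\<in>carrier A. x \<otimes>\<^bsub>A\<^esub> y \<in> carrier A \<and> x \<oplus>\<^bsub>A\<^esub> y \<in> carrier A) \<and>
     \<one>\<^bsub>A\<^esub> \<in> carrier A \<and> (\<forall>c. scalar A c \<in> carrier A)"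

lemma calg_hom_inverse:
  assumes \<theta>: "\<theta> \<in> calg_hom A B" and bij: "bij_betw \<theta> (carrier A) (carrier B)" and A: "closed_alg A"
  shows "inv_into (carrier A) \<theta> \<in> calg_hom B A"
proof -
  let ?\<psi> = "inv_into (carrier A) \<theta>"
  have inj: "inj_on \<theta> (carrier A)" and img: "\<theta> ` carrier A = carrier B"
    using bij by (auto simp: bij_betw_def)
  have hom: "\<theta> \<in> ring_hom A B" and sc: "\<And>c. \<theta> (scalar A c) = scalar B c"
    using \<theta> by (auto simp: calg_hom_def)
  have left_inv: "?\<psi> (\<theta> x) = x" if "x \<in> carrier A" for x
    using inj that by simp
  have surj: "\<exists>a\<in>carrier A. b = \<theta> a" if "b \<in> carrier B" for b
    using img that by auto
  have "?\<psi> \<in> ring_hom B A"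
  proof (rule ring_hom_memI)
    fix x y assume xy: "x \<in> carrier B" "y \<in> carrier B"
    obtain a b where ab: "a \<in> carrier A" "b \<in> carrier A" "x = \<theta> a" "y = \<theta> b"
      using surj[OF xy(1)] surj[OF xy(2)] by auto
    show "?\<psi> x \<in> carrier A" using ab by (simp add: left_inv)
    have "x \<otimes>\<^bsub>B\<^esub> y = \<theta> (a \<otimes>\<^bsub>A\<^esub> b)" "x \<oplus>\<^bsub>B\<^esub> y = \<theta> (a \<oplus>\<^bsub>A\<^esub> b)"
      using ab ring_hom_mult[OF hom] ring_hom_add[OF hom] by auto
    moreover have "a \<otimes>\<^bsub>A\<^esub> b \<in> carrier A" "a \<oplus>\<^bsub>A\<^esub> b \<in> carrier A"
      using A ab by (auto simp: closed_alg_def)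
    ultimately show "?\<psi> (x \<otimes>\<^bsub>B\<^esub> y) = ?\<psi> x \<otimes>\<^bsub>A\<^esub> ?\<psi> y" "?\<psi> (x \<oplus>\<^bsub>B\<^esub> y) = ?\<psi> x \<oplus>\<^bsub>A\<^esub> ?\<psi> y"
      using ab by (simp_all add: left_inv)
  next
    show "?\<psi> \<one>\<^bsub>B\<^esub> = \<one>\<^bsub>A\<^esub>"
      using left_inv[of "\<one>\<^bsub>A\<^esub>"] ring_hom_one[OF hom] A by (simp add: closed_alg_def)
  qed
  moreover have "?\<psi> (scalar B c) = scalar A c" for c
    using left_inv[of "scalar A c"] A by (simp add: sc closed_alg_def)
  ultimately show ?thesis by (simp add: calg_hom_def)
qed

lemma points_pullback:
  assumes \<psi>: "\<psi> \<in> calg_hom B A" and B: "closed_alg B" and x: "x \<in> points A"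
  shows "restrict (\<lambda>f. x (\<psi> f)) (carrier B) \<in> points B"
proof -
  have \<psi>': "\<psi> \<in> ring_hom B A" "\<And>c. \<psi> (scalar B c) = scalar A c"
    using \<psi> by (auto simp: calg_hom_def)
  have x': "x \<in> ring_hom A complex_alg" "\<And>c. x (scalar A c) = c"
    using x by (auto simp: points_def calg_hom_def complex_alg_def)
  have "restrict (\<lambda>f. x (\<psi> f)) (carrier B) \<in> ring_hom B complex_alg"
    using B ring_hom_mult[OF \<psi>'(1)] ring_hom_add[OF \<psi>'(1)] ring_hom_one[OF \<psi>'(1)]
      ring_hom_closed[OF \<psi>'(1)] ring_hom_mult[OF x'(1)] ring_hom_add[OF x'(1)] ring_hom_one[OF x'(1)]
    by (intro ring_hom_memI) (auto simp: closed_alg_def complex_alg_def)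
  then show ?thesis
    using B by (simp add: points_def calg_hom_def closed_alg_def \<psi>' x' complex_alg_def)
qed

text \<open>Points are contravariant, so the map of points is precomposition with the inverse of
  \<theta>, restricted to stay extensional.\<close>

lemma isomorphic_varietiesI:
  assumes \<theta>: "\<theta> \<in> calg_hom A B" and bij: "bij_betw \<theta> (carrier A) (carrier B)"
    and A: "closed_alg A" and B: "closed_alg B"
  shows "isomorphic_varieties A B"
proof -
  define \<psi> where "\<psi> = inv_into (carrier A) \<theta>"
  have \<psi>: "\<psi> \<in> calg_hom B A" unfolding \<psi>_def by (rule calg_hom_inverse[OF \<theta> bij A])
  have bij': "bij_betw \<psi> (carrier B) (carrier A)"
    unfolding \<psi>_def by (rule bij_betw_inv_into[OF bij])
  have l: "\<theta> (\<psi> f) = f" if "f \<in> carrier B" for f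
    unfolding \<psi>_def by (rule bij_betw_inv_into_right[OF bij that])
  have r: "\<psi> (\<theta> f) = f" if "f \<in> carrier A" for f
    unfolding \<psi>_def by (rule bij_betw_inv_into_left[OF bij that])
  have cl: "\<And>f. f \<in> carrier B \<Longrightarrow> \<psi> f \<in> carrier A" "\<And>f. f \<in> carrier A \<Longrightarrow> \<theta> f \<in> carrier B"
    using bij bij' by (auto simp: bij_betw_def)
  define \<phi> where "\<phi> x = restrict (\<lambda>f. x (\<psi> f)) (carrier B)" for x :: "'a \<Rightarrow> complex"
  have "bij_betw \<phi> (points A) (points B)"
  proof (rule bij_betw_byWitness[where f' = "\<lambda>y. restrict (\<lambda>f. y (\<theta> f)) (carrier A)"])
    show "\<forall>x\<in>points A. restrict (\<lambda>f. \<phi> x (\<theta> f)) (carrier A) = x"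
      using cl r by (auto simp: \<phi>_def points_def intro!: extensionalityI[of _ "carrier A"])
    show "\<forall>y\<in>points B. \<phi> (restrict (\<lambda>f. y (\<theta> f)) (carrier A)) = y"
      using cl l by (auto simp: \<phi>_def points_def intro!: extensionalityI[of _ "carrier B"])
    show "\<phi> ` points A \<subseteq> points B"
      unfolding \<phi>_def using points_pullback[OF \<psi> B] by blast
    show "(\<lambda>y. restrict (\<lambda>f. y (\<theta> f)) (carrier A)) ` points B \<subseteq> points A"
      using points_pullback[OF \<theta> A] by blast
  qed
  then show ?thesis
    unfolding isomorphic_varieties_def using \<psi> bij'
    by (intro exI[of _ \<phi>] exI[of _ \<psi>]) (simp add: \<phi>_def)
qed

section \<open>The coordinate algebra of the Calogero-Moser space\<close>

lemma polyfuns_sum3: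
  assumes "\<And>k :: 3. f k \<in> polyfuns" shows "(\<lambda>z. \<Sum>k\<in>UNIV. f k z) \<in> polyfuns"
  unfolding sum_3 by (intro polyfuns.add assms)

lemma polyfuns_cmult: "f \<in> polyfuns \<Longrightarrow> (\<lambda>z. c * f z) \<in> polyfuns"
  by (rule polyfuns.mult[OF polyfuns.const])

definition polymats :: "(mat3 \<times> mat3 \<Rightarrow> mat3) set" where
  "polymats = {M. \<forall>i j. (\<lambda>z. M z $ i $ j) \<in> polyfuns}"

lemma polymats_mult: "M \<in> polymats \<Longrightarrow> N \<in> polymats \<Longrightarrow> (\<lambda>z. M z ** N z) \<in> polymats"
  unfolding polymats_def matrix_matrix_mult_def by (auto intro!: polyfuns_sum3 polyfuns.mult)

lemma polyfuns_trace: "M \<in> polymats \<Longrightarrow> (\<lambda>z. trace (M z)) \<in> polyfuns"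
  unfolding polymats_def trace_def by (auto intro!: polyfuns_sum3)

lemma polymats_tfree:
  assumes M: "M \<in> polymats" shows "(\<lambda>z. tfree (M z)) \<in> polymats"
proof -
  have "(\<lambda>z. M z $ i $ j + (if i = j then - 1 / 3 else 0) * trace (M z)) \<in> polyfuns" for i j
    using M by (intro polyfuns.add polyfuns_cmult polyfuns_trace) (auto simp: polymats_def)
  moreover have "tfree (M z) $ i $ j = M z $ i $ j + (if i = j then - 1 / 3 else 0) * trace (M z)" for i j z
    by (simp add: tfree_def mat_def)
  ultimately show ?thesis unfolding polymats_def by simp
qed

lemma polymats_fst_snd: "fst \<in> polymats" "snd \<in> polymats"
  using polyfuns.entry_fst polyfuns.entry_snd by (auto simp: polymats_def case_prod_unfold)

lemma tau_polyfuns: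
  assumes "k \<in> {1..9}" shows "(\<lambda>z. tau l z k) \<in> polyfuns"
proof -
  have AB: "tA \<in> polymats" "tB \<in> polymats"
    using polymats_tfree[OF polymats_fst_snd(1)] polymats_tfree[OF polymats_fst_snd(2)]
    by (simp_all add: tA_def[abs_def] tB_def[abs_def])
  have "k = 1 \<or> k = 2 \<or> k = 3 \<or> k = 4 \<or> k = 5 \<or> k = 6 \<or> k = 7 \<or> k = 8 \<or> k = 9" using assms by auto
  then show ?thesis
    by (elim disjE; simp only: tau_simps;
      intro polyfuns_cmult polyfuns_trace polymats_mult AB polymats_fst_snd)
qed

lemma ev_tau_polyfuns: "p \<in> polys {1..9} \<Longrightarrow> (\<lambda>z. ev (tau l z) p) \<in> polyfuns"
proof (induction rule: polys_induct)
  case (Cst c) show ?case unfolding ev_Cst by (rule polyfuns.const)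
next
  case (add p q) then show ?case unfolding ev_add by (rule polyfuns.add)
next
  case (Var i p) then show ?case unfolding ev_mult ev_Var by (intro polyfuns.mult tau_polyfuns)
qed

lemma tau_conj_act:
  assumes g: "invertible g" shows "tau l (conj_act g z) = tau l z"
proof -
  let ?h = "matrix_inv g"
  note gh = matrix_inv_mult[OF g]
  have m: "(g ** U ** ?h) ** (g ** W ** ?h) = g ** (U ** W) ** ?h" for U W
    by (metis gh(1) matrix_mul_assoc matrix_mul_rid)
  have tr: "trace (g ** U ** ?h) = trace U" for U
    by (metis gh(1) matrix_mul_assoc matrix_mul_lid trace_mul_sym)
  have tf: "tfree (g ** U ** ?h) = g ** tfree U ** ?h" for U
    by (simp add: tfree_def tr matrix_diff_ldistrib matrix_diff_rdistrib mat_commute[of g])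
      (simp add: gh flip: matrix_mul_assoc)
  have f: "fst (conj_act g z) = g ** fst z ** ?h" "snd (conj_act g z) = g ** snd z ** ?h"
    by (simp_all add: conj_act_def case_prod_unfold)
  have "tA (conj_act g z) = g ** tA z ** ?h" "tB (conj_act g z) = g ** tB z ** ?h"
    by (simp_all add: tA_def tB_def f tf)
  then show ?thesis unfolding tau_def f by (simp only: m tr)
qed

section \<open>The homomorphism from polynomials onto invariant functions\<close>

definition Phi :: "complex \<Rightarrow> cpoly \<Rightarrow> mat3 \<times> mat3 \<Rightarrow> complex" where
  "Phi l p = restrict (\<lambda>z. ev (tau l z) p) CMbar"

lemma C3_simps:
  "mult C3 (Phi l p) (Phi l q) = Phi l (p * q)" "add C3 (Phi l p) (Phi l q) = Phi l (p + q)"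
  "one C3 = Phi l 1" "zero C3 = Phi l 0" "scalar C3 c = Phi l (Cst c)"
  by (auto simp: C3_def GL3_quotient_def regular_calg_def Phi_def)

lemma (in scaled) carrier_C3: "carrier C3 = Phi l ` polys {1..9}"
proof
  show "carrier C3 \<subseteq> Phi l ` polys {1..9}"
  proof
    fix f assume "f \<in> carrier C3"
    then obtain f0 where f: "f = restrict f0 CMbar" "f0 \<in> polyfuns"
      and inv: "\<And>g z. invertible g \<Longrightarrow> z \<in> CMbar \<Longrightarrow> f (conj_act g z) = f z"
      by (auto simp: C3_def GL3_quotient_def regular_calg_def)
    \<comment> \<open>Invariance is recorded for the restriction \<open>f\<close>; it passes to
      \<open>f0\<close> on \<open>CMbar\<close> because conjugation preserves
      \<open>CMbar\<close>.\<close>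
    have "f0 (conj_act g z) = f0 z" if "invertible g" "z \<in> CMbar" for g z
      using inv[OF that] that conj_act_CMbar[OF that(2,1)] by (simp add: f)
    then have "trace_poly f0" by (rule invariant_trace_poly[OF f(2)])
    then obtain p where "p \<in> polys {1..9}" "\<forall>z\<in>CMbar. f0 z = ev (tau l z) p"
      by (auto simp: trace_poly_def)
    then show "f \<in> Phi l ` polys {1..9}"
      by (auto simp: f(1) Phi_def intro!: image_eqI[of _ _ p] restrict_ext)
  qed
  show "Phi l ` polys {1..9} \<subseteq> carrier C3"
    using ev_tau_polyfuns conj_act_CMbar
    by (auto simp: C3_def GL3_quotient_def regular_calg_def Phi_def tau_conj_act)
qed

lemma (in scaled) ring_C3: "ring C3"
proof (rule ringI)
  note simps = carrier_C3 C3_simps[where l = l]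
  show "abelian_group C3"
  proof (rule abelian_groupI)
    fix x assume "x \<in> carrier C3"
    then obtain p where p: "p \<in> polys {1..9}" "x = Phi l p" by (auto simp: carrier_C3)
    have "Phi l (- p) \<oplus>\<^bsub>C3\<^esub> x = \<zero>\<^bsub>C3\<^esub>" by (simp add: p C3_simps[where l = l])
    then show "\<exists>y\<in>carrier C3. y \<oplus>\<^bsub>C3\<^esub> x = \<zero>\<^bsub>C3\<^esub>"
      using p by (intro bexI[of _ "Phi l (- p)"]) (auto simp: carrier_C3)
  qed (auto simp: simps algebra_simps)
  show "Group.monoid C3"
    by (rule monoidI) (auto simp: simps algebra_simps)
qed (auto simp: carrier_C3 C3_simps[where l = l] algebra_simps)

lemma (in scaled) ring_hom_Phi: "ring_hom_ring (poly_calg {1..9}) C3 (Phi l)"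
proof (rule ring_hom_ringI2)
  show "ring (poly_calg {1..9})" using cring_poly_calg by (rule cring.axioms(1))
  show "ring C3" by (rule ring_C3)
  show "Phi l \<in> ring_hom (poly_calg {1..9}) C3"
    by (rule ring_hom_memI) (auto simp: carrier_C3 C3_simps[where l = l])
qed

lemma (in scaled) kernel_Phi:
  assumes "v = - 3 * l ^ 4"
  shows "a_kernel (poly_calg {1..9}) C3 (Phi l) = rel_ideal v"
proof -
  have "Phi l p = \<zero>\<^bsub>C3\<^esub> \<longleftrightarrow> (\<forall>z\<in>CMbar. ev (tau l z) p = 0)" for p
    by (auto simp: C3_simps(4)[where l = l] Phi_def restrict_def fun_eq_iff)
  then show ?thesis
    using rel_ideal_iff[OF assms] rel_ideal_subset[of v] by (auto simp: a_kernel_def')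
qed

lemma C3v_simps:
  "carrier (C3v v) = carrier (poly_calg {1..9} Quot rel_ideal v)"
  "mult (C3v v) = mult (poly_calg {1..9} Quot rel_ideal v)"
  "add (C3v v) = add (poly_calg {1..9} Quot rel_ideal v)"
  "one (C3v v) = one (poly_calg {1..9} Quot rel_ideal v)"
  "scalar (C3v v) c = rel_ideal v +>\<^bsub>poly_calg {1..9}\<^esub> Cst c"
  by (simp_all add: C3v_def quot_calg_def ring.defs rel_ideal_def)

lemma (in scaled) isomorphic_scaled:
  assumes v: "v = - 3 * l ^ 4"
  shows "isomorphic_varieties (C3v v) C3"
proof -
  interpret h: ring_hom_ring "poly_calg {1..9}" C3 "Phi l" by (rule ring_hom_Phi)
  interpret I: ideal "rel_ideal v" "poly_calg {1..9}" by (rule ideal_rel_ideal)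
  interpret Q: ring "poly_calg {1..9} Quot rel_ideal v" by (rule I.quotient_is_ring)
  \<comment> \<open>\<open>Phi l\<close> is constant on each coset of its kernel, so the image of a
    coset is a singleton and \<open>the_elem\<close> picks the induced value.\<close>
  define \<theta> where "\<theta> X = the_elem (Phi l ` X)" for X
  have iso: "\<theta> \<in> ring_iso (poly_calg {1..9} Quot rel_ideal v) C3"
    using h.FactRing_iso_set unfolding kernel_Phi[OF v] \<theta>_def[abs_def] by (simp add: carrier_C3)
  have sc: "scalar (C3v v) c \<in> carrier (C3v v)" for c
    using h.R.a_rcosetsI[of "rel_ideal v" "Cst c"] rel_ideal_subset[of v] by (simp add: C3v_simps FactRing_def)
  have "\<theta> (scalar (C3v v) c) = scalar C3 c" for c
    using h.the_elem_simp[of "Cst c"] unfolding kernel_Phi[OF v]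
    by (simp add: C3v_simps \<theta>_def C3_simps[where l = l])
  then have hom: "\<theta> \<in> calg_hom (C3v v) C3"
    using iso by (simp add: calg_hom_def ring_iso_def ring_hom_def C3v_simps)
  have bij: "bij_betw \<theta> (carrier (C3v v)) (carrier C3)"
    using iso by (simp add: ring_iso_def C3v_simps)
  show ?thesis
  proof (rule isomorphic_varietiesI[OF hom bij])
    show "closed_alg (C3v v)"
      using sc Q.m_closed Q.a_closed Q.one_closed unfolding closed_alg_def C3v_simps by blast
    show "closed_alg C3"
      by (auto simp: closed_alg_def carrier_C3 C3_simps[where l = l])
  qed
qed

theorem theorem5p2:
  fixes v :: complex
  assumes "v \<noteq> 0"
  shows "isomorphic_varieties (C3v v) C3"
proof -
  \<comment> \<open>A fourth root of \<open>- v / 3\<close>, nonzero because \<open>v\<close>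
    is.\<close>
  define l where "l = csqrt (csqrt (- v / 3))"
  have "l ^ 4 = (l ^ 2) ^ 2" by (simp flip: power_mult)
  then have l4: "l ^ 4 = - v / 3" by (simp add: l_def)
  then have "scaled l" using assms by unfold_locales auto
  then show ?thesis by (rule scaled.isomorphic_scaled) (simp add: l4)
qed

end
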